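(* Let $r\ge2$. Assume that $\psi^{\prime\prime}>0$. Then: \begin{enumerate} \item All geodesics in $\mathcal{M}_{3,r,\psi}$ extend for infinite time. \item $\exp_P:T_P\mathbb{R}^{2r+2}\rightarrow\mathbb{R}^{2r+2}$ is a diffeomorphism for all $P$ in $\mathbb{R}^{2r+2}$. \item The non-zero components of $R_{3,r,\psi}$ and of $\nabla R_{3,r,\psi}$ are given by: \begin{enumerate} \item $R_{3,r,\psi}(\partial_x,\partial_{u_r},\partial_{u_r},\partial_x)=\psi^{\prime\prime}(u_r)$, \item $R_{3,r,\psi}(\partial_x,\partial_{u_i},\partial_{v_{i+1}},\partial_x)=1$ for $1\le i\le r-1$, \item $\nabla R_{3,r,\psi}(\partial_x,\partial_{u_r},\partial_{u_r},\partial_x;\partial_{u_r})=\psi^{\prime\prime\prime}(u_r)$. \end{enumerate} \item $\mathcal{U}_{3,r}$ is an irreducible $0$-model for $\mathcal{M}_{3,r,\psi}$. \item If $\psi(u_r)=u_r^2$, then $\mathcal{M}_{3,r,\psi}$ is an irreducible symmetric space. \item If $\psi^{\prime\prime\prime}>0$, then: \begin{enumerate} \item $\mathcal{U}_{3,r}^1$ is a $1$-model for $\mathcal{M}_{3,r,\psi}$, \item $\mathcal{M}_{3,r,\psi}$ is not $2$-curvature homogeneous. \end{enumerate} \end{enumerate}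
   Context: Let $r\ge2$. Introduce coordinates $(\vec u,\vec v,x,y)$ on $\mathbb{R}^{2r+2}$ with $\vec u=(u_1,\dots,u_r)$, $\vec v=(v_1,\dots,v_r)$. Let $\psi\in C^\infty(\mathbb{R})$ and let $\mathcal{M}_{3,r,\psi}:=(\mathbb{R}^{2r+2},g_{3,r,\psi})$ be the pseudo-Riemannian manifold (of signature $(r+1,r+1)$) whose metric has non-zero components (up to symmetry) $g_{3,r,\psi}(\partial_x,\partial_y)=1$, $g_{3,r,\psi}(\partial_{u_i},\partial_{v_j})=\delta_{ij}$, and $g_{3,r,\psi}(\partial_x,\partial_x)=-2u_1v_2-\dots-2u_{r-1}v_r-2\psi(u_r)$. Let $R_{3,r,\psi}$ be its Riemann curvature tensor and $\nabla R_{3,r,\psi}$ its covariant derivative. (Components of tensors are listed only up to the usual $\mathbb{Z}_2$ symmetries.) Let $\mathbb{R}^{2r+2}=\operatorname{Span}\{U_1,\dots,U_r,V_1,\dots,V_r,X,Y\}$ and let $\mathcal{U}_{3,r}:=(\mathbb{R}^{2r+2},g_{3,r},A_{3,r})$, where the inner product $g_{3,r}$ has non-zero components $g_{3,r}(X,Y)=1$, $g_{3,r}(U_i,V_j)=\delta_{ij}$, and the algebraic curvature tensor $A_{3,r}$ has non-zero components $A_{3,r}(X,U_r,U_r,X)=1$ and $A_{3,r}(X,U_i,V_{i+1},X)=1$ for $1\le i\le r-1$. Let $\mathcal{U}_{3,r}^1:=(\mathbb{R}^{2r+2},g_{3,r},A_{3,r},A^1_{3,r})$ where the algebraic covariant derivative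 curvature tensor $A^1_{3,r}$ has non-zero component $A^1_{3,r}(X,U_r,U_r,X;U_r)=1$. A triple $(V,g,A)$ is a $0$-model for a pseudo-Riemannian manifold $(M,g_M)$ if for every $P\in M$ there is an isomorphism $\Phi_P:T_PM\to V$ with $\Phi_P^*g=g_M|_{T_PM}$ and $\Phi_P^*A=R_M|_{T_PM}$; a quadruple $(V,g,A,A^1)$ is a $1$-model if in addition $\Phi_P^*A^1=\nabla R_M|_{T_PM}$. The manifold is $k$-curvature homogeneous if the analogous condition holds for $R_M,\nabla R_M,\dots,\nabla^kR_M$ simultaneously. A model is irreducible if it admits no non-trivial orthogonal direct sum decomposition $V=V_1\oplus V_2$, $g=g^1\oplus g^2$, $A=A^1\oplus A^2$. *)

theory Defs
  imports "HOL-Analysis.Analysis"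
begin

definition Rn :: "nat \<Rightarrow> (nat \<Rightarrow> real) set" where
  "Rn n = {p. \<forall>i. n \<le> i \<longrightarrow> p i = 0}"

definition kd :: "nat \<Rightarrow> nat \<Rightarrow> real" where
  "kd i j = (if i = j then 1 else 0)"

definition pd :: "nat \<Rightarrow> ((nat \<Rightarrow> real) \<Rightarrow> real) \<Rightarrow> (nat \<Rightarrow> real) \<Rightarrow> real" where
  "pd k f p = deriv (\<lambda>t. f (p(k := t))) (p k)"

fun iter_pd :: "nat list \<Rightarrow> ((nat \<Rightarrow> real) \<Rightarrow> real) \<Rightarrow> (nat \<Rightarrow> real) \<Rightarrow> real" where
  "iter_pd [] f = f"
| "iter_pd (k # ks) f = pd k (iter_pd ks f)"

definition smooth_on :: "nat \<Rightarrow> (nat \<Rightarrow> real) set \<Rightarrow> ((nat \<Rightarrow> real) \<Rightarrow> real) \<Rightarrow> bool" where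
  "smooth_on n S f \<longleftrightarrow>
     (\<forall>ks. set ks \<subseteq> {..<n} \<longrightarrow>
        continuous_on S (iter_pd ks f) \<and>
        (\<forall>k<n. \<forall>p\<in>S. (\<lambda>t. iter_pd ks f (p(k := t))) differentiable (at (p k))))"

definition smooth_map_on :: "nat \<Rightarrow> (nat \<Rightarrow> real) set \<Rightarrow> ((nat \<Rightarrow> real) \<Rightarrow> (nat \<Rightarrow> real)) \<Rightarrow> bool" where
  "smooth_map_on n S F \<longleftrightarrow> (\<forall>p\<in>S. F p \<in> Rn n) \<and> (\<forall>i<n. smooth_on n S (\<lambda>p. F p i))"

definition diffeo_betw :: "nat \<Rightarrow> (nat \<Rightarrow> real) set \<Rightarrow> (nat \<Rightarrow> real) set
    \<Rightarrow> ((nat \<Rightarrow> real) \<Rightarrow> (nat \<Rightarrow> real)) \<Rightarrow> bool" where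
  "diffeo_betw n S T F \<longleftrightarrow> smooth_map_on n S F \<and> F ` S = T \<and>
     (\<exists>G. smooth_map_on n T G \<and> G ` T = S \<and> (\<forall>p\<in>S. G (F p) = p) \<and> (\<forall>q\<in>T. F (G q) = q))"

definition Jac :: "((nat \<Rightarrow> real) \<Rightarrow> (nat \<Rightarrow> real)) \<Rightarrow> (nat \<Rightarrow> real) \<Rightarrow> nat \<Rightarrow> nat \<Rightarrow> real" where
  "Jac F p i j = pd j (\<lambda>q. F q i) p"

type_synonym metric = "(nat \<Rightarrow> real) \<Rightarrow> nat \<Rightarrow> nat \<Rightarrow> real"
type_synonym tfield = "(nat \<Rightarrow> real) \<Rightarrow> nat list \<Rightarrow> real"

definition ginv :: "nat \<Rightarrow> metric \<Rightarrow> metric" where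
  "ginv n g p = (SOME h. \<forall>i<n. \<forall>j<n. (\<Sum>k<n. g p i k * h k j) = kd i j)"

text \<open>Christoffel symbols of the first kind: g(nabla_{d_i} d_j, d_k)\<close>
definition Chr1 :: "nat \<Rightarrow> metric \<Rightarrow> (nat \<Rightarrow> real) \<Rightarrow> nat \<Rightarrow> nat \<Rightarrow> nat \<Rightarrow> real" where
  "Chr1 n g p i j k =
     (pd i (\<lambda>q. g q j k) p + pd j (\<lambda>q. g q i k) p - pd k (\<lambda>q. g q i j) p) / 2"

definition Chr :: "nat \<Rightarrow> metric \<Rightarrow> (nat \<Rightarrow> real) \<Rightarrow> nat \<Rightarrow> nat \<Rightarrow> nat \<Rightarrow> real" where
  "Chr n g p l i j = (\<Sum>k<n. ginv n g p l k * Chr1 n g p i j k)"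

text \<open>R(d_i,d_j)d_k = sum_l Rup l i j k d_l with R(X,Y) = nabla_X nabla_Y - nabla_Y nabla_X - nabla_[X,Y]\<close>
definition Rup :: "nat \<Rightarrow> metric \<Rightarrow> (nat \<Rightarrow> real) \<Rightarrow> nat \<Rightarrow> nat \<Rightarrow> nat \<Rightarrow> nat \<Rightarrow> real" where
  "Rup n g p l i j k =
     pd i (\<lambda>q. Chr n g q l j k) p - pd j (\<lambda>q. Chr n g q l i k) p
     + (\<Sum>m<n. Chr n g p m j k * Chr n g p l i m - Chr n g p m i k * Chr n g p l j m)"

definition Rt :: "nat \<Rightarrow> metric \<Rightarrow> tfield" where
  "Rt n g p is = (case is of [i, j, k, l] \<Rightarrow> (\<Sum>m<n. Rup n g p m i j k * g p m l) | _ \<Rightarrow> 0)"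

definition covd :: "nat \<Rightarrow> metric \<Rightarrow> tfield \<Rightarrow> tfield" where
  "covd n g T p is =
     (if is = [] then 0 else
        (let is0 = butlast is; j = last is in
           pd j (\<lambda>q. T q is0) p
           - (\<Sum>s<length is0. \<Sum>l<n. Chr n g p l j (is0 ! s) * T p (is0[s := l]))))"

definition nablaR :: "nat \<Rightarrow> metric \<Rightarrow> nat \<Rightarrow> tfield" where
  "nablaR n g k = (covd n g ^^ k) (Rt n g)"

definition geodesic :: "nat \<Rightarrow> metric \<Rightarrow> real set \<Rightarrow> (real \<Rightarrow> nat \<Rightarrow> real) \<Rightarrow> bool" where
  "geodesic n g I \<gamma> \<longleftrightarrow> (\<forall>t\<in>I. \<gamma> t \<in> Rn n) \<and>
     (\<exists>\<gamma>1 \<gamma>2. \<forall>t\<in>I. \<forall>l<n.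
        ((\<lambda>s. \<gamma> s l) has_real_derivative \<gamma>1 t l) (at t) \<and>
        ((\<lambda>s. \<gamma>1 s l) has_real_derivative \<gamma>2 t l) (at t) \<and>
        \<gamma>2 t l + (\<Sum>i<n. \<Sum>j<n. Chr n g (\<gamma> t) l i j * \<gamma>1 t i * \<gamma>1 t j) = 0)"

definition geod_complete :: "nat \<Rightarrow> metric \<Rightarrow> bool" where
  "geod_complete n g \<longleftrightarrow>
     (\<forall>I \<gamma>. open I \<and> is_interval I \<and> I \<noteq> {} \<and> geodesic n g I \<gamma> \<longrightarrow>
        (\<exists>\<delta>. geodesic n g UNIV \<delta> \<and> (\<forall>t\<in>I. \<delta> t = \<gamma> t)))"

text \<open>T_P R^n is identified with R^n via the coordinate frame\<close>
definition exp_map :: "nat \<Rightarrow> metric \<Rightarrow> (nat \<Rightarrow> real) \<Rightarrow> (nat \<Rightarrow> real) \<Rightarrow> (nat \<Rightarrow> real)" where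
  "exp_map n g P v = (THE q. \<exists>\<gamma>. geodesic n g UNIV \<gamma> \<and> \<gamma> 0 = P \<and>
      (\<forall>k<n. ((\<lambda>s. \<gamma> s k) has_real_derivative v k) (at 0)) \<and> q = \<gamma> 1)"

definition tens2 :: "(nat \<Rightarrow> nat \<Rightarrow> real) \<Rightarrow> nat list \<Rightarrow> real" where
  "tens2 b is = (case is of [i, j] \<Rightarrow> b i j | _ \<Rightarrow> 0)"

definition eqT :: "nat \<Rightarrow> nat \<Rightarrow> (nat list \<Rightarrow> real) \<Rightarrow> (nat list \<Rightarrow> real) \<Rightarrow> bool" where
  "eqT n m S T \<longleftrightarrow> (\<forall>is. length is = m \<and> set is \<subseteq> {..<n} \<longrightarrow> S is = T is)"

text \<open>Pullback of a tensor by the linear map whose matrix is M (column a = image of e_a)\<close>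
definition pullT :: "nat \<Rightarrow> (nat \<Rightarrow> nat \<Rightarrow> real) \<Rightarrow> (nat list \<Rightarrow> real) \<Rightarrow> nat list \<Rightarrow> real" where
  "pullT n M T is = (\<Sum>js\<in>{js. length js = length is \<and> set js \<subseteq> {..<n}}.
       (\<Prod>t<length is. M (js ! t) (is ! t)) * T js)"

definition invertible_mat :: "nat \<Rightarrow> (nat \<Rightarrow> nat \<Rightarrow> real) \<Rightarrow> bool" where
  "invertible_mat n M \<longleftrightarrow> (\<exists>N. (\<forall>i<n. \<forall>j<n. (\<Sum>k<n. M i k * N k j) = kd i j) \<and>
                                 (\<forall>i<n. \<forall>j<n. (\<Sum>k<n. N i k * M k j) = kd i j))"

text \<open>(V,gV,As!0,...,As!(k-1)) is a (k-1)-model for (R^n,g)\<close>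
definition is_model :: "nat \<Rightarrow> (nat \<Rightarrow> nat \<Rightarrow> real) \<Rightarrow> (nat list \<Rightarrow> real) list \<Rightarrow> metric \<Rightarrow> bool" where
  "is_model n gV As g \<longleftrightarrow> (\<forall>P\<in>Rn n. \<exists>\<Phi>. invertible_mat n \<Phi> \<and>
      eqT n 2 (pullT n \<Phi> (tens2 gV)) (tens2 (g P)) \<and>
      (\<forall>j<length As. eqT n (4 + j) (pullT n \<Phi> (As ! j)) (nablaR n g j P)))"

definition curv_hom :: "nat \<Rightarrow> metric \<Rightarrow> nat \<Rightarrow> bool" where
  "curv_hom n g k \<longleftrightarrow> (\<forall>P\<in>Rn n. \<forall>Q\<in>Rn n. \<exists>\<Phi>. invertible_mat n \<Phi> \<and>
      eqT n 2 (pullT n \<Phi> (tens2 (g Q))) (tens2 (g P)) \<and>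
      (\<forall>j\<le>k. eqT n (4 + j) (pullT n \<Phi> (nablaR n g j Q)) (nablaR n g j P)))"

text \<open>A 0-model (V,gV,A) is irreducible if there is no nontrivial gV-orthogonal
  direct sum decomposition V = V1 + V2 with A = A1 + A2; here pi is the projection onto V1 along V2.\<close>
definition irreducible_model :: "nat \<Rightarrow> (nat \<Rightarrow> nat \<Rightarrow> real) \<Rightarrow> (nat list \<Rightarrow> real) \<Rightarrow> bool" where
  "irreducible_model n gV A \<longleftrightarrow> \<not> (\<exists>\<pi>.
      (\<forall>a<n. \<forall>b<n. (\<Sum>c<n. \<pi> a c * \<pi> c b) = \<pi> a b) \<and>
      (\<exists>a<n. \<exists>b<n. \<pi> a b \<noteq> 0) \<and> (\<exists>a<n. \<exists>b<n. \<pi> a b \<noteq> kd a b) \<and>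
      (\<forall>a<n. \<forall>b<n. (\<Sum>i<n. \<Sum>j<n. \<pi> i a * (kd j b - \<pi> j b) * gV i j) = 0) \<and>
      eqT n 4 A (\<lambda>is. pullT n \<pi> A is + pullT n (\<lambda>i j. kd i j - \<pi> i j) A is))"

definition isometry_betw :: "nat \<Rightarrow> metric \<Rightarrow> metric \<Rightarrow> (nat \<Rightarrow> real) set \<Rightarrow> (nat \<Rightarrow> real) set
    \<Rightarrow> ((nat \<Rightarrow> real) \<Rightarrow> (nat \<Rightarrow> real)) \<Rightarrow> bool" where
  "isometry_betw n g h S T F \<longleftrightarrow> diffeo_betw n S T F \<and>
     (\<forall>p\<in>S. \<forall>a<n. \<forall>b<n. (\<Sum>i<n. \<Sum>j<n. Jac F p i a * Jac F p j b * h (F p) i j) = g p a b)"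

text \<open>globally symmetric: every point is an isolated fixed point of an isometric geodesic symmetry\<close>
definition symmetric_space :: "nat \<Rightarrow> metric \<Rightarrow> bool" where
  "symmetric_space n g \<longleftrightarrow> (\<forall>P\<in>Rn n. \<exists>\<sigma>. isometry_betw n g g (Rn n) (Rn n) \<sigma> \<and> \<sigma> P = P \<and>
      (\<forall>i<n. \<forall>j<n. Jac \<sigma> P i j = - kd i j))"

definition product_metric :: "nat \<Rightarrow> nat \<Rightarrow> metric \<Rightarrow> (nat \<Rightarrow> real) set \<Rightarrow> bool" where
  "product_metric n k h T \<longleftrightarrow>
     (\<forall>q\<in>T. \<forall>a<k. \<forall>b. k \<le> b \<and> b < n \<longrightarrow> h q a b = 0 \<and> h q b a = 0) \<and>
     (\<forall>q\<in>T. \<forall>q'\<in>T. (\<forall>i<k. q i = q' i) \<longrightarrow> (\<forall>a<k. \<forall>b<k. h q a b = h q' a b)) \<and>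
     (\<forall>q\<in>T. \<forall>q'\<in>T. (\<forall>i. k \<le> i \<and> i < n \<longrightarrow> q i = q' i) \<longrightarrow>
        (\<forall>a b. k \<le> a \<and> a < n \<and> k \<le> b \<and> b < n \<longrightarrow> h q a b = h q' a b))"

definition locally_reducible :: "nat \<Rightarrow> metric \<Rightarrow> bool" where
  "locally_reducible n g \<longleftrightarrow> (\<exists>P\<in>Rn n. \<exists>U T F h k. 0 < k \<and> k < n \<and> P \<in> U \<and>
      openin (top_of_set (Rn n)) U \<and> openin (top_of_set (Rn n)) T \<and>
      isometry_betw n g h U T F \<and> product_metric n k h T)"

definition irreducible_mfd :: "nat \<Rightarrow> metric \<Rightarrow> bool" where
  "irreducible_mfd n g \<longleftrightarrow> \<not> locally_reducible n g"

text \<open>coordinate indices: u_i -> i-1, v_i -> r+i-1 (1 <= i <= r), x -> 2r, y -> 2r+1\<close>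
definition uI :: "nat \<Rightarrow> nat \<Rightarrow> nat" where "uI r i = i - 1"
definition vI :: "nat \<Rightarrow> nat \<Rightarrow> nat" where "vI r i = r + i - 1"
definition xI :: "nat \<Rightarrow> nat" where "xI r = 2 * r"
definition yI :: "nat \<Rightarrow> nat" where "yI r = 2 * r + 1"

definition g_flat :: "nat \<Rightarrow> nat \<Rightarrow> nat \<Rightarrow> real" where
  "g_flat r a b =
     (if (a = xI r \<and> b = yI r) \<or> (a = yI r \<and> b = xI r) then 1 else 0)
   + (if \<exists>i\<in>{1..r}. (a = uI r i \<and> b = vI r i) \<or> (a = vI r i \<and> b = uI r i) then 1 else 0)"

definition gM :: "nat \<Rightarrow> (real \<Rightarrow> real) \<Rightarrow> metric" where
  "gM r \<psi> p a b = g_flat r a b +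
     (if a = xI r \<and> b = xI r then
        - 2 * (\<Sum>i\<in>{1..r-1}. p (uI r i) * p (vI r (i + 1))) - 2 * \<psi> (p (uI r r))
      else 0)"

text \<open>The algebraic curvature tensor whose only non-zero components, up to the
  usual Z2 symmetries, are A(X,a,b,X) = Q a b (Q symmetric, Q(X,.) = 0)\<close>
definition curvQ :: "nat \<Rightarrow> (nat \<Rightarrow> nat \<Rightarrow> real) \<Rightarrow> nat \<Rightarrow> nat \<Rightarrow> nat \<Rightarrow> nat \<Rightarrow> real" where
  "curvQ X Q a b c d =
     (if a = X \<and> d = X then Q b c else 0) + (if b = X \<and> c = X then Q a d else 0)
   - (if a = X \<and> c = X then Q b d else 0) - (if b = X \<and> d = X then Q a c else 0)"

definition Qchain :: "nat \<Rightarrow> nat \<Rightarrow> nat \<Rightarrow> real" where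
  "Qchain r a b = (if \<exists>i\<in>{1..r-1}. (a = uI r i \<and> b = vI r (i + 1)) \<or> (a = vI r (i + 1) \<and> b = uI r i)
                   then 1 else 0)"

definition Qur :: "nat \<Rightarrow> real \<Rightarrow> nat \<Rightarrow> nat \<Rightarrow> real" where
  "Qur r c a b = (if a = uI r r \<and> b = uI r r then c else 0)"

definition AU :: "nat \<Rightarrow> nat list \<Rightarrow> real" where
  "AU r is = (case is of [a, b, c, d] \<Rightarrow> curvQ (xI r) (\<lambda>a b. Qur r 1 a b + Qchain r a b) a b c d
              | _ \<Rightarrow> 0)"

definition AU1 :: "nat \<Rightarrow> nat list \<Rightarrow> real" where
  "AU1 r is = (case is of [a, b, c, d, e] \<Rightarrow>
                 (if e = uI r r then curvQ (xI r) (Qur r 1) a b c d else 0)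
              | _ \<Rightarrow> 0)"

end

theory Submission
  imports Defs
begin

text \<open>The non-zero Christoffel symbols all involve \<open>x\<close> and are, up to sign, the partial
  derivatives of \<open>F = u\<^sub>1 v\<^sub>2 + \<dots> + u\<^bsub>r-1\<^esub> v\<^sub>r + \<psi>(u\<^sub>r)\<close>. Hence the
  curvature is the Hessian of \<open>F\<close>, its covariant derivatives come from \<open>\<psi>\<close> alone, and the geodesic
  equations are triangular: \<open>x\<close> is affine, every other coordinate is obtained from the previous ones
  by integration. This gives completeness, and the exponential map is inverted by prescribing the
  endpoint instead of the velocity in the same recursion.

  Rescaling the coordinate frame turns the curvature into the model tensors. The second covariant
  derivative contains the extra component \<open>- u\<^bsub>r-1\<^esub> \<psi>'''(u\<^sub>r)\<close> in the directions
  \<open>(x, x)\<close>, whose vanishing is invariant, so no \<open>2\<close>-model exists. In an orthogonal splitting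
  compatible with the curvature one summand has to lie in the totally isotropic kernel of the Hessian
  of \<open>F\<close> inside the hyperplane \<open>\<xi> = dx = 0\<close>, hence vanishes.

  For \<open>\<psi>(u) = u\<^sup>2\<close> the geodesic symmetries are written down explicitly. In a local product chart
  Koszul's formula makes the mixed covariant derivatives of the coordinate fields vanish, so the
  curvature splits orthogonally at each point, which the algebraic irreducibility excludes.\<close>

section \<open>Christoffel symbols and curvature\<close>

text \<open>Points are sequences supported on the first n indices, and smoothness means iterated
  partial derivatives. The exponential map and its inverse are therefore given explicitly and placed
  in a class of functions closed under partial derivatives, instead of appealing to an inverse
  function theorem; the spare coordinate n carries the time of a geodesic. The rescaling to the
  models has two free scales, \<alpha> for x and l for u_r. The chain components fix the scales of
  the other u_i, and the remaining conditions are \<alpha>^2 l^2 = \<psi>'' and \<alpha>^2 l^3 =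
  \<psi>'''; they are solvable when both derivatives are positive, and afterwards no scale is left
  to absorb the second covariant derivative. A local isometry onto a product only provides a chart.
  Rather than transforming Christoffel symbols and curvature into it, the coordinate fields of the
  chart are treated as vector fields along its inverse map into the original coordinates, where the
  connection is already known.\<close>

definition dual :: "nat \<Rightarrow> nat \<Rightarrow> nat" where
  "dual r i = (if i < r then r + i else if i < 2 * r then i - r
     else if i = 2 * r then 2 * r + 1 else if i = 2 * r + 1 then 2 * r else i)"

text \<open>The function F of the overview in 0-based indices: \<open>p i\<close> is u_(i+1),
  \<open>p (r + i + 1)\<close> is v_(i+2), \<open>p (r - 1)\<close> is u_r.\<close>

definition pot :: "nat \<Rightarrow> (real \<Rightarrow> real) \<Rightarrow> (nat \<Rightarrow> real) \<Rightarrow> real" where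
  "pot r \<psi> p = (\<Sum>i<r - 1. p i * p (r + i + 1)) + \<psi> (p (r - 1))"

text \<open>The gradient of \<open>pot\<close>, with \<open>\<phi>\<close> in the place of
  \<open>\<psi>'\<close>. Keeping \<open>\<phi>\<close> as a parameter lets the same formula express
  the Hessian applied to a vector: there \<open>\<phi>\<close> is multiplication by
  \<open>\<psi>''\<close>. The index r, which is v_1, gives 0 because F does not depend on
  v_1.\<close>

definition dpot :: "nat \<Rightarrow> (real \<Rightarrow> real) \<Rightarrow> (nat \<Rightarrow> real) \<Rightarrow> nat \<Rightarrow> real" where
  "dpot r \<phi> p k = (if k < r - 1 then p (r + k + 1) else if k = r - 1 then \<phi> (p (r - 1))
     else if r < k \<and> k < 2 * r then p (k - r - 1) else 0)"

definition hess :: "nat \<Rightarrow> real \<Rightarrow> nat \<Rightarrow> nat \<Rightarrow> real" where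
  "hess r c a b = Qur r c a b + Qchain r a b"

lemma pd_eqI: "((\<lambda>t. f (p(k := t))) has_real_derivative d) (at (p k)) \<Longrightarrow> pd k f p = d"
  unfolding pd_def by (rule DERIV_imp_deriv)

lemma fun_upd_coord_deriv: "((\<lambda>t. (p(k := t)) i) has_real_derivative kd k i) (at t0)"
  by (cases "i = k") (auto simp: kd_def)

text \<open>Moves any of the four slots to the front, so that a derivation acting on all slots has
  to be evaluated in the first one only.\<close>

lemma curvQ_skew_swap:
  assumes Q: "\<And>i j. Q i j = Q j i"
  shows "curvQ X Q a l c d = - curvQ X Q l a c d" "curvQ X Q a b l d = curvQ X Q l d a b"
     "curvQ X Q a b c l = - curvQ X Q l c a b"
  unfolding curvQ_def Q[of d a] Q[of l b] Q[of d b] Q[of l a] Q[of c a] Q[of c b] by (simp_all add: conj_commute)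

lemma curvQ_zero: "curvQ X (\<lambda>i j. 0) a b c d = 0"
  by (simp add: curvQ_def)

lemma curvQ_has_derivative:
  assumes "\<And>i j. ((\<lambda>t. Q t i j) has_real_derivative Q' i j) (at x within S)"
  shows "((\<lambda>t. curvQ X (Q t) a b c d) has_real_derivative curvQ X Q' a b c d) (at x within S)"
proof -
  have *: "((\<lambda>t. if P then Q t i j else 0) has_real_derivative (if P then Q' i j else 0)) (at x within S)" for P i j
    using assms by auto
  show ?thesis unfolding curvQ_def by (intro DERIV_add DERIV_diff *)
qed

lemma Qur_sym: "Qur r c i j = Qur r c j i"
  by (auto simp: Qur_def)

lemma hess_sym: "hess r c i j = hess r c j i"
proof -
  have "Qchain r i j = Qchain r j i" unfolding Qchain_def
    by (rule if_cong) blast+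
  then show ?thesis unfolding hess_def Qur_def by auto
qed

lemma sum_lessThan_4_5:
  "(\<Sum>s<4. f s) = f 0 + f (Suc 0) + f (Suc (Suc 0)) + (f (Suc (Suc (Suc 0))) :: real)"
  "(\<Sum>s<5. f s) = f 0 + f (Suc 0) + f (Suc (Suc 0)) + f (Suc (Suc (Suc 0))) + (f (Suc (Suc (Suc (Suc 0)))) :: real)"
  by (simp_all add: eval_nat_numeral)

lemma dual_dual [simp]: "dual r (dual r i) = i"
  by (auto simp: dual_def)

lemma dual_eq_iff: "dual r i = j \<longleftrightarrow> i = dual r j"
  by (metis dual_dual)

lemma dual_x [simp]: "dual r (2 * r) = Suc (2 * r)" and dual_y [simp]: "dual r (Suc (2 * r)) = 2 * r"
  by (auto simp: dual_def)

section \<open>The metric, its potential, gradient and Hessian in coordinates\<close>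

locale coords =
  fixes r n :: nat
  assumes r2: "2 \<le> r" and n: "n = 2 * r + 2"
begin

lemma r0: "0 < r" and n6: "6 \<le> n" and xn [simp]: "2 * r < n" and yn [simp]: "Suc (2 * r) < n"
  using r2 n by auto

lemma dual_less [simp]: "dual r i < n \<longleftrightarrow> i < n"
  by (auto simp: dual_def n)

text \<open>The flat part of the metric is the permutation matrix of the involution
  \<open>dual\<close>, so contracting with it is a mere reindexing.\<close>

lemma g_flat_dual: "g_flat r a b = (if a < n \<and> b = dual r a then 1 else 0)"
proof -
  have "(\<exists>i\<in>{1..r}. (a = i - 1 \<and> b = r + i - 1) \<or> (a = r + i - 1 \<and> b = i - 1))
     \<longleftrightarrow> a < 2 * r \<and> b = dual r a" (is "?L \<longleftrightarrow> ?R")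
  proof
    assume ?L then show ?R by (auto simp: dual_def)
  next
    assume R: ?R
    show ?L
    proof (cases "a < r")
      case True then show ?thesis using R by (intro bexI[of _ "Suc a"]) (auto simp: dual_def)
    next
      case False then show ?thesis using R by (intro bexI[of _ "Suc (a - r)"]) (auto simp: dual_def)
    qed
  qed
  then show ?thesis
    unfolding g_flat_def uI_def vI_def xI_def yI_def by (auto simp: dual_def n)
qed

lemma sum_delta_dual:
  "a < n \<Longrightarrow> (\<Sum>b<n. (if b = dual r a then f b else 0)) = (f (dual r a) :: real)"
  by (simp add: sum.delta)

lemma sum_g_flat:
  "a < n \<Longrightarrow> (\<Sum>b<n. g_flat r a b * f b) = f (dual r a)"
proof -
  assume a: "a < n"
  have "(\<Sum>b<n. g_flat r a b * f b) = (\<Sum>b<n. (if b = dual r a then f b else 0))"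
    by (rule sum.cong) (auto simp: g_flat_dual a)
  then show ?thesis using sum_delta_dual[OF a, of f] by simp
qed

lemma g_flat_sym: "g_flat r a b = g_flat r b a"
  unfolding g_flat_dual by (metis dual_dual dual_less)

lemma gM_pot: "gM r \<psi> p a b = g_flat r a b + (if a = 2 * r \<and> b = 2 * r then - 2 * pot r \<psi> p else 0)"
proof -
  have "(\<Sum>i\<in>{1..r-1}. p (i - 1) * p (r + (i + 1) - 1)) = (\<Sum>i<r - 1. p i * p (r + i + 1))"
    by (rule sum.reindex_bij_witness[of _ Suc "\<lambda>i. i - 1"]) auto
  then show ?thesis unfolding gM_def pot_def xI_def uI_def vI_def by auto
qed

lemma sum_coords:
  fixes f :: "nat \<Rightarrow> real"
  shows "(\<Sum>i<n. f i) = (\<Sum>i<r. f i) + (\<Sum>i<r. f (r + i)) + f (2 * r) + f (Suc (2 * r))"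
proof -
  have "(\<Sum>i<r + m. f i) = (\<Sum>i<r. f i) + (\<Sum>i<m. f (r + i))" for m
    by (induction m) auto
  from this[of r] show ?thesis by (simp add: mult_2 n)
qed

lemma sum_dpot:
  shows "(\<Sum>i<n. dpot r \<phi> p i * c i)
     = (\<Sum>i<r - 1. p i * c (r + i + 1) + c i * p (r + i + 1)) + \<phi> (p (r - 1)) * c (r - 1)"
proof -
  have r: "r = Suc (r - 1)" using r0 by simp
  have 1: "(\<Sum>i<r. dpot r \<phi> p i * c i) = (\<Sum>i<r - 1. c i * p (r + i + 1)) + \<phi> (p (r - 1)) * c (r - 1)"
  proof -
    have "(\<Sum>i<Suc (r - 1). dpot r \<phi> p i * c i) = (\<Sum>i<r - 1. dpot r \<phi> p i * c i) + dpot r \<phi> p (r - 1) * c (r - 1)"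
      by (rule sum.lessThan_Suc)
    also have "(\<Sum>i<r - 1. dpot r \<phi> p i * c i) = (\<Sum>i<r - 1. c i * p (r + i + 1))"
      by (rule sum.cong) (auto simp: dpot_def)
    finally show ?thesis using r by (simp add: dpot_def)
  qed
  have "(\<Sum>i<r. dpot r \<phi> p (r + i) * c (r + i)) = dpot r \<phi> p r * c r
      + (\<Sum>i<r - 1. dpot r \<phi> p (r + Suc i) * c (r + Suc i))"
    using sum.lessThan_Suc_shift[of "\<lambda>i. dpot r \<phi> p (r + i) * c (r + i)" "r - 1"] r by simp
  also have "\<dots> = (\<Sum>i<r - 1. p i * c (r + i + 1))"
    using r0 by (auto simp: dpot_def intro!: sum.cong)
  finally have 2: "(\<Sum>i<r. dpot r \<phi> p (r + i) * c (r + i)) = (\<Sum>i<r - 1. p i * c (r + i + 1))" .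
  have "dpot r \<phi> p (2 * r) = 0" "dpot r \<phi> p (Suc (2 * r)) = 0" using r0 by (auto simp: dpot_def)
  then show ?thesis
    by (simp only: sum_coords 1 2 sum.distrib)
qed

text \<open>Stated along an arbitrary curve, so that it serves both for coordinate lines, where it
  gives the partial derivatives, and for the transversal part of a geodesic.\<close>

lemma pot_has_derivative:
  assumes c: "\<And>i. i < 2 * r \<Longrightarrow> ((\<lambda>t. c t i) has_real_derivative c' i) (at t0)"
    and \<psi>: "(\<psi> has_real_derivative \<phi> (c t0 (r - 1))) (at (c t0 (r - 1)))"
  shows "((\<lambda>t. pot r \<psi> (c t)) has_real_derivative (\<Sum>i<n. dpot r \<phi> (c t0) i * c' i)) (at t0)"
proof -
  have "((\<lambda>t. \<psi> (c t (r - 1))) has_real_derivative \<phi> (c t0 (r - 1)) * c' (r - 1)) (at t0)"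
    by (rule DERIV_chain2[where f=\<psi> and g="\<lambda>t. c t (r - 1)", OF \<psi>]) (use c r0 in simp)
  moreover have "((\<lambda>t. \<Sum>i<r - 1. c t i * c t (r + i + 1)) has_real_derivative
      (\<Sum>i<r - 1. c t0 i * c' (r + i + 1) + c' i * c t0 (r + i + 1))) (at t0)"
    by (rule DERIV_sum) (use r0 in \<open>auto intro!: derivative_eq_intros c\<close>)
  ultimately show ?thesis unfolding pot_def sum_dpot by (rule DERIV_add[rotated])
qed

text \<open>Here \<open>\<phi>'\<close> is a number, the derivative at the base point. The gradient
  formula with the linear map \<open>\<lambda>z. \<phi>' * z\<close> is the Hessian applied to the
  velocity \<open>c'\<close>.\<close>

lemma dpot_has_derivative:
  assumes c: "\<And>i. i < 2 * r \<Longrightarrow> ((\<lambda>t. c t i) has_real_derivative c' i) (at t0)"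
    and \<phi>: "(\<phi> has_real_derivative \<phi>' ) (at (c t0 (r - 1)))"
  shows "((\<lambda>t. dpot r \<phi> (c t) j) has_real_derivative dpot r (\<lambda>z. \<phi>' * z) c' j) (at t0)"
proof -
  have "((\<lambda>t. \<phi> (c t (r - 1))) has_real_derivative \<phi>' * c' (r - 1)) (at t0)"
    by (rule DERIV_chain2[where f=\<phi> and g="\<lambda>t. c t (r - 1)", OF \<phi>]) (use c r0 in simp)
  then show ?thesis using r0 c by (auto simp: dpot_def)
qed

lemma hess_dpot: "hess r c i j = dpot r (\<lambda>z. c * z) (kd i) j"
proof -
  have "(\<exists>k\<in>{1..r-1}. (i = k - 1 \<and> j = r + (k + 1) - 1) \<or> (i = r + (k + 1) - 1 \<and> j = k - 1))
     \<longleftrightarrow> (i < r - 1 \<and> j = r + i + 1) \<or> (j < r - 1 \<and> i = r + j + 1)" (is "?L \<longleftrightarrow> ?R")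
  proof
    assume ?R
    then show ?L
    proof
      assume "i < r - 1 \<and> j = r + i + 1" then show ?L by (intro bexI[of _ "Suc i"]) auto
    next
      assume "j < r - 1 \<and> i = r + j + 1" then show ?L by (intro bexI[of _ "Suc j"]) auto
    qed
  qed auto
  then show ?thesis using r0
    unfolding hess_def Qur_def Qchain_def uI_def vI_def dpot_def kd_def by auto
qed

lemma dpot_xy [simp]: "dpot r \<phi> p (2 * r) = 0" "dpot r \<phi> p (Suc (2 * r)) = 0"
  using r0 by (auto simp: dpot_def)

lemma hess_xy [simp]:
  shows "hess r c i (2 * r) = 0" "hess r c i (Suc (2 * r)) = 0" "hess r c (2 * r) i = 0" "hess r c (Suc (2 * r)) i = 0"
proof -
  show "hess r c i (2 * r) = 0" "hess r c i (Suc (2 * r)) = 0" by (auto simp: hess_dpot)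
  then show "hess r c (2 * r) i = 0" "hess r c (Suc (2 * r)) i = 0" by (metis hess_sym)+
qed

lemma pd_has_derivative_pot:
  assumes "\<And>x. (\<psi> has_real_derivative \<phi> x) (at x)" "k < n"
  shows "((\<lambda>t. pot r \<psi> (p(k := t))) has_real_derivative dpot r \<phi> p k) (at (p k))"
proof -
  have "((\<lambda>t. pot r \<psi> (p(k := t))) has_real_derivative
      (\<Sum>i<n. dpot r \<phi> (p(k := p k)) i * kd k i)) (at (p k))"
    using assms by (intro pot_has_derivative fun_upd_coord_deriv) auto
  moreover have "(\<Sum>i<n. dpot r \<phi> p i * kd k i) = dpot r \<phi> p k"
    using assms(2) by (simp add: kd_def mult_delta_right sum.delta)
  ultimately show ?thesis by simp
qed

lemma pd_has_derivative_dpot: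
  assumes "\<And>x. (\<phi> has_real_derivative \<phi>' x) (at x)"
  shows "((\<lambda>t. dpot r \<phi> (p(k := t)) j) has_real_derivative hess r (\<phi>' (p (r - 1))) k j) (at (p k))"
proof -
  have "((\<lambda>t. dpot r \<phi> (p(k := t)) j) has_real_derivative
      dpot r (\<lambda>z. \<phi>' ((p(k := p k)) (r - 1)) * z) (kd k) j) (at (p k))"
    using assms by (intro dpot_has_derivative fun_upd_coord_deriv) auto
  then show ?thesis by (simp add: hess_dpot)
qed

section \<open>Connection, curvature and covariant derivatives\<close>

lemma Chr1_gM:
  assumes "\<And>x. (\<psi> has_real_derivative \<phi> x) (at x)"
    "i < n" "j < n" "k < n"
  shows "Chr1 (n) (gM r \<psi>) p i j k =
     (if i = 2 * r \<and> j = 2 * r then dpot r \<phi> p k else 0)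
     - (if j = 2 * r \<and> k = 2 * r then dpot r \<phi> p i else 0)
     - (if i = 2 * r \<and> k = 2 * r then dpot r \<phi> p j else 0)"
proof -
  have "pd l (\<lambda>q. gM r \<psi> q a b) p = (if a = 2 * r \<and> b = 2 * r then - 2 * dpot r \<phi> p l else 0)"
    if "l < n" for l a b
    unfolding gM_pot
    by (rule pd_eqI) (auto intro!: derivative_eq_intros pd_has_derivative_pot[OF assms(1) that])
  then show ?thesis unfolding Chr1_def using assms(2-4) by (auto simp: field_simps)
qed

lemma sum_gM:
  assumes "a < n"
  shows "(\<Sum>b<n. gM r \<psi> p a b * f b) = f (dual r a) - (if a = 2 * r then 2 * pot r \<psi> p * f (2 * r) else 0)"
proof -
  have "(\<Sum>b<n. gM r \<psi> p a b * f b) = (\<Sum>b<n. g_flat r a b * f b)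
     + (\<Sum>b<n. if b = 2 * r then (if a = 2 * r then - 2 * pot r \<psi> p * f (2 * r) else 0) else 0)"
    unfolding sum.distrib[symmetric] by (rule sum.cong) (auto simp: gM_pot algebra_simps)
  then show ?thesis by (simp add: sum_g_flat[OF assms, simplified])
qed

lemma gM_sym: "gM r \<psi> p a b = gM r \<psi> p b a"
  unfolding gM_pot by (auto simp: g_flat_sym)

text \<open>The choice operator only promises some right inverse. A witness \<open>h0\<close> shows
  that one exists, and the row equations then determine every entry in range: row y of the metric
  yields row x of the inverse, which in turn enters the equation of row x.\<close>

lemma ginv_gM:
  assumes "i < n" "j < n"
  shows "ginv (n) (gM r \<psi>) p i j =
    (if j = dual r i then 1 else 0) + (if i = Suc (2 * r) \<and> j = Suc (2 * r) then 2 * pot r \<psi> p else 0)"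
proof -
  define h0 where "h0 k j = (if j = dual r k then 1 else 0) + (if k = Suc (2 * r) \<and> j = Suc (2 * r) then 2 * pot r \<psi> p else 0)" for k j
  let ?P = "\<lambda>h. \<forall>i<n. \<forall>j<n. (\<Sum>k<n. gM r \<psi> p i k * h k j) = kd i j"
  have eq: "(\<Sum>k<n. gM r \<psi> p i k * h k j) =
       h (dual r i) j - (if i = 2 * r then 2 * pot r \<psi> p * h (2 * r) j else 0)"
    if "i < n" for h :: "nat \<Rightarrow> nat \<Rightarrow> real" and i j
    using sum_gM[OF that] by simp
  have "?P h0"
  proof (intro allI impI)
    fix i j assume "i < n" "j < n"
    then show "(\<Sum>k<n. gM r \<psi> p i k * h0 k j) = kd i j"
      unfolding eq[OF \<open>i < n\<close>] by (auto simp: h0_def kd_def dual_eq_iff)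
  qed
  then have "?P (ginv (n) (gM r \<psi>) p)"
    unfolding ginv_def by (rule someI[where P = ?P])
  then have P: "ginv (n) (gM r \<psi>) p (dual r i) j
       - (if i = 2 * r then 2 * pot r \<psi> p * ginv (n) (gM r \<psi>) p (2 * r) j else 0) = kd i j"
    if "i < n" "j < n" for i j
    using eq[OF that(1)] that by metis
  have x: "ginv (n) (gM r \<psi>) p (2 * r) j = kd (Suc (2 * r)) j"
    using P[of "Suc (2 * r)" j] assms(2) by simp
  show ?thesis
  proof (cases "i = Suc (2 * r)")
    case True
    then show ?thesis using P[of "2 * r" j] assms x by (auto simp: kd_def)
  next
    case False
    then have "dual r i \<noteq> 2 * r" using dual_eq_iff by simp
    then show ?thesis using P[of "dual r i" j] assms False by (auto simp: kd_def)
  qed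
qed

lemma Chr_gM:
  assumes "\<And>x. (\<psi> has_real_derivative \<phi> x) (at x)"
    "l < n" "i < n" "j < n"
  shows "Chr (n) (gM r \<psi>) p l i j =
     (if i = 2 * r \<and> j = 2 * r then dpot r \<phi> p (dual r l) else 0)
     - (if l = Suc (2 * r) then (if j = 2 * r then dpot r \<phi> p i else 0)
                            + (if i = 2 * r then dpot r \<phi> p j else 0) else 0)"
proof -
  let ?C = "Chr1 (n) (gM r \<psi>) p i j"
  have "Chr (n) (gM r \<psi>) p l i j = (\<Sum>k<n. (if k = dual r l then ?C k else 0)
      + (if k = Suc (2 * r) then (if l = Suc (2 * r) then 2 * pot r \<psi> p * ?C (Suc (2 * r)) else 0) else 0))"
    unfolding Chr_def by (rule sum.cong) (use assms(2) in \<open>auto simp: ginv_gM\<close>)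
  also have "\<dots> = ?C (dual r l) + (if l = Suc (2 * r) then 2 * pot r \<psi> p * ?C (Suc (2 * r)) else 0)"
    unfolding sum.distrib sum_delta_dual[OF assms(2)] by (simp add: sum.delta)
  \<comment> \<open>The point-dependent (y,y) entry of the inverse is met only by the Christoffel
    symbol with lowered index y, which vanishes since no coefficient depends on y and those
    involving y are constant.\<close>
  also have "?C (Suc (2 * r)) = 0"
    using assms by (subst Chr1_gM[OF assms(1)]) auto
  finally show ?thesis using assms
    by (auto simp: Chr1_gM[OF assms(1)] dual_eq_iff)
qed

declare One_nat_def [simp del]

lemma Rup_gM:
  assumes \<psi>: "\<And>x. (\<psi> has_real_derivative \<psi>1 x) (at x)" and \<psi>1: "\<And>x. (\<psi>1 has_real_derivative \<psi>2 x) (at x)"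
    and "l < n" "i < n" "j < n" "k < n"
  defines "H \<equiv> \<lambda>p. hess r (\<psi>2 (p (r - 1)))"
  shows "Rup n (gM r \<psi>) p l i j k =
     (if j = 2 * r \<and> k = 2 * r then H p i (dual r l) else 0)
     - (if i = 2 * r \<and> k = 2 * r then H p j (dual r l) else 0)
     + (if l = Suc (2 * r) then (if i = 2 * r then H p j k else 0) - (if j = 2 * r then H p i k else 0) else 0)"
proof -
  note C = Chr_gM[OF \<psi>]
  have pdC: "pd i (\<lambda>q. Chr n (gM r \<psi>) q l j k) p =
     (if j = 2 * r \<and> k = 2 * r then H p i (dual r l) else 0)
     - (if l = Suc (2 * r) then (if k = 2 * r then H p i j else 0)
                            + (if j = 2 * r then H p i k else 0) else 0)"
    if "l < n" "i < n" "j < n" "k < n" for l i j k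
    unfolding C[OF that(1,3,4)] H_def
    by (rule pd_eqI) (auto intro!: derivative_eq_intros pd_has_derivative_dpot[OF \<psi>1])
  \<comment> \<open>A product of two Christoffel symbols survives only for i = j = k = x and l = y,
    and is then symmetric in i and j, so the quadratic part of the curvature cancels.\<close>
  have prod: "Chr n (gM r \<psi>) p m j k * Chr n (gM r \<psi>) p l i m =
     (if j = 2 * r \<and> k = 2 * r \<and> i = 2 * r \<and> l = Suc (2 * r)
      then - (dpot r \<psi>1 p (dual r m) * dpot r \<psi>1 p m) else 0)"
    if "m < n" "l < n" "i < n" "j < n" "k < n" for m l i j k
    unfolding C[OF that(1,4,5)] C[OF that(2,3,1)] by auto
  have "(\<Sum>m<n. Chr n (gM r \<psi>) p m j k * Chr n (gM r \<psi>) p l i m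
      - Chr n (gM r \<psi>) p m i k * Chr n (gM r \<psi>) p l j m) = 0"
    by (rule sum.neutral) (use assms(3-6) in \<open>auto simp: prod\<close>)
  then show ?thesis using assms(3-6) by (simp add: Rup_def pdC H_def hess_sym)
qed

lemma Rt_gM:
  assumes \<psi>: "\<And>x. (\<psi> has_real_derivative \<psi>1 x) (at x)" and \<psi>1: "\<And>x. (\<psi>1 has_real_derivative \<psi>2 x) (at x)"
    and "a < n" "b < n" "c < n" "d < n"
  shows "Rt n (gM r \<psi>) p [a, b, c, d] = curvQ (2 * r) (hess r (\<psi>2 (p (r - 1)))) a b c d"
proof -
  have "(\<Sum>m<n. Rup n (gM r \<psi>) p m a b c * gM r \<psi> p m d)
      = (\<Sum>m<n. gM r \<psi> p d m * Rup n (gM r \<psi>) p m a b c)"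
    by (rule sum.cong) (auto simp: gM_sym mult.commute)
  also have "\<dots> = Rup n (gM r \<psi>) p (dual r d) a b c
      - (if d = 2 * r then 2 * pot r \<psi> p * Rup n (gM r \<psi>) p (2 * r) a b c else 0)"
    by (rule sum_gM[OF assms(6)])
  also have "\<dots> = curvQ (2 * r) (hess r (\<psi>2 (p (r - 1)))) a b c d"
    using assms(3-6) by (auto simp: Rup_gM[OF \<psi> \<psi>1] curvQ_def dual_eq_iff)
  finally show ?thesis by (simp add: Rt_def)
qed

text \<open>For a covector \<open>f\<close> that annihilates the y-direction, only the derivative of
  the x-field in the x-direction remains, and it is the gradient of F with respect to the flat
  metric.\<close>

lemma sum_Chr_gM:
  assumes \<psi>: "\<And>x. (\<psi> has_real_derivative \<psi>1 x) (at x)"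
    and "e < n" "i < n" "f (Suc (2 * r)) = 0"
  shows "(\<Sum>l<n. Chr n (gM r \<psi>) p l e i * f l) =
    (if e = 2 * r \<and> i = 2 * r then \<Sum>l<n. dpot r \<psi>1 p (dual r l) * f l else 0)"
proof -
  have "(\<Sum>l<n. Chr n (gM r \<psi>) p l e i * f l)
    = (\<Sum>l<n. if e = 2 * r \<and> i = 2 * r then dpot r \<psi>1 p (dual r l) * f l else 0)"
    by (rule sum.cong) (use assms in \<open>auto simp: Chr_gM[OF \<psi>]\<close>)
  then show ?thesis by auto
qed

lemma curvQ_x_y:
  assumes "\<And>i. Q (Suc (2 * r)) i = 0" "\<And>i. Q i (Suc (2 * r)) = 0"
  shows "curvQ (2 * r) Q (Suc (2 * r)) b c d = 0" "curvQ (2 * r) Q a (Suc (2 * r)) c d = 0"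
    "curvQ (2 * r) Q a b (Suc (2 * r)) d = 0" "curvQ (2 * r) Q a b c (Suc (2 * r)) = 0"
  using assms by (auto simp: curvQ_def)

text \<open>The connection maps \<open>\<partial>\<^sub>x\<close> to some vector and kills everything else, up to
  \<open>\<partial>\<^sub>y\<close>-terms that the curvature does not see. Acting as a derivation on a tensor of
  type \<open>curvQ\<close> it gives zero, because that tensor is skew in each pair of slots.\<close>

lemma connection_kills_curvQ:
  assumes \<psi>: "\<And>x. (\<psi> has_real_derivative \<psi>1 x) (at x)"
    and lt: "a < n" "b < n" "c < n" "d < n" "e < n"
    and Q: "\<And>i. Q (Suc (2 * r)) i = 0" "\<And>i. Q i (Suc (2 * r)) = 0" "\<And>i. Q (2 * r) i = 0" "\<And>i. Q i (2 * r) = 0"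
      "\<And>i j. Q i j = Q j i"
  shows "(\<Sum>l<n. Chr n (gM r \<psi>) p l e a * curvQ (2 * r) Q l b c d)
    + (\<Sum>l<n. Chr n (gM r \<psi>) p l e b * curvQ (2 * r) Q a l c d)
    + (\<Sum>l<n. Chr n (gM r \<psi>) p l e c * curvQ (2 * r) Q a b l d)
    + (\<Sum>l<n. Chr n (gM r \<psi>) p l e d * curvQ (2 * r) Q a b c l) = 0"
proof -
  \<comment> \<open>The contraction of \<open>Q\<close> with the gradient of F, that is with the
    image of the x-field under the connection.\<close>
  define W where "W j = (\<Sum>l<n. dpot r \<psi>1 p (dual r l) * Q l j)" for j
  have W: "(\<Sum>l<n. dpot r \<psi>1 p (dual r l) * curvQ (2 * r) Q l b c d)
      = (if b = 2 * r \<and> c = 2 * r then W d else 0) - (if b = 2 * r \<and> d = 2 * r then W c else 0)" for b c d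
  proof -
    have "(\<Sum>l<n. dpot r \<psi>1 p (dual r l) * curvQ (2 * r) Q l b c d)
      = (\<Sum>l<n. (if b = 2 * r \<and> c = 2 * r then dpot r \<psi>1 p (dual r l) * Q l d else 0)
             - (if b = 2 * r \<and> d = 2 * r then dpot r \<psi>1 p (dual r l) * Q l c else 0))"
      by (rule sum.cong) (auto simp: curvQ_def Q)
    then show ?thesis by (auto simp: sum_subtractf W_def)
  qed
  note sym = curvQ_skew_swap[of Q, OF Q(5)]
  have S: "(\<Sum>l<n. Chr n (gM r \<psi>) p l e i * curvQ (2 * r) Q l b c d) = (if e = 2 * r \<and> i = 2 * r then
       (if b = 2 * r \<and> c = 2 * r then W d else 0) - (if b = 2 * r \<and> d = 2 * r then W c else 0) else 0)"
    if "i < n" for i b c d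
    unfolding W[symmetric]
    by (rule sum_Chr_gM[OF \<psi>]) (use that lt curvQ_x_y[of Q, OF Q(1,2)] in auto)
  show ?thesis
    unfolding sym(1)[of _ a _ c d] sym(2)[of _ a b _ d] sym(3)[of _ a b c]
    unfolding mult_minus_right sum_negf S[OF lt(1)] S[OF lt(2)] S[OF lt(3)] S[OF lt(4)]
    by (cases "e = 2 * r"; cases "a = 2 * r"; cases "b = 2 * r"; cases "c = 2 * r"; cases "d = 2 * r"; simp)
qed

lemma Qur_xy [simp]: "Qur r c (2 * r) i = 0" "Qur r c i (2 * r) = 0" "Qur r c (Suc (2 * r)) i = 0" "Qur r c i (Suc (2 * r)) = 0"
  using r0 by (auto simp: Qur_def uI_def)

lemma nablaR1_gM:
  assumes \<psi>: "\<And>x. (\<psi> has_real_derivative \<psi>1 x) (at x)" and \<psi>1: "\<And>x. (\<psi>1 has_real_derivative \<psi>2 x) (at x)"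
    and \<psi>2: "\<And>x. (\<psi>2 has_real_derivative \<psi>3 x) (at x)"
    and lt: "a < n" "b < n" "c < n" "d < n" "e < n"
  shows "nablaR n (gM r \<psi>) 1 p [a, b, c, d, e] =
    (if e = r - 1 then curvQ (2 * r) (Qur r (\<psi>3 (p (r - 1)))) a b c d else 0)"
proof -
  have "((\<lambda>t. \<psi>2 ((p(e := t)) (r - 1))) has_real_derivative (if e = r - 1 then \<psi>3 (p (r - 1)) else 0)) (at (p e))"
    using \<psi>2 by auto
  then have H: "((\<lambda>t. hess r (\<psi>2 ((p(e := t)) (r - 1))) i j) has_real_derivative
     (if e = r - 1 then Qur r (\<psi>3 (p (r - 1))) i j else 0)) (at (p e))" for i j
    unfolding hess_def Qur_def by (auto intro!: derivative_eq_intros)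
  have "((\<lambda>t. curvQ (2 * r) (hess r (\<psi>2 ((p(e := t)) (r - 1)))) a b c d) has_real_derivative
      curvQ (2 * r) (\<lambda>i j. if e = r - 1 then Qur r (\<psi>3 (p (r - 1))) i j else 0) a b c d) (at (p e))"
    by (rule curvQ_has_derivative) (rule H)
  from DERIV_imp_deriv[OF this] have pd: "pd e (\<lambda>q. Rt n (gM r \<psi>) q [a, b, c, d]) p =
     (if e = r - 1 then curvQ (2 * r) (Qur r (\<psi>3 (p (r - 1)))) a b c d else 0)"
    unfolding Rt_gM[OF \<psi> \<psi>1 lt(1-4)]
    by (cases "e = r - 1") (simp_all add: pd_def curvQ_zero)
  have s4: "(\<Sum>s<4. \<Sum>l<n. Chr n (gM r \<psi>) p l e ([a, b, c, d] ! s) * Rt n (gM r \<psi>) p ([a, b, c, d][s := l])) = 0"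
    using connection_kills_curvQ[OF \<psi> lt, of "hess r (\<psi>2 (p (r - 1)))" p, OF _ _ _ _ hess_sym] lt
    by (simp add: sum_lessThan_4_5 Rt_gM[OF \<psi> \<psi>1])
  have "nablaR n (gM r \<psi>) 1 p [a, b, c, d, e] = pd e (\<lambda>q. Rt n (gM r \<psi>) q [a, b, c, d]) p
     - (\<Sum>s<4. \<Sum>l<n. Chr n (gM r \<psi>) p l e ([a, b, c, d] ! s) * Rt n (gM r \<psi>) p ([a, b, c, d][s := l]))"
    by (simp add: nablaR_def covd_def sum_lessThan_4_5 One_nat_def)
  then show ?thesis unfolding s4 pd by simp
qed

text \<open>The u_r-component of the covariant derivative of the x-field along itself is u_(r-1).
  This is the one Christoffel symbol that meets the derivative slot of \<nabla>R.\<close>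

lemma dpot_pred: "dpot r \<psi>1 p (dual r (r - 1)) = p (r - 2)"
  using r2 by (auto simp: dpot_def dual_def)

text \<open>The four curvature slots again contribute nothing. The fifth slot is the covector du_r,
  whose covariant derivative is -u_(r-1) dx dx; this produces the term that depends on more than
  u_r.\<close>

lemma nablaR2_gM:
  assumes \<psi>: "\<And>x. (\<psi> has_real_derivative \<psi>1 x) (at x)" and \<psi>1: "\<And>x. (\<psi>1 has_real_derivative \<psi>2 x) (at x)"
    and \<psi>2: "\<And>x. (\<psi>2 has_real_derivative \<psi>3 x) (at x)"
    and \<psi>3: "\<And>x. (\<psi>3 has_real_derivative \<psi>4 x) (at x)"
    and lt: "a < n" "b < n" "c < n" "d < n" "e < n" "f < n"
  shows "nablaR n (gM r \<psi>) 2 p [a, b, c, d, e, f] = curvQ (2 * r) (Qur r 1) a b c d *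
    ((if e = r - 1 \<and> f = r - 1 then \<psi>4 (p (r - 1)) else 0)
     - (if e = 2 * r \<and> f = 2 * r then p (r - 2) * \<psi>3 (p (r - 1)) else 0))"
proof -
  let ?g = "gM r \<psi>"
  note N1 = nablaR1_gM[OF \<psi> \<psi>1 \<psi>2]
  have Q1: "Qur r s i j = s * Qur r 1 i j" for s i j by (auto simp: Qur_def)
  have c1: "curvQ (2 * r) (Qur r s) a b c d = curvQ (2 * r) (Qur r 1) a b c d * s" for s a b c d
    unfolding curvQ_def Q1[of s] by (auto simp: algebra_simps)
  have "((\<lambda>t. \<psi>3 ((p(f := t)) (r - 1))) has_real_derivative (if f = r - 1 then \<psi>4 (p (r - 1)) else 0)) (at (p f))"
    using \<psi>3 by auto
  then have D: "((\<lambda>t. s * \<psi>3 ((p(f := t)) (r - 1))) has_real_derivative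
      s * (if f = r - 1 then \<psi>4 (p (r - 1)) else 0)) (at (p f))" for s
    by (rule DERIV_cmult)
  have pd: "pd f (\<lambda>q. nablaR n ?g 1 q [a, b, c, d, e]) p =
     (if e = r - 1 \<and> f = r - 1 then curvQ (2 * r) (Qur r 1) a b c d * \<psi>4 (p (r - 1)) else 0)"
    unfolding N1[OF lt(1-5)] c1[of "\<psi>3 _"]
    using pd_eqI[OF D, of "curvQ (2 * r) (Qur r 1) a b c d"] by (cases "e = r - 1") (simp_all add: pd_def)
  have k: "(\<Sum>l<n. Chr n ?g p l f e * nablaR n ?g 1 p [a, b, c, d, l]) =
     (if e = 2 * r \<and> f = 2 * r then p (r - 2) * curvQ (2 * r) (Qur r (\<psi>3 (p (r - 1)))) a b c d else 0)"
  proof -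
    have "(\<Sum>l<n. Chr n ?g p l f e * nablaR n ?g 1 p [a, b, c, d, l]) =
     (if f = 2 * r \<and> e = 2 * r then \<Sum>l<n. dpot r \<psi>1 p (dual r l) * nablaR n ?g 1 p [a, b, c, d, l] else 0)"
      using r0 by (intro sum_Chr_gM[OF \<psi> lt(6,5)]) (auto simp: N1[OF lt(1-4)])
    also have "(\<Sum>l<n. dpot r \<psi>1 p (dual r l) * nablaR n ?g 1 p [a, b, c, d, l])
       = (\<Sum>l<n. if l = r - 1 then p (r - 2) * curvQ (2 * r) (Qur r (\<psi>3 (p (r - 1)))) a b c d else 0)"
      by (rule sum.cong) (auto simp: N1[OF lt(1-4)] dpot_pred)
    also have "\<dots> = p (r - 2) * curvQ (2 * r) (Qur r (\<psi>3 (p (r - 1)))) a b c d"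
      using n r0 by (simp add: sum.delta)
    finally show ?thesis by auto
  qed
  define C where "C a b c d = (if e = r - 1 then curvQ (2 * r) (Qur r (\<psi>3 (p (r - 1)))) a b c d else 0)" for a b c d
  have N1': "nablaR n ?g 1 p [a, b, c, d, e] = C a b c d" if "a < n" "b < n" "c < n" "d < n" for a b c d
    unfolding C_def by (rule N1) (use that lt in auto)
  have z: "(\<Sum>l<n. Chr n ?g p l f a * C l b c d) + (\<Sum>l<n. Chr n ?g p l f b * C a l c d)
       + (\<Sum>l<n. Chr n ?g p l f c * C a b l d) + (\<Sum>l<n. Chr n ?g p l f d * C a b c l) = 0"
    unfolding C_def using connection_kills_curvQ[OF \<psi> lt(1-4,6), of "Qur r (\<psi>3 (p (r - 1)))" p, OF _ _ _ _ Qur_sym]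
    by (cases "e = r - 1") simp_all
  have s5: "(\<Sum>s<5. \<Sum>l<n. Chr n ?g p l f ([a, b, c, d, e] ! s) * nablaR n ?g 1 p ([a, b, c, d, e][s := l]))
      = (\<Sum>l<n. Chr n ?g p l f e * nablaR n ?g 1 p [a, b, c, d, l])"
    using z lt by (simp add: sum_lessThan_4_5 N1')
  have "nablaR n ?g 2 = covd n ?g (nablaR n ?g 1)" by (simp add: nablaR_def numeral_2_eq_2 One_nat_def)
  then have "nablaR n ?g 2 p [a, b, c, d, e, f] = pd f (\<lambda>q. nablaR n ?g 1 q [a, b, c, d, e]) p
     - (\<Sum>s<5. \<Sum>l<n. Chr n ?g p l f ([a, b, c, d, e] ! s) * nablaR n ?g 1 p ([a, b, c, d, e][s := l]))"
    by (simp add: covd_def sum_lessThan_4_5)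
  then show ?thesis unfolding s5 pd k c1[of "\<psi>3 _"] by (auto simp: right_diff_distrib)
qed

end

section \<open>Multilinear algebra of the curvature tensor\<close>

lemma pullT_Nil: "pullT n M T [] = T []"
  by (simp add: pullT_def cong: conj_cong)

text \<open>Replaces the sum over index lists by nested sums, one for each slot, so that pullbacks
  of tensors of fixed rank unfold by rewriting.\<close>

lemma pullT_Cons: "pullT n M T (i # is) = (\<Sum>j<n. M j i * pullT n M (\<lambda>js. T (j # js)) is)"
proof -
  let ?L = "{js. length js = length is \<and> set js \<subseteq> {..<n}}"
  have "{js. length js = length (i # is) \<and> set js \<subseteq> {..<n}} = (\<lambda>(j, js). j # js) ` ({..<n} \<times> ?L)"
    by (auto simp: length_Suc_conv image_iff)
  moreover have "inj_on (\<lambda>(j, js). j # js) ({..<n} \<times> ?L)"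
    by (auto simp: inj_on_def)
  ultimately have "pullT n M T (i # is) = (\<Sum>(j, js)\<in>{..<n} \<times> ?L.
      (\<Prod>t<Suc (length is). M ((j # js) ! t) ((i # is) ! t)) * T (j # js))"
    unfolding pullT_def by (simp add: sum.reindex case_prod_unfold)
  also have "\<dots> = (\<Sum>(j, js)\<in>{..<n} \<times> ?L.
      M j i * ((\<Prod>t<length is. M (js ! t) (is ! t)) * T (j # js)))"
    by (rule sum.cong) (auto simp: prod.lessThan_Suc_shift simp del: prod.lessThan_Suc)
  also have "\<dots> = (\<Sum>j<n. \<Sum>js\<in>?L. M j i * ((\<Prod>t<length is. M (js ! t) (is ! t)) * T (j # js)))"
    by (rule sum.cartesian_product[symmetric])
  finally show ?thesis by (simp add: pullT_def sum_distrib_left)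
qed

definition bil :: "nat \<Rightarrow> (nat \<Rightarrow> nat \<Rightarrow> real) \<Rightarrow> (nat \<Rightarrow> real) \<Rightarrow> (nat \<Rightarrow> real) \<Rightarrow> real" where
  "bil n Q b c = (\<Sum>k<n. b k * (\<Sum>l<n. c l * Q k l))"

text \<open>The multilinear extension of \<open>curvQ\<close> from basis indices to vectors
  (\<open>curvQ_multilinear\<close>); the component \<open>a X\<close> is the value of dx on
  \<open>a\<close>.\<close>

definition curvF :: "nat \<Rightarrow> nat \<Rightarrow> (nat \<Rightarrow> nat \<Rightarrow> real) \<Rightarrow>
    (nat \<Rightarrow> real) \<Rightarrow> (nat \<Rightarrow> real) \<Rightarrow> (nat \<Rightarrow> real) \<Rightarrow> (nat \<Rightarrow> real) \<Rightarrow> real" where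
  "curvF n X Q a b c d = a X * d X * bil n Q b c + b X * c X * bil n Q a d
     - a X * c X * bil n Q b d - b X * d X * bil n Q a c"

lemma kd_sum: "i < n \<Longrightarrow> (\<Sum>j<n. f j * kd j i) = f i" "i < n \<Longrightarrow> (\<Sum>j<n. f j * kd i j) = f i"
    "i < n \<Longrightarrow> (\<Sum>j<n. kd j i * f j) = f i" "i < n \<Longrightarrow> (\<Sum>j<n. kd i j * f j) = f i"
  by (simp_all add: kd_def mult_delta_right mult_delta_left sum.delta)

lemma curvQ_multilinear:
  assumes X: "X < n"
  shows "(\<Sum>j<n. A j * (\<Sum>k<n. B k * (\<Sum>l<n. C l * (\<Sum>m<n. D m * curvQ X Q j k l m))))
     = curvF n X Q A B C D"
proof -
  define QC where "QC k = (\<Sum>l<n. C l * Q k l)" for k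
  define QD where "QD k = (\<Sum>l<n. D l * Q k l)" for k
  have 1: "(\<Sum>m<n. D m * curvQ X Q j k l m) = kd j X * D X * Q k l + kd k X * kd l X * QD j
     - kd j X * kd l X * QD k - kd k X * D X * Q j l" for j k l
  proof -
    have "(\<Sum>m<n. D m * curvQ X Q j k l m) = (\<Sum>m<n. (kd j X * Q k l) * (D m * kd m X)
      + (kd k X * kd l X) * (D m * Q j m) - (kd j X * kd l X) * (D m * Q k m)
      - (kd k X * Q j l) * (D m * kd m X))"
      by (rule sum.cong) (auto simp: curvQ_def kd_def algebra_simps)
    then show ?thesis
      by (simp add: sum.distrib sum_subtractf sum_distrib_left[symmetric] kd_sum[OF X] QD_def)
  qed
  have 2: "(\<Sum>l<n. C l * (kd j X * D X * Q k l + kd k X * kd l X * QD j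
     - kd j X * kd l X * QD k - kd k X * D X * Q j l)) =
      kd j X * D X * QC k + kd k X * C X * QD j - kd j X * C X * QD k - kd k X * D X * QC j" for j k
  proof -
    have "(\<Sum>l<n. C l * (kd j X * D X * Q k l + kd k X * kd l X * QD j
       - kd j X * kd l X * QD k - kd k X * D X * Q j l)) =
       (\<Sum>l<n. (kd j X * D X) * (C l * Q k l) + (kd k X * QD j) * (C l * kd l X)
         - (kd j X * QD k) * (C l * kd l X) - (kd k X * D X) * (C l * Q j l))"
      by (rule sum.cong) (auto simp: algebra_simps)
    then show ?thesis
      by (simp add: sum.distrib sum_subtractf sum_distrib_left[symmetric] kd_sum[OF X] QC_def)
  qed
  have 3: "(\<Sum>k<n. B k * (kd j X * D X * QC k + kd k X * C X * QD j - kd j X * C X * QD k - kd k X * D X * QC j))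
     = kd j X * D X * (\<Sum>k<n. B k * QC k) + B X * C X * QD j - kd j X * C X * (\<Sum>k<n. B k * QD k) - B X * D X * QC j" for j
  proof -
    have "(\<Sum>k<n. B k * (kd j X * D X * QC k + kd k X * C X * QD j - kd j X * C X * QD k - kd k X * D X * QC j)) =
       (\<Sum>k<n. (kd j X * D X) * (B k * QC k) + (C X * QD j) * (B k * kd k X)
         - (kd j X * C X) * (B k * QD k) - (D X * QC j) * (B k * kd k X))"
      by (rule sum.cong) (auto simp: algebra_simps)
    then show ?thesis
      by (simp add: sum.distrib sum_subtractf sum_distrib_left[symmetric] kd_sum[OF X])
  qed
  have "(\<Sum>j<n. A j * (kd j X * D X * (\<Sum>k<n. B k * QC k) + B X * C X * QD j - kd j X * C X * (\<Sum>k<n. B k * QD k) - B X * D X * QC j))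
    = (\<Sum>j<n. (D X * (\<Sum>k<n. B k * QC k)) * (A j * kd j X) + (B X * C X) * (A j * QD j)
        - (C X * (\<Sum>k<n. B k * QD k)) * (A j * kd j X) - (B X * D X) * (A j * QC j))"
    by (rule sum.cong) (auto simp: algebra_simps)
  also have "\<dots> = curvF n X Q A B C D"
    by (simp add: sum.distrib sum_subtractf sum_distrib_left[symmetric] kd_sum[OF X] curvF_def bil_def QC_def QD_def)
  finally show ?thesis unfolding 1 2 3 .
qed

lemma pullT_curvQ:
  assumes "X < n" "\<And>a b c d. T [a, b, c, d] = curvQ X Q a b c d"
  shows "pullT n M T [a, b, c, d] = curvF n X Q (\<lambda>i. M i a) (\<lambda>i. M i b) (\<lambda>i. M i c) (\<lambda>i. M i d)"
  by (simp add: pullT_Cons pullT_Nil assms curvQ_multilinear)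

lemma bil_cong:
  assumes "\<And>i. i < n \<Longrightarrow> a i = a' i" "\<And>i. i < n \<Longrightarrow> b i = b' i"
  shows "bil n Q a b = bil n Q a' b'"
  using assms by (simp add: bil_def)

lemma curvF_cong:
  assumes "X < n" "\<And>i. i < n \<Longrightarrow> a i = a' i" "\<And>i. i < n \<Longrightarrow> b i = b' i"
    "\<And>i. i < n \<Longrightarrow> c i = c' i" "\<And>i. i < n \<Longrightarrow> d i = d' i"
  shows "curvF n X Q a b c d = curvF n X Q a' b' c' d'"
proof -
  have "bil n Q b c = bil n Q b' c'" "bil n Q a d = bil n Q a' d'" "bil n Q b d = bil n Q b' d'" "bil n Q a c = bil n Q a' c'"
    using assms by (auto intro!: bil_cong)
  then show ?thesis using assms by (simp add: curvF_def)
qed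

lemma sum_swap_mult:
  fixes g :: "'s \<Rightarrow> real"
  shows "(\<Sum>k\<in>A. f k * (\<Sum>s\<in>B. g s * h k s)) = (\<Sum>s\<in>B. g s * (\<Sum>k\<in>A. f k * h k s))"
  unfolding sum_distrib_left by (subst sum.swap) (simp add: mult.left_commute)

lemma bil_sum_left: "bil n Q (\<lambda>i. \<Sum>s<m. u s * M i s) b = (\<Sum>s<m. u s * bil n Q (\<lambda>i. M i s) b)"
  unfolding bil_def
  using sum_swap_mult[where f = "\<lambda>k. \<Sum>l<n. b l * Q k l" and g = u and h = M]
  by (simp add: mult.commute)

lemma bil_sum_right: "bil n Q b (\<lambda>i. \<Sum>s<m. u s * M i s) = (\<Sum>s<m. u s * bil n Q b (\<lambda>i. M i s))"
proof -
  have "(\<Sum>l<n. (\<Sum>s<m. u s * M l s) * Q k l) = (\<Sum>s<m. u s * (\<Sum>l<n. M l s * Q k l))" for k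
    using sum_swap_mult[where f = "Q k" and g = u and h = M] by (simp add: mult.commute)
  then show ?thesis
    unfolding bil_def
    using sum_swap_mult[where f = b and g = u and h = "\<lambda>k s. \<Sum>l<n. M l s * Q k l"] by simp
qed

lemma curvF_sum:
  fixes u :: "nat \<Rightarrow> real"
  shows "curvF n X Q (\<lambda>i. \<Sum>s<m. u s * M i s) b c d = (\<Sum>s<m. u s * curvF n X Q (\<lambda>i. M i s) b c d)"
  "curvF n X Q a (\<lambda>i. \<Sum>s<m. u s * M i s) c d = (\<Sum>s<m. u s * curvF n X Q a (\<lambda>i. M i s) c d)"
  "curvF n X Q a b (\<lambda>i. \<Sum>s<m. u s * M i s) d = (\<Sum>s<m. u s * curvF n X Q a b (\<lambda>i. M i s) d)"
  "curvF n X Q a b c (\<lambda>i. \<Sum>s<m. u s * M i s) = (\<Sum>s<m. u s * curvF n X Q a b c (\<lambda>i. M i s))"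
proof -
  have lin: "(\<Sum>s<m. u s * (f s * A + B * g s - f s * C - D * h s)) =
      (\<Sum>s<m. u s * f s) * A + B * (\<Sum>s<m. u s * g s) - (\<Sum>s<m. u s * f s) * C - D * (\<Sum>s<m. u s * h s)"
    for f g h :: "nat \<Rightarrow> real" and A B C D
    by (simp add: sum_distrib_left sum_distrib_right sum.distrib sum_subtractf algebra_simps)
  note S = curvF_def bil_sum_left bil_sum_right
  show "curvF n X Q (\<lambda>i. \<Sum>s<m. u s * M i s) b c d = (\<Sum>s<m. u s * curvF n X Q (\<lambda>i. M i s) b c d)"
    unfolding S using lin[of "M X" "d X * bil n Q b c" "b X * c X" "\<lambda>s. bil n Q (\<lambda>i. M i s) d"
        "c X * bil n Q b d" "b X * d X" "\<lambda>s. bil n Q (\<lambda>i. M i s) c"] by (simp add: mult.assoc)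
  show "curvF n X Q a (\<lambda>i. \<Sum>s<m. u s * M i s) c d = (\<Sum>s<m. u s * curvF n X Q a (\<lambda>i. M i s) c d)"
    unfolding S using lin[of "M X" "c X * bil n Q a d" "a X * d X" "\<lambda>s. bil n Q (\<lambda>i. M i s) c"
        "d X * bil n Q a c" "a X * c X" "\<lambda>s. bil n Q (\<lambda>i. M i s) d"] by (simp add: algebra_simps)
  show "curvF n X Q a b (\<lambda>i. \<Sum>s<m. u s * M i s) d = (\<Sum>s<m. u s * curvF n X Q a b (\<lambda>i. M i s) d)"
    unfolding S using lin[of "M X" "b X * bil n Q a d" "a X * d X" "\<lambda>s. bil n Q b (\<lambda>i. M i s)"
        "a X * bil n Q b d" "b X * d X" "\<lambda>s. bil n Q a (\<lambda>i. M i s)"] by (simp add: algebra_simps)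
  show "curvF n X Q a b c (\<lambda>i. \<Sum>s<m. u s * M i s) = (\<Sum>s<m. u s * curvF n X Q a b c (\<lambda>i. M i s))"
    unfolding S using lin[of "M X" "a X * bil n Q b c" "b X * c X" "\<lambda>s. bil n Q a (\<lambda>i. M i s)"
        "b X * bil n Q a c" "a X * c X" "\<lambda>s. bil n Q b (\<lambda>i. M i s)"] by (simp add: algebra_simps)
qed

lemma curvF_zero:
  assumes "X < n" "\<And>i. i < n \<Longrightarrow> z i = 0"
  shows "curvF n X Q z b c d = 0" "curvF n X Q a z c d = 0"
  using assms by (simp_all add: curvF_def bil_def)

lemma curvF_skew: "curvF n X Q b a c d = - curvF n X Q a b c d"
  by (simp add: curvF_def)

section \<open>Algebraic irreducibility of the curvature\<close>

context coords begin

lemma sum_hess: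
  assumes "i < n" shows "(\<Sum>k<n. b k * hess r c k i) = dpot r (\<lambda>z. c * z) b i"
proof -
  have "(\<Sum>k<n. b k * hess r c k i) = dpot r (\<lambda>z. c * z) (\<lambda>i. \<Sum>k<n. b k * kd k i) i"
    unfolding hess_dpot dpot_def by (auto simp: sum_distrib_left mult_ac)
  also have "\<dots> = dpot r (\<lambda>z. c * z) b i"
  proof -
    have "i < r - 1 \<Longrightarrow> r + i + 1 < n" "r - 1 < n" "i < 2 * r \<Longrightarrow> i - r - 1 < n"
      using n by auto
    then show ?thesis by (auto simp: dpot_def kd_sum)
  qed
  finally show ?thesis .
qed

lemma bil_hess_kd: "i < n \<Longrightarrow> bil n (hess r c) b (kd i) = dpot r (\<lambda>z. c * z) b i"
  by (simp add: bil_def kd_sum sum_hess)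

lemma bil_hess: "bil n (hess r c) a b = (\<Sum>i<n. a i * dpot r (\<lambda>z. c * z) b i)"
  unfolding bil_def
proof (rule sum.cong)
  fix i assume "i \<in> {..<n}"
  then show "a i * (\<Sum>l<n. b l * hess r c i l) = a i * dpot r (\<lambda>z. c * z) b i"
    using sum_hess[of i b c] by (simp add: hess_sym[of r c i])
qed simp

text \<open>Testing with \<open>w = kd i\<close> and \<open>w' = z\<close> shows that z_x b - b_x z
  is annihilated by the Hessian. Its kernel is spanned by the v_1-, x- and y-directions, hence the
  exclusion of the index r and the bound 2r.\<close>

lemma curvF_zero_parallel:
  assumes "c \<noteq> 0" "\<And>w w'. curvF n (2 * r) (hess r c) z b w w' = 0" "z (2 * r) \<noteq> 0" "i < 2 * r" "i \<noteq> r"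
  shows "b i = b (2 * r) / z (2 * r) * z i"
proof -
  have d: "z (2 * r) * dpot r (\<lambda>z. c * z) b i = b (2 * r) * dpot r (\<lambda>z. c * z) z i" if "i < 2 * r" for i
  proof -
    have "kd i (2 * r) = 0" "i < n" using that n by (auto simp: kd_def)
    then have "z (2 * r) * (z (2 * r) * dpot r (\<lambda>z. c * z) b i - b (2 * r) * dpot r (\<lambda>z. c * z) z i) = 0"
      using assms(2)[of "kd i" z] by (simp add: curvF_def bil_hess_kd algebra_simps)
    then show ?thesis using assms(3) by simp
  qed
  have "z (2 * r) * b i = b (2 * r) * z i"
  proof -
    consider "i < r - 1" | "i = r - 1" | "r < i" using assms by linarith
    then show ?thesis
    proof cases
      case 1
      then have "dpot r (\<lambda>z. c * z) p (i + r + 1) = p i" for p by (auto simp: dpot_def)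
      then show ?thesis using d[of "i + r + 1"] 1 by simp
    next
      case 2 then show ?thesis using d[of i] assms(1) r0 by (simp add: dpot_def)
    next
      case 3
      then have "dpot r (\<lambda>z. c * z) p (i - r - 1) = p i" for p using assms(4) by (auto simp: dpot_def)
      then show ?thesis using d[of "i - r - 1"] assms(4) by simp
    qed
  qed
  then show ?thesis using assms(3) by (simp add: field_simps)
qed

text \<open>If V2 also contained a vector with nonzero x-component, all vectors of V1 and V2 would
  have u_1-components proportional to their x-components with one common factor, and the
  u_1-direction, whose x-component is 0, could not be split. So V2 consists of combinations of the
  v_1- and y-directions, which are isotropic and orthogonal to each other; V2 is then orthogonal to
  V1 and to itself, hence zero. The term with \<open>\<kappa>\<close> admits both the flat model
  metric and the metric at a point of the manifold.\<close>

lemma curvature_irreducible_aux: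
  assumes c: "c \<noteq> 0" and dec: "\<And>w. \<exists>a\<in>V1. \<exists>b\<in>V2. \<forall>i<n. w i = a i + b i"
    and orth: "\<And>a b. a \<in> V1 \<Longrightarrow> b \<in> V2 \<Longrightarrow> (\<Sum>i<n. a i * b (dual r i)) + \<kappa> * a (2 * r) * b (2 * r) = 0"
    and curv: "\<And>a b w w'. a \<in> V1 \<Longrightarrow> b \<in> V2 \<Longrightarrow> curvF n (2 * r) (hess r c) a b w w' = 0"
    and z: "z \<in> V1" "z (2 * r) \<noteq> 0" and b: "b \<in> V2" and i: "i < n"
  shows "b i = 0"
proof -
  have V2: "b j = b (2 * r) / z (2 * r) * z j" if "b \<in> V2" "j < 2 * r" "j \<noteq> r" for b j
    by (rule curvF_zero_parallel[OF c]) (use that z curv in auto)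
  have x0: "b (2 * r) = 0" if b: "b \<in> V2" for b
  proof (rule ccontr)
    assume bx: "b (2 * r) \<noteq> 0"
    \<comment> \<open>The index 0 is u_1; the vectors \<open>z\<close> and \<open>b\<close> play
      symmetric roles, each controlling the elements of the opposite summand.\<close>
    have b0: "b 0 = b (2 * r) / z (2 * r) * z 0" by (rule V2[OF b]) (use r0 in auto)
    obtain a' b' where ab: "a' \<in> V1" "b' \<in> V2" "\<forall>i<n. kd 0 i = a' i + b' i" using dec by blast
    have "curvF n (2 * r) (hess r c) b a' w w' = 0" for w w'
      by (subst curvF_skew) (simp add: curv ab b)
    then have "a' 0 = a' (2 * r) / b (2 * r) * b 0"
      by (rule curvF_zero_parallel[OF c]) (use bx r0 in auto)
    moreover have "b' 0 = b' (2 * r) / z (2 * r) * z 0" by (rule V2) (use r0 ab in auto)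
    ultimately have "a' 0 + b' 0 = (a' (2 * r) + b' (2 * r)) / z (2 * r) * z 0"
      using b0 bx z(2) by (simp add: field_simps)
    moreover have "a' 0 + b' 0 = 1" "a' (2 * r) + b' (2 * r) = 0"
      using ab(3)[rule_format, of 0] ab(3)[rule_format, of "2 * r"] n6 r0 by (simp_all add: kd_def)
    ultimately show False by simp
  qed
  have sup: "b j = 0" if "b \<in> V2" "j \<noteq> r" "j \<noteq> Suc (2 * r)" "j < n" for b j
  proof (cases "j = 2 * r")
    case False
    then have "j < 2 * r" using that n by simp
    then show ?thesis using V2[OF that(1), of j] that x0[OF that(1)] by simp
  qed (use x0 that in simp)
  have iso: "(\<Sum>i<n. b i * w (dual r i)) = 0" for w
  proof -
    obtain a' b' where ab: "a' \<in> V1" "b' \<in> V2" "\<forall>i<n. w i = a' i + b' i" using dec by blast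
    have "(\<Sum>i<n. b i * w (dual r i)) = (\<Sum>i<n. b i * a' (dual r i)) + (\<Sum>i<n. b i * b' (dual r i))"
      unfolding sum.distrib[symmetric] by (rule sum.cong) (use ab in \<open>auto simp: algebra_simps\<close>)
    also have "(\<Sum>i<n. b i * b' (dual r i)) = 0"
    proof (rule sum.neutral, rule ballI)
      fix i assume "i \<in> {..<n}"
      then have "b i = 0 \<or> b' (dual r i) = 0"
        using sup[OF b, of i] sup[OF ab(2), of "dual r i"] r0 n by (cases "i = r"; cases "i = Suc (2 * r)") (auto simp: dual_def)
      then show "b i * b' (dual r i) = 0" by auto
    qed
    also have "(\<Sum>i<n. b i * a' (dual r i)) = (\<Sum>i<n. a' i * b (dual r i))"
      by (rule sum.reindex_bij_witness[of _ "dual r" "dual r"]) auto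
    also have "\<dots> = 0" using orth[OF ab(1) b] x0[OF b] by simp
    finally show ?thesis by simp
  qed
  \<comment> \<open>Pairing \<open>b\<close> with the basis vector dual to i under the flat metric
    extracts the component \<open>b i\<close>.\<close>
  have "(\<Sum>j<n. b j * kd (dual r i) (dual r j)) = (\<Sum>j<n. b j * kd i j)"
    by (rule sum.cong) (auto simp: kd_def dual_eq_iff)
  then show ?thesis using iso[of "kd (dual r i)"] kd_sum(2)[OF i, of b] by simp
qed

lemma curvature_irreducible:
  assumes c: "c \<noteq> 0" and dec: "\<And>w. \<exists>a\<in>V1. \<exists>b\<in>V2. \<forall>i<n. w i = a i + b i"
    and orth: "\<And>a b. a \<in> V1 \<Longrightarrow> b \<in> V2 \<Longrightarrow> (\<Sum>i<n. a i * b (dual r i)) + \<kappa> * a (2 * r) * b (2 * r) = 0"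
    and curv: "\<And>a b w w'. a \<in> V1 \<Longrightarrow> b \<in> V2 \<Longrightarrow> curvF n (2 * r) (hess r c) a b w w' = 0"
  shows "(\<forall>a\<in>V1. \<forall>i<n. a i = 0) \<or> (\<forall>b\<in>V2. \<forall>i<n. b i = 0)"
proof -
  \<comment> \<open>The x-direction itself is split; at least one of its two parts has nonzero
    x-component and selects the summand that forces the other one to vanish.\<close>
  obtain a b where ab: "a \<in> V1" "b \<in> V2" "\<forall>i<n. kd (2 * r) i = a i + b i" using dec by blast
  then have "a (2 * r) + b (2 * r) = 1" using ab(3)[rule_format, of "2 * r"] by (simp add: kd_def)
  then consider "a (2 * r) \<noteq> 0" | "b (2 * r) \<noteq> 0" by fastforce
  then show ?thesis
  proof cases
    case 1
    have "b i = 0" if "b \<in> V2" "i < n" for b i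
      using curvature_irreducible_aux[OF c dec orth curv ab(1) 1 that] .
    then show ?thesis by blast
  next
    case 2
    have orth': "(\<Sum>i<n. b i * a (dual r i)) + \<kappa> * b (2 * r) * a (2 * r) = 0" if "a \<in> V1" "b \<in> V2" for a b
    proof -
      have "(\<Sum>i<n. b i * a (dual r i)) = (\<Sum>i<n. a i * b (dual r i))"
        by (rule sum.reindex_bij_witness[of _ "dual r" "dual r"]) auto
      then show ?thesis using orth[OF that] by (simp add: mult_ac)
    qed
    have dec': "\<exists>a\<in>V2. \<exists>b\<in>V1. \<forall>i<n. w i = a i + b i" for w
      using dec[of w] by (metis add.commute)
    have curv': "curvF n (2 * r) (hess r c) b a w w' = 0" if "a \<in> V1" "b \<in> V2" for a b w w'
      by (subst curvF_skew) (simp add: curv that)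
    have "a i = 0" if "a \<in> V1" "i < n" for a i
      using curvature_irreducible_aux[OF c dec' orth' curv' ab(2) 2 that] .
    then show ?thesis by blast
  qed
qed

end

section \<open>Curvature models\<close>

lemma pullT_cong:
  assumes "\<And>js. length js = length is \<Longrightarrow> set js \<subseteq> {..<n} \<Longrightarrow> T js = T' js"
  shows "pullT n M T is = pullT n M T' is"
  unfolding pullT_def by (rule sum.cong) (use assms in auto)

text \<open>Serves \<nabla>R, its covariant derivative and the model tensor \<open>AU1\<close>,
  which all factor into a curvature part and a part \<open>t\<close> in the derivative slots. The
  factorisation is asked for only at indices in range, where the component formulas hold.\<close>

lemma pullT_curvQ_prod:
  assumes X: "X < n"
    and T: "\<And>a b c d es. length es = length is \<Longrightarrow> set (a # b # c # d # es) \<subseteq> {..<n} \<Longrightarrow>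
       T (a # b # c # d # es) = curvQ X Q a b c d * t es"
  shows "pullT n M T (a # b # c # d # is) =
    curvF n X Q (\<lambda>i. M i a) (\<lambda>i. M i b) (\<lambda>i. M i c) (\<lambda>i. M i d) * pullT n M t is"
proof -
  define T' where "T' = (\<lambda>js. case js of (a # b # c # d # es) \<Rightarrow> curvQ X Q a b c d * t es | _ \<Rightarrow> 0)"
  have scale: "pullT n M (\<lambda>js. s * t js) js = s * pullT n M t js" for s js
    by (simp add: pullT_def sum_distrib_left mult_ac)
  have "pullT n M T (a # b # c # d # is) = pullT n M T' (a # b # c # d # is)"
    by (rule pullT_cong) (auto simp: T'_def T length_Suc_conv)
  also have "\<dots> = (\<Sum>j<n. M j a * (\<Sum>k<n. M k b * (\<Sum>l<n. M l c * (\<Sum>m<n. M m d * curvQ X Q j k l m)))) * pullT n M t is"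
    by (simp add: pullT_Cons T'_def scale sum_distrib_right mult.assoc)
  finally show ?thesis by (simp add: curvQ_multilinear X)
qed

lemma bil_expand: "bil n Q a b = (\<Sum>i<n. \<Sum>j<n. a i * b j * Q i j)"
  by (simp add: bil_def sum_distrib_left mult_ac)

lemma pullT_tens2: "pullT n M (tens2 g) [i, j] = bil n g (\<lambda>k. M k i) (\<lambda>k. M k j)"
  by (simp add: pullT_Cons pullT_Nil tens2_def bil_def)

context coords begin

lemma bil_g_flat: "bil n (g_flat r) a b = (\<Sum>i<n. a i * b (dual r i))"
  unfolding bil_def
proof (rule sum.cong)
  fix i assume "i \<in> {..<n}"
  then show "a i * (\<Sum>l<n. b l * g_flat r i l) = a i * b (dual r i)"
    using sum_g_flat[of i b] by (simp add: mult.commute)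
qed simp

lemma hess_eq: "hess r c i j = (if i = r - 1 \<and> j = r - 1 then c else 0)
   + (if i < r - 1 \<and> j = r + i + 1 \<or> j < r - 1 \<and> i = r + j + 1 then 1 else 0)"
  using r0 by (auto simp: hess_dpot dpot_def kd_def)

lemma AU_hess: "AU r [a, b, c, d] = curvQ (2 * r) (hess r 1) a b c d"
  by (simp add: AU_def curvQ_def hess_def xI_def)

text \<open>The ranges of the projection and of its complement are the two summands. Evaluated on
  one vector of each, both parts of the split tensor contain a zero vector, so the mixed curvature
  vanishes and \<open>curvature_irreducible\<close> applies.\<close>

lemma irreducible_model_AU: "irreducible_model n (g_flat r) (AU r)"
  unfolding irreducible_model_def
proof
  assume "\<exists>\<pi>. (\<forall>a<n. \<forall>b<n. (\<Sum>c<n. \<pi> a c * \<pi> c b) = \<pi> a b) \<and>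
      (\<exists>a<n. \<exists>b<n. \<pi> a b \<noteq> 0) \<and> (\<exists>a<n. \<exists>b<n. \<pi> a b \<noteq> kd a b) \<and>
      (\<forall>a<n. \<forall>b<n. (\<Sum>i<n. \<Sum>j<n. \<pi> i a * (kd j b - \<pi> j b) * g_flat r i j) = 0) \<and>
      eqT n 4 (AU r) (\<lambda>is. pullT n \<pi> (AU r) is + pullT n (\<lambda>i j. kd i j - \<pi> i j) (AU r) is)"
  then obtain \<pi> where idem: "\<And>a b. a < n \<Longrightarrow> b < n \<Longrightarrow> (\<Sum>c<n. \<pi> a c * \<pi> c b) = \<pi> a b"
    and nz: "\<exists>a<n. \<exists>b<n. \<pi> a b \<noteq> 0" and nid: "\<exists>a<n. \<exists>b<n. \<pi> a b \<noteq> kd a b"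
    and orth: "\<And>a b. a < n \<Longrightarrow> b < n \<Longrightarrow> (\<Sum>i<n. \<Sum>j<n. \<pi> i a * (kd j b - \<pi> j b) * g_flat r i j) = 0"
    and eqT: "eqT n 4 (AU r) (\<lambda>is. pullT n \<pi> (AU r) is + pullT n (\<lambda>i j. kd i j - \<pi> i j) (AU r) is)"
    by blast
  define \<rho> where "\<rho> i j = kd i j - \<pi> i j" for i j
  define A where "A = curvF n (2 * r) (hess r 1)"
  define P where "P u i = (\<Sum>a<n. u a * \<pi> i a)" for u i
  define R where "R u i = (\<Sum>a<n. u a * \<rho> i a)" for u i
  have PR: "P u i + R u i = u i" if "i < n" for u i
    using that by (simp add: P_def R_def \<rho>_def right_diff_distrib sum_subtractf kd_sum)
  have PP: "P (P u) i = P u i" if "i < n" for u i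
  proof -
    have "P (P u) i = (\<Sum>b<n. \<pi> i b * (\<Sum>a<n. u a * \<pi> b a))" by (simp add: P_def mult.commute)
    also have "\<dots> = (\<Sum>a<n. u a * (\<Sum>b<n. \<pi> i b * \<pi> b a))" by (rule sum_swap_mult)
    also have "\<dots> = P u i" unfolding P_def by (rule sum.cong) (use idem that in auto)
    finally show ?thesis .
  qed
  have RP: "R (P u) i = 0" and PR0: "P (R u) i = 0" if "i < n" for u i
  proof -
    show "R (P u) i = 0" using PR[OF that, of "P u"] PP[OF that, of u] by simp
    have "P u i = P (P u) i + P (R u) i"
    proof -
      have "P u i = (\<Sum>a<n. (P u a + R u a) * \<pi> i a)"
        unfolding P_def[of u i] by (rule sum.cong) (simp_all add: PR)
      then show ?thesis by (simp add: P_def[of _ i] distrib_right sum.distrib)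
    qed
    then show "P (R u) i = 0" using PP[OF that] by simp
  qed
  have basis: "curvQ (2 * r) (hess r 1) a b c d =
      A (\<lambda>i. \<pi> i a) (\<lambda>i. \<pi> i b) (\<lambda>i. \<pi> i c) (\<lambda>i. \<pi> i d) + A (\<lambda>i. \<rho> i a) (\<lambda>i. \<rho> i b) (\<lambda>i. \<rho> i c) (\<lambda>i. \<rho> i d)"
    if "a < n" "b < n" "c < n" "d < n" for a b c d
  proof -
    have "AU r [a, b, c, d] = pullT n \<pi> (AU r) [a, b, c, d] + pullT n (\<lambda>i j. kd i j - \<pi> i j) (AU r) [a, b, c, d]"
      using eqT that unfolding eqT_def by auto
    then show ?thesis unfolding A_def
      by (simp add: AU_hess pullT_curvQ[OF xn AU_hess] \<rho>_def)
  qed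
  \<comment> \<open>The decomposition is given on basis vectors; multilinearity carries it to all
    vectors.\<close>
  have split: "A u v w z = A (P u) (P v) (P w) (P z) + A (R u) (R v) (R w) (R z)" for u v w z
  proof -
    have "A u v w z = (\<Sum>a<n. u a * (\<Sum>b<n. v b * (\<Sum>c<n. w c * (\<Sum>d<n. z d * curvQ (2 * r) (hess r 1) a b c d))))"
      by (simp add: A_def curvQ_multilinear)
    also have "\<dots> = (\<Sum>a<n. u a * (\<Sum>b<n. v b * (\<Sum>c<n. w c * (\<Sum>d<n. z d *
       (A (\<lambda>i. \<pi> i a) (\<lambda>i. \<pi> i b) (\<lambda>i. \<pi> i c) (\<lambda>i. \<pi> i d) + A (\<lambda>i. \<rho> i a) (\<lambda>i. \<rho> i b) (\<lambda>i. \<rho> i c) (\<lambda>i. \<rho> i d))))))"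
      using basis by (intro sum.cong refl arg_cong2[where f = "(*)"]) auto
    also have "\<dots> = A (P u) (P v) (P w) (P z) + A (R u) (R v) (R w) (R z)"
      unfolding A_def P_def[abs_def] R_def[abs_def] curvF_sum by (simp only: distrib_left sum.distrib)
    finally show ?thesis .
  qed
  have "(\<forall>a\<in>range P. \<forall>i<n. a i = 0) \<or> (\<forall>b\<in>range R. \<forall>i<n. b i = 0)"
  proof (rule curvature_irreducible[where c = 1 and \<kappa> = 0])
    show "\<exists>a\<in>range P. \<exists>b\<in>range R. \<forall>i<n. w i = a i + b i" for w
      using PR[of _ w] by (intro bexI[of _ "P w"] bexI[of _ "R w"]) auto
    show "(\<Sum>i<n. a i * b (dual r i)) + 0 * a (2 * r) * b (2 * r) = 0" if "a \<in> range P" "b \<in> range R" for a b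
    proof -
      from that obtain u v where ab: "a = P u" "b = R v" by blast
      have "(\<Sum>i<n. a i * b (dual r i)) = bil n (g_flat r) (P u) (R v)" by (simp add: ab bil_g_flat)
      also have "\<dots> = (\<Sum>s<n. u s * (\<Sum>s'<n. v s' * bil n (g_flat r) (\<lambda>i. \<pi> i s) (\<lambda>i. \<rho> i s')))"
        unfolding P_def[abs_def] R_def[abs_def] bil_sum_left bil_sum_right ..
      also have "\<dots> = 0" using orth by (simp add: bil_expand \<rho>_def)
      finally show ?thesis by simp
    qed
    show "curvF n (2 * r) (hess r 1) a b w w' = 0" if "a \<in> range P" "b \<in> range R" for a b w w'
    proof -
      from that obtain u v where ab: "a = P u" "b = R v" by blast
      have "A (P (P u)) (P (R v)) (P w) (P w') = 0" unfolding A_def by (rule curvF_zero(2)) (simp_all add: PR0)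
      moreover have "A (R (P u)) (R (R v)) (R w) (R w') = 0" unfolding A_def by (rule curvF_zero(1)) (simp_all add: RP)
      ultimately show ?thesis using split[of a b w w'] by (simp add: A_def ab)
    qed
  qed simp
  moreover have "P (kd a) i = \<pi> i a" "R (kd a) i = \<rho> i a" if "a < n" for a i
    using that by (simp_all add: P_def R_def kd_sum)
  ultimately have "(\<forall>i<n. \<forall>a<n. \<pi> i a = 0) \<or> (\<forall>i<n. \<forall>a<n. \<rho> i a = 0)"
    by (metis rangeI)
  then show False using nz nid by (auto simp: \<rho>_def)
qed

text \<open>The frame change is diagonal up to one entry in the (y,x) position. Dual directions get
  reciprocal factors, which preserves the flat metric; the extra entry produces the coefficient
  g_xx.\<close>

lemma is_model_gM_aux:
  fixes \<alpha> l :: real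
  assumes nz: "\<alpha> \<noteq> 0" "l \<noteq> 0" and c2: "\<alpha>\<^sup>2 * l\<^sup>2 = c2"
  obtains M where "invertible_mat n M" "eqT n 2 (pullT n M (tens2 (g_flat r))) (tens2 (gM r \<psi> p))"
    "\<And>a b c d. a < n \<Longrightarrow> b < n \<Longrightarrow> c < n \<Longrightarrow> d < n \<Longrightarrow>
       pullT n M (AU r) [a, b, c, d] = curvQ (2 * r) (hess r c2) a b c d"
    "\<And>a b c d e. a < n \<Longrightarrow> b < n \<Longrightarrow> c < n \<Longrightarrow> d < n \<Longrightarrow> e < n \<Longrightarrow>
       pullT n M (AU1 r) [a, b, c, d, e] = (if e = r - 1 then curvQ (2 * r) (Qur r (c2 * l)) a b c d else 0)"
proof -
  \<comment> \<open>A chain component equals 1 after pullback iff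
    \<open>\<alpha>\<^sup>2 * up i = up (i + 1)\<close>; starting from \<open>up (r - 1) = l\<close>
    this dictates the powers of \<open>\<alpha>\<close>.\<close>
  define up where "up i = l / \<alpha> ^ (2 * (r - 1 - i))" for i :: nat
  define dg where "dg i = (if i < r then up i else if i < 2 * r then 1 / up (i - r)
     else if i = 2 * r then \<alpha> else 1 / \<alpha>)" for i
  \<comment> \<open>Chosen so that the image of the x-field has square length
    \<open>2 * \<alpha> * k = - 2 * pot r \<psi> p\<close>.\<close>
  define k where "k = - pot r \<psi> p / \<alpha>"
  define mk where "mk d k j i = (if j = i then d i else 0) + (if j = Suc (2 * r) \<and> i = 2 * r then k else 0)"
    for d :: "nat \<Rightarrow> real" and k :: real and j i
  define M where "M = mk dg k"
  have up0: "up i \<noteq> 0" for i using nz by (simp add: up_def)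
  have dg0: "dg i \<noteq> 0" for i using nz up0 by (simp add: dg_def)
  have dgx: "dg (2 * r) = \<alpha>" "dg (Suc (2 * r)) = 1 / \<alpha>" using r0 by (auto simp: dg_def)
  have dual_dg: "dg i * dg (dual r i) = 1" if "i < n" for i
    using that up0 nz n by (auto simp: dg_def dual_def)
  have row: "(\<Sum>j<n. mk d k i j * f j) = d i * f i + (if i = Suc (2 * r) then k * f (2 * r) else 0)"
    if "i < n" for d k i and f :: "nat \<Rightarrow> real"
  proof -
    have "(\<Sum>j<n. mk d k i j * f j) = (\<Sum>j<n. (if j = i then d i * f i else 0)
       + (if j = 2 * r then if i = Suc (2 * r) then k * f (2 * r) else 0 else 0))"
      by (rule sum.cong) (auto simp: mk_def algebra_simps)
    then show ?thesis using that by (simp add: sum.distrib sum.delta)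
  qed
  have col: "(\<Sum>j<n. mk d k j i * f j) = d i * f i + (if i = 2 * r then k * f (Suc (2 * r)) else 0)"
    if "i < n" for d k i and f :: "nat \<Rightarrow> real"
  proof -
    have "(\<Sum>j<n. mk d k j i * f j) = (\<Sum>j<n. (if j = i then d i * f i else 0)
       + (if j = Suc (2 * r) then if i = 2 * r then k * f (Suc (2 * r)) else 0 else 0))"
      by (rule sum.cong) (auto simp: mk_def algebra_simps)
    then show ?thesis using that by (simp add: sum.distrib sum.delta)
  qed
  \<comment> \<open>The inverse has off-diagonal entry \<open>- k\<close> without further factor
    because the diagonal entries for x and y are reciprocal.\<close>
  have "(\<Sum>j<n. mk dg k a j * mk (\<lambda>i. 1 / dg i) (- k) j b) = kd a b"
    "(\<Sum>j<n. mk (\<lambda>i. 1 / dg i) (- k) a j * mk dg k j b) = kd a b" if "a < n" "b < n" for a b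
    unfolding row[OF that(1)] using dg0 nz by (auto simp: mk_def kd_def dgx)
  then have inv: "invertible_mat n M" unfolding invertible_mat_def M_def by blast
  have bilM: "bil n Q (\<lambda>i. M i a) (\<lambda>i. M i b) = dg a * dg b * Q a b
      + (if b = 2 * r then dg a * k * Q a (Suc (2 * r)) else 0)
      + (if a = 2 * r then k * dg b * Q (Suc (2 * r)) b else 0)
      + (if a = 2 * r \<and> b = 2 * r then k * k * Q (Suc (2 * r)) (Suc (2 * r)) else 0)"
    if "a < n" "b < n" for a b Q
    unfolding bil_def M_def col[OF that(2)] col[OF that(1)] by (simp add: algebra_simps)
  have g: "bil n (g_flat r) (\<lambda>i. M i a) (\<lambda>i. M i b) = gM r \<psi> p a b" if "a < n" "b < n" for a b
  proof -
    have 1: "dg a * dg b * g_flat r a b = g_flat r a b"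
      using that dual_dg[OF that(1)] by (auto simp: g_flat_dual)
    have 2: "\<alpha> * k = - pot r \<psi> p" "k * \<alpha> = - pot r \<psi> p" using nz by (simp_all add: k_def)
    have 3: "g_flat r a (Suc (2 * r)) = kd a (2 * r)" "g_flat r (Suc (2 * r)) b = kd b (2 * r)" for a b
    proof -
      show 4: "g_flat r (Suc (2 * r)) b = kd b (2 * r)" for b by (auto simp: g_flat_dual kd_def)
      show "g_flat r a (Suc (2 * r)) = kd a (2 * r)" unfolding 4[symmetric] by (rule g_flat_sym)
    qed
    show ?thesis
      unfolding bilM[OF that] gM_pot 1 3
      using 2 by (cases "a = 2 * r"; cases "b = 2 * r") (simp_all add: dgx kd_def)
  qed
  have Mx: "M (2 * r) a = (if a = 2 * r then \<alpha> else 0)" for a by (simp add: M_def mk_def dgx)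
  have Mu: "M (r - 1) a = (if a = r - 1 then l else 0)" for a
    using r0 by (auto simp: M_def mk_def dg_def up_def)
  have chain: "\<alpha>\<^sup>2 * (up i * (1 / up (i + 1))) = 1" if "i < r - 1" for i
  proof -
    have "2 * (r - 1 - i) = 2 + 2 * (r - 1 - (i + 1))" using that by simp
    then have "\<alpha> ^ (2 * (r - 1 - i)) = \<alpha>\<^sup>2 * \<alpha> ^ (2 * (r - 1 - (i + 1)))" by (metis power_add)
    then show ?thesis using nz by (simp add: up_def)
  qed
  have hess2: "\<alpha>\<^sup>2 * bil n (hess r 1) (\<lambda>i. M i a) (\<lambda>i. M i b) = hess r c2 a b" if "a < n" "b < n" for a b
  proof -
    have "bil n (hess r 1) (\<lambda>i. M i a) (\<lambda>i. M i b) = dg a * dg b * hess r 1 a b"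
      unfolding bilM[OF that] by simp
    moreover have "\<alpha>\<^sup>2 * (dg a * dg b * hess r 1 a b) = hess r c2 a b"
    proof -
      have u: "dg (r - 1) = l" using r0 by (simp add: dg_def up_def)
      have ch: "\<alpha>\<^sup>2 * (dg i * dg (r + i + 1)) = 1" if "i < r - 1" for i
      proof -
        have "dg i = up i" "dg (r + i + 1) = 1 / up (i + 1)" using that by (auto simp: dg_def)
        then show ?thesis using chain[OF that] by (simp only:)
      qed
      consider "a = r - 1" "b = r - 1" | "a < r - 1" "b = r + a + 1" | "b < r - 1" "a = r + b + 1"
        | "hess r 1 a b = 0" "hess r c2 a b = 0"
        unfolding hess_eq by fastforce
      then show ?thesis
      proof cases
        case 1
        then have "hess r 1 a b = 1" "hess r c2 a b = c2" using r0 by (auto simp: hess_eq)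
        then show ?thesis using 1 u c2 by (simp add: power2_eq_square)
      next
        case 2
        then have "hess r 1 a b = 1" "hess r c2 a b = 1" using r0 by (auto simp: hess_eq)
        then show ?thesis using 2 ch by simp
      next
        case 3
        then have "hess r 1 a b = 1" "hess r c2 a b = 1" using r0 by (auto simp: hess_eq)
        then show ?thesis using 3 ch[of b] by (simp add: mult.commute)
      qed simp
    qed
    ultimately show ?thesis by simp
  qed
  have u2: "\<alpha>\<^sup>2 * bil n (Qur r 1) (\<lambda>i. M i a) (\<lambda>i. M i b) * l = Qur r (c2 * l) a b" if "a < n" "b < n" for a b
    unfolding bilM[OF that] using r0 c2 by (auto simp: Qur_def uI_def dg_def up_def power2_eq_square)
  have curvM: "curvF n (2 * r) Q (\<lambda>i. M i a) (\<lambda>i. M i b) (\<lambda>i. M i c) (\<lambda>i. M i d) * s = curvQ (2 * r) Q' a b c d"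
    if lt: "a < n" "b < n" "c < n" "d < n" and Q: "\<And>a b. a < n \<Longrightarrow> b < n \<Longrightarrow> \<alpha>\<^sup>2 * bil n Q (\<lambda>i. M i a) (\<lambda>i. M i b) * s = Q' a b"
    for Q Q' a b c d s
  proof -
    let ?B = "\<lambda>a b. bil n Q (\<lambda>i. M i a) (\<lambda>i. M i b)"
    have "curvQ (2 * r) Q' a b c d = curvQ (2 * r) (\<lambda>a b. \<alpha>\<^sup>2 * ?B a b * s) a b c d"
      using lt by (simp add: curvQ_def Q)
    then show ?thesis
      unfolding curvF_def Mx
      by (cases "a = 2 * r"; cases "b = 2 * r"; cases "c = 2 * r"; cases "d = 2 * r"; simp add: curvQ_def power2_eq_square algebra_simps)
  qed
  have R: "pullT n M (AU r) [a, b, c, d] = curvQ (2 * r) (hess r c2) a b c d"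
    if "a < n" "b < n" "c < n" "d < n" for a b c d
    unfolding pullT_curvQ[OF xn AU_hess] using curvM[OF that, of "hess r 1" 1 "hess r c2"] hess2 by simp
  have R1: "pullT n M (AU1 r) [a, b, c, d, e] = (if e = r - 1 then curvQ (2 * r) (Qur r (c2 * l)) a b c d else 0)"
    if "a < n" "b < n" "c < n" "d < n" "e < n" for a b c d e
  proof -
    have "pullT n M (AU1 r) [a, b, c, d, e] = curvF n (2 * r) (Qur r 1) (\<lambda>i. M i a) (\<lambda>i. M i b) (\<lambda>i. M i c) (\<lambda>i. M i d)
       * pullT n M (\<lambda>es. kd (r - 1) (hd es)) [e]"
      by (rule pullT_curvQ_prod[OF xn]) (auto simp: AU1_def xI_def uI_def length_Suc_conv kd_def)
    also have "pullT n M (\<lambda>es. kd (r - 1) (hd es)) [e] = M (r - 1) e"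
    proof -
      have "r - 1 < n" using n by simp
      then show ?thesis by (simp add: pullT_Cons pullT_Nil kd_sum)
    qed
    finally show ?thesis
      using curvM[OF that(1-4), of "Qur r 1" l "Qur r (c2 * l)"] u2 by (simp add: Mu)
  qed
  have "eqT n 2 (pullT n M (tens2 (g_flat r))) (tens2 (gM r \<psi> p))"
    unfolding eqT_def by (auto simp: length_Suc_conv numeral_2_eq_2 pullT_tens2 g) (simp add: tens2_def)
  then show ?thesis using that[OF inv _ R R1] by blast
qed

lemma is_model_0:
  assumes \<psi>: "\<And>x. (\<psi> has_real_derivative \<psi>1 x) (at x)" and \<psi>1: "\<And>x. (\<psi>1 has_real_derivative \<psi>2 x) (at x)"
    and pos: "\<And>x. \<psi>2 x > 0"
  shows "is_model n (g_flat r) [AU r] (gM r \<psi>)"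
  unfolding is_model_def
proof
  fix p assume "p \<in> Rn n"
  \<comment> \<open>With \<open>\<alpha> = 1\<close> the only condition left is that
    \<open>l\<^sup>2\<close> equals the second derivative of \<open>\<psi>\<close>.\<close>
  define l where "l = sqrt (\<psi>2 (p (r - 1)))"
  have "l \<noteq> 0" "1\<^sup>2 * l\<^sup>2 = \<psi>2 (p (r - 1))" using pos[of "p (r - 1)"] by (auto simp: l_def)
  from is_model_gM_aux[OF one_neq_zero this] obtain M where M: "invertible_mat n M" "eqT n 2 (pullT n M (tens2 (g_flat r))) (tens2 (gM r \<psi> p))"
    "\<And>a b c d. a < n \<Longrightarrow> b < n \<Longrightarrow> c < n \<Longrightarrow> d < n \<Longrightarrow>
       pullT n M (AU r) [a, b, c, d] = curvQ (2 * r) (hess r (\<psi>2 (p (r - 1)))) a b c d"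
    by metis
  have "eqT n 4 (pullT n M (AU r)) (nablaR n (gM r \<psi>) 0 p)"
    unfolding eqT_def by (auto simp: length_Suc_conv eval_nat_numeral M(3) nablaR_def Rt_gM[OF \<psi> \<psi>1] One_nat_def)
  then show "\<exists>\<Phi>. invertible_mat n \<Phi> \<and> eqT n 2 (pullT n \<Phi> (tens2 (g_flat r))) (tens2 (gM r \<psi> p)) \<and>
     (\<forall>j<length [AU r]. eqT n (4 + j) (pullT n \<Phi> ([AU r] ! j)) (nablaR n (gM r \<psi>) j p))"
    using M(1,2) by (intro exI[of _ M]) auto
qed

lemma is_model_1:
  assumes \<psi>: "\<And>x. (\<psi> has_real_derivative \<psi>1 x) (at x)" and \<psi>1: "\<And>x. (\<psi>1 has_real_derivative \<psi>2 x) (at x)"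
    and \<psi>2: "\<And>x. (\<psi>2 has_real_derivative \<psi>3 x) (at x)"
    and pos: "\<And>x. \<psi>2 x > 0" and pos3: "\<And>x. \<psi>3 x > 0"
  shows "is_model n (g_flat r) [AU r, AU1 r] (gM r \<psi>)"
  unfolding is_model_def
proof
  fix p assume "p \<in> Rn n"
  define c2 where "c2 = \<psi>2 (p (r - 1))"
  define c3 where "c3 = \<psi>3 (p (r - 1))"
  \<comment> \<open>The conditions \<open>\<alpha>\<^sup>2 * l\<^sup>2 = c2\<close> and
    \<open>c2 * l = c3\<close> determine \<open>l\<close>, and \<open>\<alpha>\<close> up to
    sign.\<close>
  define l where "l = c3 / c2"
  define \<alpha> where "\<alpha> = sqrt (c2 / l\<^sup>2)"
  have pos': "c2 > 0" "c3 > 0" using pos pos3 by (auto simp: c2_def c3_def)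
  then have l: "l > 0" by (simp add: l_def)
  then have "\<alpha> \<noteq> 0" "l \<noteq> 0" "\<alpha>\<^sup>2 * l\<^sup>2 = c2" using pos' by (auto simp: \<alpha>_def)
  from is_model_gM_aux[OF this] obtain M where M: "invertible_mat n M" "eqT n 2 (pullT n M (tens2 (g_flat r))) (tens2 (gM r \<psi> p))"
    "\<And>a b c d. a < n \<Longrightarrow> b < n \<Longrightarrow> c < n \<Longrightarrow> d < n \<Longrightarrow>
       pullT n M (AU r) [a, b, c, d] = curvQ (2 * r) (hess r c2) a b c d"
    "\<And>a b c d e. a < n \<Longrightarrow> b < n \<Longrightarrow> c < n \<Longrightarrow> d < n \<Longrightarrow> e < n \<Longrightarrow>
       pullT n M (AU1 r) [a, b, c, d, e] = (if e = r - 1 then curvQ (2 * r) (Qur r (c2 * l)) a b c d else 0)"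
    by metis
  have c3: "c2 * l = c3" using pos' by (simp add: l_def)
  have "eqT n 4 (pullT n M (AU r)) (nablaR n (gM r \<psi>) 0 p)"
    unfolding eqT_def by (auto simp: length_Suc_conv eval_nat_numeral M(3) nablaR_def Rt_gM[OF \<psi> \<psi>1] One_nat_def c2_def)
  moreover have "eqT n 5 (pullT n M (AU1 r)) (nablaR n (gM r \<psi>) 1 p)"
  proof -
    have "pullT n M (AU1 r) [a, b, c, d, e] = nablaR n (gM r \<psi>) 1 p [a, b, c, d, e]"
      if "a < n" "b < n" "c < n" "d < n" "e < n" for a b c d e
      using that by (simp add: M(4) nablaR1_gM[OF \<psi> \<psi>1 \<psi>2] c3 c3_def)
    then show ?thesis unfolding eqT_def by (auto simp: length_Suc_conv eval_nat_numeral One_nat_def)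
  qed
  ultimately show "\<exists>\<Phi>. invertible_mat n \<Phi> \<and> eqT n 2 (pullT n \<Phi> (tens2 (g_flat r))) (tens2 (gM r \<psi> p)) \<and>
     (\<forall>j<length [AU r, AU1 r]. eqT n (4 + j) (pullT n \<Phi> ([AU r, AU1 r] ! j)) (nablaR n (gM r \<psi>) j p))"
    using M(1,2) by (intro exI[of _ M]) (auto simp: less_Suc_eq One_nat_def)
qed

section \<open>Obstruction to 2-curvature homogeneity\<close>

lemma bil_Qur: "bil n (Qur r c) a b = c * a (r - 1) * b (r - 1)"
proof -
  have u: "r - 1 < n" using n by simp
  have "Qur r c i j = c * kd (r - 1) i * kd (r - 1) j" for i j by (auto simp: Qur_def uI_def kd_def)
  then have "bil n (Qur r c) a b = (\<Sum>k<n. a k * (\<Sum>l<n. (c * kd (r - 1) k) * (b l * kd (r - 1) l)))"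
    by (simp add: bil_def mult_ac)
  also have "\<dots> = (\<Sum>k<n. (c * b (r - 1)) * (a k * kd (r - 1) k))"
  proof (rule sum.cong)
    fix k
    have "(\<Sum>l<n. (c * kd (r - 1) k) * (b l * kd (r - 1) l)) = c * kd (r - 1) k * b (r - 1)"
      unfolding sum_distrib_left[symmetric] kd_sum(2)[OF u] ..
    then show "a k * (\<Sum>l<n. (c * kd (r - 1) k) * (b l * kd (r - 1) l)) = (c * b (r - 1)) * (a k * kd (r - 1) k)"
      by simp
  qed simp
  also have "\<dots> = c * a (r - 1) * b (r - 1)"
    unfolding sum_distrib_left[symmetric] kd_sum(2)[OF u] by simp
  finally show ?thesis .
qed

text \<open>Matching \<nabla>R forces the pullback of du_r to annihilate the x-direction. Hence the
  (x,x) part of the second covariant derivative is only rescaled by a nonzero factor, and it cannot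
  vanish at one point but not at the other.\<close>

lemma not_curv_hom_2:
  assumes \<psi>: "\<And>x. (\<psi> has_real_derivative \<psi>1 x) (at x)" and \<psi>1: "\<And>x. (\<psi>1 has_real_derivative \<psi>2 x) (at x)"
    and \<psi>2: "\<And>x. (\<psi>2 has_real_derivative \<psi>3 x) (at x)" and \<psi>3: "\<And>x. (\<psi>3 has_real_derivative \<psi>4 x) (at x)"
    and pos3: "\<And>x. \<psi>3 x > 0"
  shows "\<not> curv_hom n (gM r \<psi>) 2"
proof
  assume ch: "curv_hom n (gM r \<psi>) 2"
  let ?g = "gM r \<psi>" and ?u = "r - 1" and ?x = "2 * r"
  define P where "P = (\<lambda>i::nat. 0::real)"
  \<comment> \<open>The index r - 2 is u_(r-1). Both points have u_r = 0, so the derivatives of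
    \<open>\<psi>\<close> agree there and only the extra component differs.\<close>
  define Q where "Q = P(r - 2 := 1)"
  have PQ: "P \<in> Rn n" "Q \<in> Rn n" using n by (auto simp: Rn_def P_def Q_def)
  have Qu: "Q ?u = 0" "P ?u = 0" "Q (r - 2) = 1" "P (r - 2) = 0" using r2 by (auto simp: Q_def P_def)
  have u: "?u < n" "?u \<noteq> ?x" using n r0 by auto
  from ch PQ obtain M where M: "\<And>j. j \<le> 2 \<Longrightarrow> eqT n (4 + j) (pullT n M (nablaR n ?g j Q)) (nablaR n ?g j P)"
    unfolding curv_hom_def by metis
  \<comment> \<open>Rows of the matrix: \<open>a\<close> and \<open>b\<close> are the pullbacks of
    dx and du_r, and \<open>D\<close> is the value of their wedge product on the x- and
    u_r-directions.\<close>
  define a where "a = M ?x"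
  define b where "b = M ?u"
  define D where "D = a ?x * b ?u - a ?u * b ?x"
  define c3 where "c3 = \<psi>3 0"
  have c3: "c3 > 0" using pos3 by (simp add: c3_def)
  have cF: "curvF n ?x (Qur r c) (\<lambda>i. M i ?x) (\<lambda>i. M i ?u) (\<lambda>i. M i ?u) (\<lambda>i. M i ?x) = c * D\<^sup>2" for c
    by (simp add: curvF_def bil_Qur D_def a_def b_def power2_eq_square algebra_simps)
  have cQ: "curvQ ?x (Qur r c) ?x ?u ?u ?x = c" for c
    using u by (simp add: curvQ_def Qur_def uI_def)
  have 1: "c3 * D\<^sup>2 * b e = (if e = ?u then c3 else 0)" if "e < n" for e
  proof -
    have "eqT n 5 (pullT n M (nablaR n ?g 1 Q)) (nablaR n ?g 1 P)" using M[of 1] by simp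
    then have "pullT n M (nablaR n ?g 1 Q) [?x, ?u, ?u, ?x, e] = nablaR n ?g 1 P [?x, ?u, ?u, ?x, e]"
      using that u by (simp add: eqT_def)
    also have "pullT n M (nablaR n ?g 1 Q) [?x, ?u, ?u, ?x, e]
      = curvF n ?x (Qur r c3) (\<lambda>i. M i ?x) (\<lambda>i. M i ?u) (\<lambda>i. M i ?u) (\<lambda>i. M i ?x) * pullT n M (\<lambda>es. kd ?u (hd es)) [e]"
      by (rule pullT_curvQ_prod[OF xn]) (auto simp: length_Suc_conv nablaR1_gM[OF \<psi> \<psi>1 \<psi>2] Qu kd_def c3_def)
    also have "pullT n M (\<lambda>es. kd ?u (hd es)) [e] = b e"
      using u by (simp add: pullT_Cons pullT_Nil kd_sum b_def)
    finally show ?thesis using that u by (simp add: cF cQ nablaR1_gM[OF \<psi> \<psi>1 \<psi>2] Qu c3_def)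
  qed
  \<comment> \<open>The derivative slot u_r gives D nonzero; the derivative slot x, where \<nabla>R
    vanishes, then gives \<open>b ?x = 0\<close>.\<close>
  have "D \<noteq> 0" using 1[OF u(1)] c3 by auto
  then have bx: "b ?x = 0" using 1[OF xn] c3 u by auto
  have "eqT n 6 (pullT n M (nablaR n ?g 2 Q)) (nablaR n ?g 2 P)" using M[of 2] by simp
  then have "pullT n M (nablaR n ?g 2 Q) [?x, ?u, ?u, ?x, ?x, ?x] = nablaR n ?g 2 P [?x, ?u, ?u, ?x, ?x, ?x]"
    using u by (simp add: eqT_def)
  also have "\<dots> = 0" using u by (simp add: nablaR2_gM[OF \<psi> \<psi>1 \<psi>2 \<psi>3] Qu)
  also have "pullT n M (nablaR n ?g 2 Q) [?x, ?u, ?u, ?x, ?x, ?x]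
      = curvF n ?x (Qur r 1) (\<lambda>i. M i ?x) (\<lambda>i. M i ?u) (\<lambda>i. M i ?u) (\<lambda>i. M i ?x)
       * pullT n M (\<lambda>es. kd ?u (es ! 0) * (\<psi>4 0 * kd ?u (es ! Suc 0)) - kd ?x (es ! 0) * (c3 * kd ?x (es ! Suc 0))) [?x, ?x]"
    by (rule pullT_curvQ_prod[OF xn]) (auto simp: length_Suc_conv nablaR2_gM[OF \<psi> \<psi>1 \<psi>2 \<psi>3] Qu u u(2)[symmetric] kd_def c3_def)
  also have "pullT n M (\<lambda>es. kd ?u (es ! 0) * (\<psi>4 0 * kd ?u (es ! Suc 0)) - kd ?x (es ! 0) * (c3 * kd ?x (es ! Suc 0))) [?x, ?x]
     = (\<Sum>i<n. M i ?x * (\<Sum>j<n. (kd ?u i * \<psi>4 0) * (M j ?x * kd ?u j) - (kd ?x i * c3) * (M j ?x * kd ?x j)))"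
    by (simp add: pullT_Cons pullT_Nil algebra_simps)
  also have "\<dots> = (\<Sum>i<n. (\<psi>4 0 * b ?x) * (M i ?x * kd ?u i) - (c3 * a ?x) * (M i ?x * kd ?x i))"
  proof (rule sum.cong)
    fix i
    have "(\<Sum>j<n. (kd ?u i * \<psi>4 0) * (M j ?x * kd ?u j) - (kd ?x i * c3) * (M j ?x * kd ?x j))
       = kd ?u i * \<psi>4 0 * b ?x - kd ?x i * c3 * a ?x"
      unfolding sum_subtractf sum_distrib_left[symmetric] kd_sum(2)[OF u(1)] kd_sum(2)[OF xn] a_def b_def ..
    then have "M i ?x * (\<Sum>j<n. (kd ?u i * \<psi>4 0) * (M j ?x * kd ?u j) - (kd ?x i * c3) * (M j ?x * kd ?x j))
      = M i ?x * (kd ?u i * \<psi>4 0 * b ?x - kd ?x i * c3 * a ?x)" by (simp only:)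
    also have "\<dots> = (\<psi>4 0 * b ?x) * (M i ?x * kd ?u i) - (c3 * a ?x) * (M i ?x * kd ?x i)"
      by (simp add: algebra_simps)
    finally show "M i ?x * (\<Sum>j<n. (kd ?u i * \<psi>4 0) * (M j ?x * kd ?u j) - (kd ?x i * c3) * (M j ?x * kd ?x j))
      = (\<psi>4 0 * b ?x) * (M i ?x * kd ?u i) - (c3 * a ?x) * (M i ?x * kd ?x i)" .
  qed simp
  also have "\<dots> = \<psi>4 0 * b ?x * b ?x - c3 * a ?x * a ?x"
    unfolding sum_subtractf sum_distrib_left[symmetric] kd_sum(2)[OF u(1)] kd_sum(2)[OF xn] by (simp add: a_def b_def)
  \<comment> \<open>At \<open>P\<close> this component is 0, while at \<open>Q\<close> the
    coefficient u_(r-1) = 1 leaves c3. With \<open>b ?x = 0\<close> the term in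
    \<open>\<psi>4\<close> drops out, so \<open>a ?x = 0\<close>, which contradicts D
    nonzero.\<close>
  finally have "D\<^sup>2 * (c3 * (a ?x)\<^sup>2) = 0" by (simp add: cF bx power2_eq_square)
  then have "a ?x = 0" using \<open>D \<noteq> 0\<close> c3 by simp
  then show False using \<open>D \<noteq> 0\<close> bx by (simp add: D_def)
qed

end

section \<open>Smooth functions\<close>

text \<open>The integral of h from 0 to t, rescaled to the unit interval: negative t needs no
  separate case, and the domain of integration is fixed, as the theorems on parameter integrals
  require.\<close>

definition tint :: "(real \<Rightarrow> real) \<Rightarrow> real \<Rightarrow> real" where
  "tint h t = t * integral {0..1} (\<lambda>s. h (t * s))"

lemma tint_0 [simp]: "tint h 0 = 0"
  by (simp add: tint_def)

lemma tint_eq_antiderivative: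
  assumes G: "\<And>t. (G has_real_derivative h t) (at t)"
  shows "tint h t = G t - G 0"
proof -
  have "((\<lambda>s. h (t * s) * t) has_integral G (t * 1) - G (t * 0)) {0..1}"
  proof (rule fundamental_theorem_of_calculus)
    fix s :: real
    have "((\<lambda>s. G (t * s)) has_real_derivative h (t * s) * t) (at s within {0..1})"
      by (rule DERIV_chain2[of G]) (auto intro!: derivative_eq_intros G)
    then show "((\<lambda>s. G (t * s)) has_vector_derivative h (t * s) * t) (at s within {0..1})"
      by (simp add: has_real_derivative_iff_has_vector_derivative)
  qed simp
  from integral_unique[OF this] have "integral {0..1} (\<lambda>s. h (t * s)) * t = G t - G 0" by simp
  then show ?thesis unfolding tint_def by (subst mult.commute)
qed

lemma continuous_antiderivative:
  fixes h :: "real \<Rightarrow> real"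
  assumes h: "continuous_on UNIV h"
  obtains G where "\<And>t. (G has_real_derivative h t) (at t)"
proof -
  define G where "G t = (if t \<ge> 0 then integral {0..t} h else - integral {t..0} h)" for t
  have int: "h integrable_on {a..b}" for a b
    by (rule integrable_continuous_interval) (use h continuous_on_subset in blast)
  have G: "G t = integral {a..t} h - integral {a..0} h" if "a \<le> 0" "a \<le> t" for a t
  proof (cases "t \<ge> 0")
    case True
    then show ?thesis using Henstock_Kurzweil_Integration.integral_combine[of a 0 t h] that int by (simp add: G_def)
  next
    case False
    then show ?thesis using Henstock_Kurzweil_Integration.integral_combine[of a t 0 h] that int by (simp add: G_def)
  qed
  have "(G has_real_derivative h t) (at t)" for t
  proof -
    \<comment> \<open>A base point to the left of both 0 and t turns the signed integral near t into
      an ordinary one minus a constant.\<close>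
    define a where "a = min 0 t - 1"
    define b where "b = t + 1"
    have "((\<lambda>u. integral {a..u} h) has_real_derivative h t) (at t within {a..b})"
      by (rule integral_has_real_derivative) (use h continuous_on_subset in \<open>auto simp: a_def b_def\<close>)
    then have "((\<lambda>u. integral {a..u} h) has_real_derivative h t) (at t)"
      by (simp add: at_within_Icc_at a_def b_def)
    then have "((\<lambda>u. integral {a..u} h - integral {a..0} h) has_real_derivative h t) (at t)"
      by (auto intro!: derivative_eq_intros)
    then show ?thesis
      by (rule has_field_derivative_transform_within_open[where S = "{a<..<b}"])
        (auto simp: a_def b_def intro!: G[symmetric])
  qed
  then show ?thesis by (rule that)
qed

lemma tint_has_derivative:
  assumes "continuous_on UNIV h" shows "(tint h has_real_derivative h t) (at t)"
proof -
  obtain G where G: "\<And>t. (G has_real_derivative h t) (at t)" using continuous_antiderivative[OF assms] by metis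
  have "tint h = (\<lambda>t. G t - G 0)" using tint_eq_antiderivative[OF G] by auto
  then show ?thesis using G by (auto intro!: derivative_eq_intros)
qed

lemma continuous_on_fun_upd:
  fixes m :: nat and f :: "'a::topological_space \<Rightarrow> nat \<Rightarrow> real"
  assumes "continuous_on S f" "continuous_on S g"
  shows "continuous_on S (\<lambda>x. (f x)(m := g x))"
proof (rule continuous_on_coordinatewise_then_product)
  fix i show "continuous_on S (\<lambda>x. ((f x)(m := g x)) i)"
    using assms continuous_on_product_then_coordinatewise[OF assms(1), of i] by (cases "i = m") auto
qed

text \<open>A class of functions of countably many coordinates that contains the components of all maps
  below and is closed under partial derivatives; in \<open>integ\<close> the coordinate \<open>m\<close> is the upper limit
  of the integral.\<close>

inductive_set sm :: "((nat \<Rightarrow> real) \<Rightarrow> real) set" where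
  const: "(\<lambda>p. c) \<in> sm"
| coord: "(\<lambda>p. p i) \<in> sm"
| add: "f \<in> sm \<Longrightarrow> g \<in> sm \<Longrightarrow> (\<lambda>p. f p + g p) \<in> sm"
| mult: "f \<in> sm \<Longrightarrow> g \<in> sm \<Longrightarrow> (\<lambda>p. f p * g p) \<in> sm"
| comp: "f \<in> sm \<Longrightarrow> \<forall>j x. (H j has_real_derivative H (Suc j) x) (at x) \<Longrightarrow> (\<lambda>p. H (j :: nat) (f p)) \<in> sm"
| integ: "f \<in> sm \<Longrightarrow> (\<lambda>p. tint (\<lambda>s. f (p(m := s))) (p m)) \<in> sm"
| freeze: "f \<in> sm \<Longrightarrow> (\<lambda>p. f (p(m := c))) \<in> sm"

lemma sm_continuous: "f \<in> sm \<Longrightarrow> continuous_on UNIV f"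
proof (induction rule: sm.induct)
  case (coord i)
  show ?case using continuous_on_product_then_coordinatewise[OF continuous_on_id, of UNIV i] by simp
next
  case (comp f H j)
  have "continuous_on UNIV (H j)"
    by (rule DERIV_continuous_on[where D = "H (Suc j)"]) (use comp in \<open>auto intro: has_field_derivative_at_within\<close>)
  then show ?case using comp.IH by (rule continuous_on_compose2) auto
next
  case (integ f m)
  have id: "continuous_on UNIV (\<lambda>p :: nat \<Rightarrow> real. p m)"
    using continuous_on_product_then_coordinatewise[OF continuous_on_id, of UNIV m] by simp
  have "continuous_on UNIV (\<lambda>p. integral (cbox 0 1) (\<lambda>s. f (p(m := p m * s))))"
  proof (rule integral_continuous_on_param)
    have "continuous_on (UNIV \<times> cbox 0 1) (\<lambda>x :: (nat \<Rightarrow> real) \<times> real. fst x m * snd x)"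
      by (intro continuous_intros continuous_on_compose2[OF id]) auto
    then have "continuous_on (UNIV \<times> cbox 0 1) (\<lambda>x :: (nat \<Rightarrow> real) \<times> real. (fst x)(m := fst x m * snd x))"
      by (intro continuous_on_fun_upd continuous_on_fst continuous_on_id)
    then have "continuous_on (UNIV \<times> cbox 0 1) (\<lambda>x. f ((fst x)(m := fst x m * snd x)))"
      by (rule continuous_on_compose2[OF integ.IH]) auto
    then show "continuous_on (UNIV \<times> cbox 0 1) (\<lambda>(p, s). f (p(m := p m * s)))"
      by (simp add: case_prod_unfold)
  qed
  then show ?case unfolding tint_def by (auto intro!: continuous_intros id)
next
  case (freeze f m c)
  have "continuous_on UNIV (\<lambda>p :: nat \<Rightarrow> real. p(m := c))"
    by (intro continuous_on_fun_upd continuous_intros)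
  then show ?case by (rule continuous_on_compose2[OF freeze.IH]) auto
qed (auto intro!: continuous_intros)

lemma continuous_on_coord_line: "continuous_on UNIV f \<Longrightarrow> continuous_on UNIV (\<lambda>t. f ((p :: nat \<Rightarrow> real)(k := t)))"
proof -
  assume f: "continuous_on UNIV f"
  have "continuous_on UNIV (\<lambda>t. p(k := t))" by (intro continuous_on_fun_upd continuous_intros)
  then show ?thesis by (rule continuous_on_compose2[OF f]) auto
qed

text \<open>For \<open>comp\<close> the derivative stays in the class because the whole tower of
  derivatives is part of the rule. For \<open>integ\<close> the fundamental theorem applies when k
  is the integrated coordinate, and differentiation under the integral sign otherwise.\<close>

lemma sm_pd:
  "f \<in> sm \<Longrightarrow> \<exists>f'\<in>sm. \<forall>p t. ((\<lambda>t. f (p(k := t))) has_real_derivative f' (p(k := t))) (at t)"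
proof (induction rule: sm.induct)
  case (const c) show ?case by (rule bexI[OF _ sm.const[of 0]]) simp
next
  case (coord i) show ?case by (rule bexI[OF _ sm.const[of "kd k i"]]) (auto simp: kd_def)
next
  case (add f g)
  then obtain f' g' where "f' \<in> sm" "g' \<in> sm"
    and "\<forall>p t. ((\<lambda>t. f (p(k := t))) has_real_derivative f' (p(k := t))) (at t)"
    and "\<forall>p t. ((\<lambda>t. g (p(k := t))) has_real_derivative g' (p(k := t))) (at t)" by blast
  then show ?case by (intro bexI[OF _ sm.add[of f' g']]) (auto intro!: derivative_eq_intros simp del: fun_upd_apply)
next
  case (mult f g)
  then obtain f' g' where "f' \<in> sm" "g' \<in> sm"
    and "\<forall>p t. ((\<lambda>t. f (p(k := t))) has_real_derivative f' (p(k := t))) (at t)"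
    and "\<forall>p t. ((\<lambda>t. g (p(k := t))) has_real_derivative g' (p(k := t))) (at t)" by blast
  then show ?case using mult.hyps
    by (intro bexI[OF _ sm.add[OF sm.mult[of f' g] sm.mult[of f g']]]) (auto intro!: derivative_eq_intros simp del: fun_upd_apply)
next
  case (comp f H j)
  then obtain f' where f': "f' \<in> sm"
    and d: "\<And>p t. ((\<lambda>t. f (p(k := t))) has_real_derivative f' (p(k := t))) (at t)" by blast
  have 1: "(\<lambda>p. H (Suc j) (f p) * f' p) \<in> sm"
    by (rule sm.mult[OF sm.comp[OF comp.hyps] f'])
  have "((\<lambda>t. H j (f (p(k := t)))) has_real_derivative H (Suc j) (f (p(k := t))) * f' (p(k := t))) (at t)" for p t
    by (rule DERIV_chain2[of "H j"]) (use comp.hyps d in auto)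
  then show ?case by (intro bexI[OF _ 1] allI)
next
  case (integ f m)
  then obtain f' where f': "f' \<in> sm"
    and d: "\<And>p t. ((\<lambda>t. f (p(k := t))) has_real_derivative f' (p(k := t))) (at t)" by blast
  show ?case
  proof (cases "k = m")
    case True
    have "((\<lambda>t. tint (\<lambda>s. f (p(m := s))) t) has_real_derivative f (p(m := t))) (at t)" for p t
      by (rule tint_has_derivative) (rule continuous_on_coord_line[OF sm_continuous[OF integ.hyps]])
    then show ?thesis using True integ.hyps by (intro bexI[of _ f]) (simp_all add: fun_upd_same del: fun_upd_apply)
  next
    case False
    have "((\<lambda>t. tint (\<lambda>s. f (p(k := t, m := s))) (p m)) has_real_derivative tint (\<lambda>s. f' (p(k := t, m := s))) (p m)) (at t)" for p t
    proof -
      have comm: "p(k := t, m := s) = p(m := s, k := t)" for t s using False by (rule fun_upd_twist)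
      have "((\<lambda>x. integral (cbox 0 1) (\<lambda>s. f (p(m := p m * s, k := x)))) has_real_derivative
          integral (cbox 0 1) (\<lambda>s. f' (p(m := p m * s, k := t)))) (at t within UNIV)"
      proof (rule leibniz_rule_field_derivative)
        show "((\<lambda>x. f (p(m := p m * s, k := x))) has_real_derivative f' (p(m := p m * s, k := x))) (at x within UNIV)"
          for x s by (rule d)
        show "(\<lambda>s. f (p(m := p m * s, k := x))) integrable_on cbox 0 1" for x
        proof (rule integrable_continuous)
          have "continuous_on UNIV (\<lambda>s. p(m := p m * s, k := x))"
            by (intro continuous_on_fun_upd continuous_intros)
          then have "continuous_on UNIV (\<lambda>s. f (p(m := p m * s, k := x)))"
            by (rule continuous_on_compose2[OF sm_continuous[OF integ.hyps]]) auto
          then show "continuous_on (cbox 0 1) (\<lambda>s. f (p(m := p m * s, k := x)))"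
            by (rule continuous_on_subset) simp
        qed
        have "continuous_on (UNIV \<times> cbox 0 1) (\<lambda>y :: real \<times> real. p(m := p m * snd y, k := fst y))"
          by (intro continuous_on_fun_upd continuous_intros)
        then have "continuous_on (UNIV \<times> cbox 0 1) (\<lambda>y :: real \<times> real. f' (p(m := p m * snd y, k := fst y)))"
          by (rule continuous_on_compose2[OF sm_continuous[OF f']]) auto
        then show "continuous_on (UNIV \<times> cbox 0 1) (\<lambda>(x, s). f' (p(m := p m * s, k := x)))"
          by (simp add: case_prod_unfold)
      qed auto
      then have "((\<lambda>x. p m * integral (cbox 0 1) (\<lambda>s. f (p(m := p m * s, k := x)))) has_real_derivative
          p m * integral (cbox 0 1) (\<lambda>s. f' (p(m := p m * s, k := t)))) (at t)"
        by (rule DERIV_cmult)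
      then show ?thesis unfolding tint_def comm by simp
    qed
    then show ?thesis using False by (intro bexI[OF _ sm.integ[OF f', of m]]) (simp add: fun_upd_other False[symmetric] del: fun_upd_apply)
  qed
next
  case (freeze f m c)
  then obtain f' where f': "f' \<in> sm"
    and d: "\<And>p t. ((\<lambda>t. f (p(k := t))) has_real_derivative f' (p(k := t))) (at t)" by blast
  show ?case
  proof (cases "k = m")
    case True
    then show ?thesis by (intro bexI[OF _ sm.const[of 0]]) (simp del: fun_upd_apply)
  next
    case False
    have "p(k := t, m := s) = p(m := s, k := t)" for p :: "nat \<Rightarrow> real" and t s using False by (rule fun_upd_twist)
    then show ?thesis using d by (intro bexI[OF _ sm.freeze[OF f', of m c]]) (simp del: fun_upd_apply)
  qed
qed

lemma sm_pd_sm: assumes "f \<in> sm" shows "pd k f \<in> sm"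
  and sm_has_pd: "((\<lambda>t. f (p(k := t))) has_real_derivative pd k f p) (at (p k))"
proof -
  obtain f' where f': "f' \<in> sm" and d: "\<And>p t. ((\<lambda>t. f (p(k := t))) has_real_derivative f' (p(k := t))) (at t)"
    using sm_pd[OF assms] by blast
  have "pd k f = f'"
    using d[where t = "_ k"] by (intro ext pd_eqI) (metis fun_upd_triv)
  then show "pd k f \<in> sm" "((\<lambda>t. f (p(k := t))) has_real_derivative pd k f p) (at (p k))"
    using f' d[of p "p k"] by auto
qed

lemma sm_iter_pd: "f \<in> sm \<Longrightarrow> iter_pd ks f \<in> sm"
  by (induction ks) (auto intro: sm_pd_sm)

lemma sm_smooth_on: assumes "f \<in> sm" shows "smooth_on n S f"
  unfolding smooth_on_def
proof (intro allI impI conjI ballI)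
  fix ks k p
  show "continuous_on S (iter_pd ks f)"
    using sm_continuous[OF sm_iter_pd[OF assms]] continuous_on_subset by blast
  show "(\<lambda>t. iter_pd ks f (p(k := t))) differentiable at (p k)"
    using sm_has_pd[OF sm_iter_pd[OF assms]] real_differentiable_def by blast
qed

lemma sm_uminus: "f \<in> sm \<Longrightarrow> (\<lambda>p. - f p) \<in> sm"
  using sm.mult[OF sm.const[of "-1"]] by fastforce

lemma sm_diff: "f \<in> sm \<Longrightarrow> g \<in> sm \<Longrightarrow> (\<lambda>p. f p - g p) \<in> sm"
  using sm.add[OF _ sm_uminus] by fastforce

lemma sm_sum: "(\<And>i. i \<in> I \<Longrightarrow> f i \<in> sm) \<Longrightarrow> (\<lambda>p. \<Sum>i\<in>I. f i p) \<in> sm"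
  by (induction I rule: infinite_finite_induct) (auto intro: sm.const sm.add)

section \<open>Smoothness on the coordinate subspace\<close>

lemma Rn_upd: "p \<in> Rn n \<Longrightarrow> k < n \<Longrightarrow> p(k := t) \<in> Rn n"
  by (auto simp: Rn_def)

text \<open>Partial derivatives in directions below n look only along lines that stay in
  \<open>Rn n\<close>, so agreement on this set suffices although the functions are defined on all
  sequences.\<close>

lemma smooth_on_cong:
  assumes "\<And>p. p \<in> Rn n \<Longrightarrow> f p = g p" "smooth_on n (Rn n) g"
  shows "smooth_on n (Rn n) f"
proof -
  have eq: "iter_pd ks f p = iter_pd ks g p" if "set ks \<subseteq> {..<n}" "p \<in> Rn n" for ks p
    using that
  proof (induction ks arbitrary: p)
    case (Cons k ks)
    then have "(\<lambda>t. iter_pd ks f (p(k := t))) = (\<lambda>t. iter_pd ks g (p(k := t)))"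
      by (intro ext Cons.IH) (auto intro: Rn_upd simp del: fun_upd_apply)
    then show ?case by (simp add: pd_def)
  qed (simp add: assms)
  show ?thesis unfolding smooth_on_def
  proof (intro allI impI conjI ballI)
    fix ks :: "nat list" assume ks: "set ks \<subseteq> {..<n}"
    have "continuous_on (Rn n) (iter_pd ks g)" using assms(2) ks by (auto simp: smooth_on_def)
    then show "continuous_on (Rn n) (iter_pd ks f)"
      using eq[OF ks] by (metis (no_types, lifting) continuous_on_cong)
    fix k p assume k: "k < n" and p: "p \<in> Rn n"
    have "(\<lambda>t. iter_pd ks f (p(k := t))) = (\<lambda>t. iter_pd ks g (p(k := t)))"
      by (intro ext eq ks Rn_upd p k)
    then show "(\<lambda>t. iter_pd ks f (p(k := t))) differentiable at (p k)"
      using assms(2) ks k p by (auto simp: smooth_on_def)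
  qed
qed

lemma smooth_map_on_sm:
  assumes "\<And>p. p \<in> Rn n \<Longrightarrow> F p \<in> Rn n" "\<And>i. i < n \<Longrightarrow> f i \<in> sm"
    "\<And>i p. i < n \<Longrightarrow> p \<in> Rn n \<Longrightarrow> F p i = f i p"
  shows "smooth_map_on n (Rn n) F"
  unfolding smooth_map_on_def
proof (intro conjI ballI allI impI)
  fix i assume i: "i < n"
  show "smooth_on n (Rn n) (\<lambda>p. F p i)"
    by (rule smooth_on_cong[where g = "f i"]) (use assms i sm_smooth_on in auto)
qed (use assms in auto)

section \<open>Geodesics and the exponential map\<close>

lemma Rn_eqI:
  assumes "p \<in> Rn n" "q \<in> Rn n" "\<And>i. i < n \<Longrightarrow> p i = q i"
  shows "p = q"
proof
  fix i show "p i = q i" using assms by (cases "i < n") (auto simp: Rn_def)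
qed

text \<open>Both second derivatives are the same given function of t, so the difference is affine
  with zero initial data. The triangular form of the system reduces uniqueness of geodesics to this
  case, without a Lipschitz argument.\<close>

lemma second_order_unique:
  fixes f g :: "real \<Rightarrow> real"
  assumes I: "open I" "is_interval I" "t0 \<in> I"
    and f: "\<And>t. t \<in> I \<Longrightarrow> (f has_real_derivative f' t) (at t)" "\<And>t. t \<in> I \<Longrightarrow> (f' has_real_derivative h t) (at t)"
    and g: "\<And>t. t \<in> I \<Longrightarrow> (g has_real_derivative g' t) (at t)" "\<And>t. t \<in> I \<Longrightarrow> (g' has_real_derivative h t) (at t)"
    and init: "f t0 = g t0" "f' t0 = g' t0" and t: "t \<in> I"
  shows "f t = g t \<and> f' t = g' t"
proof -
  have conv: "convex I" using I by (simp add: is_interval_convex)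
  have zero: "d t = d t0" if "\<And>t. t \<in> I \<Longrightarrow> (d has_real_derivative 0) (at t)" "t \<in> I" for d :: "real \<Rightarrow> real" and t
  proof -
    have "\<exists>c. \<forall>x\<in>I. d x = c"
      by (rule has_field_derivative_zero_constant[OF conv]) (use that in \<open>auto intro: has_field_derivative_at_within\<close>)
    then show ?thesis using that I by auto
  qed
  have 1: "f' t = g' t" if "t \<in> I" for t
  proof -
    have "f' t - g' t = f' t0 - g' t0"
      by (rule zero[of "\<lambda>t. f' t - g' t"]) (use f(2) g(2) that in \<open>auto intro!: derivative_eq_intros\<close>)
    then show ?thesis using init by simp
  qed
  have "f t - g t = f t0 - g t0"
    by (rule zero[of "\<lambda>t. f t - g t"]) (use f(1) g(1) 1 t in \<open>auto intro!: derivative_eq_intros\<close>)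
  then show ?thesis using init 1 t by simp
qed

text \<open>The geodesic equations decouple along the chain \<open>u\<^sub>1, \<dots>, u\<^sub>r, v\<^sub>r, \<dots>, v\<^sub>1\<close>:
  each coordinate is obtained from its predecessor by integrating twice. The coordinate with
  position \<open>c\<close> in the chain has index \<open>chi r c\<close>.\<close>

definition chi :: "nat \<Rightarrow> nat \<Rightarrow> nat" where
  "chi r c = (if c < r then c else 3 * r - 1 - c)"

text \<open>The force that position c exerts on position c + 1 of the chain: the identity except at
  the passage from u_r to v_r, where \<open>\<psi>'\<close> enters.\<close>

definition link :: "nat \<Rightarrow> (real \<Rightarrow> real) \<Rightarrow> nat \<Rightarrow> real \<Rightarrow> real" where
  "link r \<phi> c z = (if Suc c = r then \<phi> z else z)"

primrec chain :: "nat \<Rightarrow> (real \<Rightarrow> real) \<Rightarrow> (nat \<Rightarrow> real) \<Rightarrow> (nat \<Rightarrow> real) \<Rightarrow> nat \<Rightarrow> real \<Rightarrow> real" where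
  "chain r \<phi> P v 0 = (\<lambda>t. P 0 + t * v 0)"
| "chain r \<phi> P v (Suc c) = (\<lambda>t. P (chi r (Suc c)) + t * v (chi r (Suc c))
     - (v (2 * r))\<^sup>2 * tint (tint (\<lambda>s. link r \<phi> c (chain r \<phi> P v c s))) t)"

definition dchain :: "nat \<Rightarrow> (real \<Rightarrow> real) \<Rightarrow> (nat \<Rightarrow> real) \<Rightarrow> (nat \<Rightarrow> real) \<Rightarrow> nat \<Rightarrow> real \<Rightarrow> real" where
  "dchain r \<phi> P v c t = (case c of 0 \<Rightarrow> v 0 | Suc c' \<Rightarrow> v (chi r c)
     - (v (2 * r))\<^sup>2 * tint (\<lambda>s. link r \<phi> c' (chain r \<phi> P v c' s)) t)"

text \<open>The equation for y is y'' = 2 x' dF/dt with constant x', so one integration is explicit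
  and a single \<open>tint\<close> of F minus its initial value remains.\<close>

definition geo :: "nat \<Rightarrow> (real \<Rightarrow> real) \<Rightarrow> (real \<Rightarrow> real) \<Rightarrow> (nat \<Rightarrow> real) \<Rightarrow> (nat \<Rightarrow> real) \<Rightarrow> real \<Rightarrow> nat \<Rightarrow> real" where
  "geo r \<psi> \<phi> P v t i = (if i < 2 * r then chain r \<phi> P v (chi r i) t
     else if i = 2 * r then P i + t * v i
     else if i = Suc (2 * r) then P i + t * v i
       + 2 * v (2 * r) * tint (\<lambda>s. pot r \<psi> (\<lambda>j. chain r \<phi> P v (chi r j) s) - pot r \<psi> P) t
     else 0)"

definition dgeo :: "nat \<Rightarrow> (real \<Rightarrow> real) \<Rightarrow> (real \<Rightarrow> real) \<Rightarrow> (nat \<Rightarrow> real) \<Rightarrow> (nat \<Rightarrow> real) \<Rightarrow> real \<Rightarrow> nat \<Rightarrow> real" where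
  "dgeo r \<psi> \<phi> P v t i = (if i < 2 * r then dchain r \<phi> P v (chi r i) t
     else if i = Suc (2 * r) then v i + 2 * v (2 * r) * (pot r \<psi> (\<lambda>j. chain r \<phi> P v (chi r j) t) - pot r \<psi> P)
     else v i)"

text \<open>The acceleration prescribed by the geodesic equation at position p with velocity
  v.\<close>

definition acc :: "nat \<Rightarrow> (real \<Rightarrow> real) \<Rightarrow> (nat \<Rightarrow> real) \<Rightarrow> (nat \<Rightarrow> real) \<Rightarrow> nat \<Rightarrow> real" where
  "acc r \<phi> p v l = - (v (2 * r))\<^sup>2 * dpot r \<phi> p (dual r l)
     + (if l = Suc (2 * r) then 2 * v (2 * r) * (\<Sum>i<2 * r + 2. dpot r \<phi> p i * v i) else 0)"

definition geo_sys :: "nat \<Rightarrow> (real \<Rightarrow> real) \<Rightarrow> real set \<Rightarrow> (real \<Rightarrow> nat \<Rightarrow> real) \<Rightarrow> (real \<Rightarrow> nat \<Rightarrow> real) \<Rightarrow> bool" where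
  "geo_sys r \<phi> I \<gamma> \<gamma>1 \<longleftrightarrow> (\<forall>t\<in>I. \<forall>l<2 * r + 2. ((\<lambda>s. \<gamma> s l) has_real_derivative \<gamma>1 t l) (at t) \<and>
      ((\<lambda>s. \<gamma>1 s l) has_real_derivative acc r \<phi> (\<gamma> t) (\<gamma>1 t) l) (at t))"

text \<open>The same chain, parametrised by the endpoint \<open>q\<close> at time 1 instead of the initial velocity;
  \<open>ivel\<close> and \<open>ivec\<close> return that velocity, which gives the inverse of the exponential map.\<close>

primrec ichain :: "nat \<Rightarrow> (real \<Rightarrow> real) \<Rightarrow> (nat \<Rightarrow> real) \<Rightarrow> (nat \<Rightarrow> real) \<Rightarrow> nat \<Rightarrow> real \<Rightarrow> real" where
  "ichain r \<phi> P q 0 = (\<lambda>t. P 0 + t * (q 0 - P 0))"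
| "ichain r \<phi> P q (Suc c) = (\<lambda>t. P (chi r (Suc c)) + t * (q (chi r (Suc c)) - P (chi r (Suc c))
       + (q (2 * r) - P (2 * r))\<^sup>2 * tint (tint (\<lambda>s. link r \<phi> c (ichain r \<phi> P q c s))) 1)
     - (q (2 * r) - P (2 * r))\<^sup>2 * tint (tint (\<lambda>s. link r \<phi> c (ichain r \<phi> P q c s))) t)"

definition ivel :: "nat \<Rightarrow> (real \<Rightarrow> real) \<Rightarrow> (nat \<Rightarrow> real) \<Rightarrow> (nat \<Rightarrow> real) \<Rightarrow> nat \<Rightarrow> real" where
  "ivel r \<phi> P q c = (case c of 0 \<Rightarrow> q 0 - P 0 | Suc c' \<Rightarrow> q (chi r c) - P (chi r c)
     + (q (2 * r) - P (2 * r))\<^sup>2 * tint (tint (\<lambda>s. link r \<phi> c' (ichain r \<phi> P q c' s))) 1)"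

definition ivec :: "nat \<Rightarrow> (real \<Rightarrow> real) \<Rightarrow> (real \<Rightarrow> real) \<Rightarrow> (nat \<Rightarrow> real) \<Rightarrow> (nat \<Rightarrow> real) \<Rightarrow> nat \<Rightarrow> real" where
  "ivec r \<psi> \<phi> P q i = (if i < 2 * r then ivel r \<phi> P q (chi r i)
     else if i = 2 * r then q i - P i
     else if i = Suc (2 * r) then q i - P i
       - 2 * (q (2 * r) - P (2 * r)) * tint (\<lambda>s. pot r \<psi> (\<lambda>j. ichain r \<phi> P q (chi r j) s) - pot r \<psi> P) 1
     else 0)"

lemma sm_tint_tint:
  assumes "f \<in> sm" shows "(\<lambda>p. tint (tint (\<lambda>s. f (p(m := s)))) (p m)) \<in> sm"
  using sm.integ[OF sm.integ[OF assms, of m], of m] by simp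

lemma sm_link:
  assumes "\<forall>j x. (H j has_real_derivative H (Suc j) x) (at x)" "f \<in> sm"
  shows "(\<lambda>p. link r (H (1 :: nat)) c (f p)) \<in> sm"
  using sm.comp[OF assms(2,1), of 1] assms(2) by (cases "Suc c = r") (simp_all add: link_def)

lemma chain_derivs:
  assumes \<phi>: "continuous_on UNIV \<phi>"
  shows "(chain r \<phi> P v c has_real_derivative dchain r \<phi> P v c t) (at t)"
    and "(dchain r \<phi> P v (Suc c) has_real_derivative - (v (2 * r))\<^sup>2 * link r \<phi> c (chain r \<phi> P v c t)) (at t)"
    and "(dchain r \<phi> P v 0 has_real_derivative 0) (at t)"
    and "continuous_on UNIV (\<lambda>s. link r \<phi> c (chain r \<phi> P v c s))"
proof -
  have link: "continuous_on UNIV (\<lambda>s. link r \<phi> c (f s))" if "continuous_on UNIV f" for c f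
    using that continuous_on_compose2[OF \<phi> that] by (cases "Suc c = r") (auto simp: link_def)
  have chain: "continuous_on UNIV (chain r \<phi> P v c)" for c
  proof (induction c)
    case (Suc c)
    have "continuous_on UNIV (tint (\<lambda>s. link r \<phi> c (chain r \<phi> P v c s)))"
      by (rule DERIV_continuous_on) (use tint_has_derivative[OF link[OF Suc]] in \<open>auto intro: has_field_derivative_at_within\<close>)
    then have "continuous_on UNIV (tint (tint (\<lambda>s. link r \<phi> c (chain r \<phi> P v c s))))"
      by (intro DERIV_continuous_on) (use tint_has_derivative in \<open>auto intro: has_field_derivative_at_within\<close>)
    then show ?case by (auto intro!: continuous_intros)
  qed (auto intro!: continuous_intros)
  have L: "(tint (\<lambda>s. link r \<phi> c (chain r \<phi> P v c s)) has_real_derivative link r \<phi> c (chain r \<phi> P v c t)) (at t)" for c t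
    by (rule tint_has_derivative[OF link[OF chain]])
  then have "continuous_on UNIV (tint (\<lambda>s. link r \<phi> c (chain r \<phi> P v c s)))" for c
    by (intro DERIV_continuous_on) (auto intro: has_field_derivative_at_within)
  note LL = tint_has_derivative[OF this]
  show "(chain r \<phi> P v c has_real_derivative dchain r \<phi> P v c t) (at t)"
    by (cases c) (auto simp: dchain_def intro!: derivative_eq_intros LL)
  show "(dchain r \<phi> P v (Suc c) has_real_derivative - (v (2 * r))\<^sup>2 * link r \<phi> c (chain r \<phi> P v c t)) (at t)"
    unfolding dchain_def by (auto intro!: derivative_eq_intros L)
  show "(dchain r \<phi> P v 0 has_real_derivative 0) (at t)" unfolding dchain_def by simp
  show "continuous_on UNIV (\<lambda>s. link r \<phi> c (chain r \<phi> P v c s))" by (rule link[OF chain])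
qed

section \<open>Solution and uniqueness for the geodesic system\<close>

context coords begin

lemma chi_chi: "i < 2 * r \<Longrightarrow> chi r (chi r i) = i" and chi_less: "i < 2 * r \<Longrightarrow> chi r i < 2 * r"
  by (auto simp: chi_def)

lemma chi_0: "chi r 0 = 0" using r0 by (simp add: chi_def)

text \<open>This is the triangularity: after raising the index, the gradient at position c + 1 of
  the chain involves only position c, and at the start u_1 it vanishes.\<close>

lemma dpot_dual_chi:
  shows "dpot r \<phi> p (dual r 0) = 0"
    and "Suc c < 2 * r \<Longrightarrow> dpot r \<phi> p (dual r (chi r (Suc c))) = link r \<phi> c (p (chi r c))"
proof -
  show "dpot r \<phi> p (dual r 0) = 0" using r0 by (auto simp: dpot_def dual_def)
  assume c: "Suc c < 2 * r"
  consider "Suc c < r" | "Suc c = r" | "r \<le> c" by linarith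
  then show "dpot r \<phi> p (dual r (chi r (Suc c))) = link r \<phi> c (p (chi r c))"
  proof cases
    case 1
    then have "chi r (Suc c) = Suc c" "chi r c = c" "dual r (Suc c) = r + Suc c" by (auto simp: chi_def dual_def)
    then show ?thesis using 1 by (auto simp: dpot_def link_def)
  next
    case 2
    then have "chi r (Suc c) = 2 * r - 1" "chi r c = r - 1" "dual r (2 * r - 1) = r - 1" by (auto simp: chi_def dual_def)
    then show ?thesis using 2 by (auto simp: dpot_def link_def)
  next
    case 3
    then have "chi r (Suc c) = 3 * r - Suc (Suc c)" "chi r c = 3 * r - Suc c" "dual r (3 * r - Suc (Suc c)) = 2 * r - Suc (Suc c)"
      using c by (auto simp: chi_def dual_def)
    moreover have "2 * r - Suc (Suc c) < r - 1" "r + (2 * r - Suc (Suc c)) + 1 = 3 * r - Suc c" using 3 c by auto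
    ultimately show ?thesis using 3 by (auto simp: dpot_def link_def)
  qed
qed

lemma sum_Chr_velocity:
  assumes \<psi>: "\<And>x. (\<psi> has_real_derivative \<psi>1 x) (at x)" and l: "l < n"
  shows "(\<Sum>i<n. \<Sum>j<n. Chr n (gM r \<psi>) p l i j * v i * v j) = - acc r \<psi>1 p v l"
proof -
  define S where "S = (\<Sum>i<n. dpot r \<psi>1 p i * v i)"
  have "(\<Sum>i<n. \<Sum>j<n. Chr n (gM r \<psi>) p l i j * v i * v j) =
    (\<Sum>i<n. \<Sum>j<n. (dpot r \<psi>1 p (dual r l) * (v i * kd (2 * r) i)) * (v j * kd (2 * r) j)
      - kd (Suc (2 * r)) l * ((dpot r \<psi>1 p i * v i) * (v j * kd (2 * r) j) + (v i * kd (2 * r) i) * (dpot r \<psi>1 p j * v j)))"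
    by (intro sum.cong refl) (use l in \<open>auto simp: Chr_gM[OF \<psi>] kd_def algebra_simps\<close>)
  also have "\<dots> = dpot r \<psi>1 p (dual r l) * v (2 * r) * v (2 * r) - kd (Suc (2 * r)) l * (S * v (2 * r) + v (2 * r) * S)"
    by (simp add: sum_subtractf sum.distrib sum_distrib_left[symmetric] sum_distrib_right[symmetric] kd_sum(2)[OF xn] S_def)
  finally show ?thesis by (auto simp: acc_def kd_def power2_eq_square S_def n)
qed

lemma geodesic_geo_sys:
  assumes \<psi>: "\<And>x. (\<psi> has_real_derivative \<psi>1 x) (at x)"
  shows "geodesic n (gM r \<psi>) I \<gamma> \<longleftrightarrow> (\<forall>t\<in>I. \<gamma> t \<in> Rn n) \<and> (\<exists>\<gamma>1. geo_sys r \<psi>1 I \<gamma> \<gamma>1)"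
proof -
  have "\<gamma>2 + (\<Sum>i<n. \<Sum>j<n. Chr n (gM r \<psi>) (\<gamma> t) l i j * \<gamma>1 t i * \<gamma>1 t j) = 0 \<longleftrightarrow> \<gamma>2 = acc r \<psi>1 (\<gamma> t) (\<gamma>1 t) l"
    if "l < n" for \<gamma>2 \<gamma>1 t l
    unfolding sum_Chr_velocity[OF \<psi> that] by auto
  then have "(\<exists>\<gamma>2. \<forall>t\<in>I. \<forall>l<n.
        ((\<lambda>s. \<gamma> s l) has_real_derivative \<gamma>1 t l) (at t) \<and>
        ((\<lambda>s. \<gamma>1 s l) has_real_derivative \<gamma>2 t l) (at t) \<and>
        \<gamma>2 t l + (\<Sum>i<n. \<Sum>j<n. Chr n (gM r \<psi>) (\<gamma> t) l i j * \<gamma>1 t i * \<gamma>1 t j) = 0) \<longleftrightarrow> geo_sys r \<psi>1 I \<gamma> \<gamma>1" for \<gamma>1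
    unfolding geo_sys_def n[symmetric]
    by (intro iffI exI[of _ "\<lambda>t. acc r \<psi>1 (\<gamma> t) (\<gamma>1 t)"]; force)
  then show ?thesis unfolding geodesic_def by (simp only:)
qed

lemma geo_sys_geo:
  assumes \<psi>: "\<And>x. (\<psi> has_real_derivative \<psi>1 x) (at x)" and \<psi>1: "continuous_on UNIV \<psi>1"
  shows "geo_sys r \<psi>1 UNIV (geo r \<psi> \<psi>1 P v) (dgeo r \<psi> \<psi>1 P v)"
proof -
  note C = chain_derivs[OF \<psi>1, where P = P and v = v and r = r]
  let ?c = "\<lambda>t j. chain r \<psi>1 P v (chi r j) t"
  have pot: "((\<lambda>s. pot r \<psi> (?c s)) has_real_derivative (\<Sum>i<n. dpot r \<psi>1 (?c t) i * dchain r \<psi>1 P v (chi r i) t)) (at t)" for t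
    by (rule pot_has_derivative) (auto intro: C \<psi>)
  then have "continuous_on UNIV (\<lambda>s. pot r \<psi> (?c s))"
    by (intro DERIV_continuous_on) (auto intro: has_field_derivative_at_within)
  then have ti: "(tint (\<lambda>s. pot r \<psi> (?c s) - pot r \<psi> P) has_real_derivative pot r \<psi> (?c t) - pot r \<psi> P) (at t)" for t
    by (intro tint_has_derivative continuous_intros)
  have dx: "dgeo r \<psi> \<psi>1 P v t (2 * r) = v (2 * r)" for t by (simp add: dgeo_def)
  have dp: "dpot r \<psi>1 (geo r \<psi> \<psi>1 P v t) i = dpot r \<psi>1 (?c t) i" for t i
    using r0 by (auto simp: dpot_def geo_def)
  have "((\<lambda>s. geo r \<psi> \<psi>1 P v s l) has_real_derivative dgeo r \<psi> \<psi>1 P v t l) (at t) \<and>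
      ((\<lambda>s. dgeo r \<psi> \<psi>1 P v s l) has_real_derivative acc r \<psi>1 (geo r \<psi> \<psi>1 P v t) (dgeo r \<psi> \<psi>1 P v t) l) (at t)"
    if l: "l < n" for l t
  proof -
    consider "l < 2 * r" | "l = 2 * r" | "l = Suc (2 * r)" using l n by linarith
    then show ?thesis
    proof cases
      case 1
      have "(dchain r \<psi>1 P v (chi r l) has_real_derivative - (v (2 * r))\<^sup>2 * dpot r \<psi>1 (?c t) (dual r l)) (at t)"
      proof (cases "chi r l")
        case 0
        then have "l = 0" using chi_chi[OF 1] chi_0 by simp
        then show ?thesis using C(3) 0 by (simp add: dpot_dual_chi(1) chi_0)
      next
        case (Suc c)
        then have "l = chi r (Suc c)" "Suc c < 2 * r" using chi_chi[OF 1] chi_less[OF 1] by auto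
        then show ?thesis using C(2)[of c t] Suc by (simp add: dpot_dual_chi(2) chi_chi)
      qed
      moreover have "geo r \<psi> \<psi>1 P v s l = chain r \<psi>1 P v (chi r l) s" "dgeo r \<psi> \<psi>1 P v s l = dchain r \<psi>1 P v (chi r l) s" for s
        using 1 by (simp_all add: geo_def dgeo_def)
      ultimately show ?thesis using 1 C(1) by (simp add: acc_def dp dx)
    next
      case 2
      then show ?thesis by (auto simp: geo_def dgeo_def acc_def intro!: derivative_eq_intros)
    next
      case 3
      have S: "(\<Sum>i<n. dpot r \<psi>1 (geo r \<psi> \<psi>1 P v t) i * dgeo r \<psi> \<psi>1 P v t i)
         = (\<Sum>i<n. dpot r \<psi>1 (?c t) i * dchain r \<psi>1 P v (chi r i) t)"
        unfolding dp
        by (rule sum.cong) (use n in \<open>auto simp: dgeo_def less_Suc_eq\<close>)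
      have "acc r \<psi>1 (geo r \<psi> \<psi>1 P v t) (dgeo r \<psi> \<psi>1 P v t) l
        = 2 * v (2 * r) * (\<Sum>i<n. dpot r \<psi>1 (?c t) i * dchain r \<psi>1 P v (chi r i) t)"
        unfolding acc_def n[symmetric] S dx 3 by simp
      then show ?thesis using 3 by (auto simp: geo_def dgeo_def intro!: derivative_eq_intros ti pot)
    qed
  qed
  then show ?thesis unfolding geo_sys_def n[symmetric] by auto
qed

text \<open>In the order x, chain, y, each acceleration depends only on coordinates and velocities
  already known to agree.\<close>

lemma geo_sys_unique:
  assumes I: "open I" "is_interval I" "t0 \<in> I"
    and a: "geo_sys r \<phi> I \<alpha> \<alpha>1" and b: "geo_sys r \<phi> I \<beta> \<beta>1"
    and init: "\<And>l. l < n \<Longrightarrow> \<alpha> t0 l = \<beta> t0 l" "\<And>l. l < n \<Longrightarrow> \<alpha>1 t0 l = \<beta>1 t0 l"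
  shows "t \<in> I \<Longrightarrow> l < n \<Longrightarrow> \<alpha> t l = \<beta> t l \<and> \<alpha>1 t l = \<beta>1 t l"
proof -
  have step: "\<alpha> t l = \<beta> t l \<and> \<alpha>1 t l = \<beta>1 t l"
    if "l < n" "t \<in> I" "\<And>t. t \<in> I \<Longrightarrow> acc r \<phi> (\<alpha> t) (\<alpha>1 t) l = acc r \<phi> (\<beta> t) (\<beta>1 t) l" for l t
  proof (rule second_order_unique[OF I, where f = "\<lambda>t. \<alpha> t l" and g = "\<lambda>t. \<beta> t l" and f' = "\<lambda>t. \<alpha>1 t l"
        and g' = "\<lambda>t. \<beta>1 t l" and h = "\<lambda>t. acc r \<phi> (\<alpha> t) (\<alpha>1 t) l"])
    fix t assume t: "t \<in> I"
    show "((\<lambda>t. \<beta>1 t l) has_real_derivative acc r \<phi> (\<alpha> t) (\<alpha>1 t) l) (at t)"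
      unfolding that(3)[OF t] using b t that(1) by (simp add: geo_sys_def n)
  qed (use a b init that(1,2) in \<open>simp_all add: geo_sys_def n\<close>)
  have x: "\<alpha> t (2 * r) = \<beta> t (2 * r) \<and> \<alpha>1 t (2 * r) = \<beta>1 t (2 * r)" if "t \<in> I" for t
    by (rule step) (use that in \<open>auto simp: acc_def\<close>)
  have ch: "\<alpha> t (chi r c) = \<beta> t (chi r c) \<and> \<alpha>1 t (chi r c) = \<beta>1 t (chi r c)" if "c < 2 * r" "t \<in> I" for c t
    using that
  proof (induction c arbitrary: t)
    case 0
    show ?case by (rule step) (use 0 n r0 in \<open>auto simp: acc_def chi_0 dpot_dual_chi(1)\<close>)
  next
    case (Suc c)
    have lt: "chi r (Suc c) < 2 * r" using chi_less Suc by simp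
    have "acc r \<phi> (\<alpha> t) (\<alpha>1 t) (chi r (Suc c)) = acc r \<phi> (\<beta> t) (\<beta>1 t) (chi r (Suc c))" if "t \<in> I" for t
      using lt Suc.prems Suc.IH[OF _ that] x[OF that] by (simp add: acc_def dpot_dual_chi(2))
    then show ?case using Suc.prems lt n by (intro step) auto
  qed
  have uv: "\<alpha> t l = \<beta> t l \<and> \<alpha>1 t l = \<beta>1 t l" if "l < 2 * r" "t \<in> I" for l t
    using ch[OF chi_less[OF that(1)] that(2)] chi_chi[OF that(1)] by simp
  have y: "\<alpha> t (Suc (2 * r)) = \<beta> t (Suc (2 * r)) \<and> \<alpha>1 t (Suc (2 * r)) = \<beta>1 t (Suc (2 * r))" if t: "t \<in> I" for t
  proof (rule step)
    fix t assume t: "t \<in> I"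
    have dp: "dpot r \<phi> (\<alpha> t) i = dpot r \<phi> (\<beta> t) i" for i using uv[OF _ t] r0 by (auto simp: dpot_def)
    have "(\<Sum>i<n. dpot r \<phi> (\<alpha> t) i * \<alpha>1 t i) = (\<Sum>i<n. dpot r \<phi> (\<beta> t) i * \<beta>1 t i)"
      unfolding dp by (rule sum.cong) (use uv[OF _ t] n in \<open>auto simp: less_Suc_eq\<close>)
    then show "acc r \<phi> (\<alpha> t) (\<alpha>1 t) (Suc (2 * r)) = acc r \<phi> (\<beta> t) (\<beta>1 t) (Suc (2 * r))"
      using x[OF t] dp by (simp add: acc_def n)
  qed (use t in auto)
  assume "t \<in> I" "l < n"
  moreover then consider "l < 2 * r" | "l = 2 * r" | "l = Suc (2 * r)" using n by linarith
  ultimately show ?thesis using uv x y by cases auto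
qed

lemma geo_0: assumes "P \<in> Rn n" shows "geo r \<psi> \<phi> P v 0 = P"
proof
  fix i
  have ch: "chain r \<phi> P v c 0 = P (chi r c)" for c by (cases c) (simp_all add: chi_0)
  consider "i < 2 * r" | "i = 2 * r" | "i = Suc (2 * r)" | "i \<ge> n" using n by linarith
  then show "geo r \<psi> \<phi> P v 0 i = P i"
    by cases (use assms n in \<open>auto simp: geo_def ch chi_chi Rn_def\<close>)
qed

lemma dgeo_0: assumes "P \<in> Rn n" shows "dgeo r \<psi> \<phi> P v 0 i = v i"
proof -
  have ch: "chain r \<phi> P v c 0 = P (chi r c)" for c by (cases c) (simp_all add: chi_0)
  have dch: "dchain r \<phi> P v c 0 = v (chi r c)" for c by (cases c) (simp_all add: chi_0 dchain_def)
  have "pot r \<psi> (\<lambda>j. P (chi r (chi r j))) = pot r \<psi> P"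
    unfolding pot_def using r0 by (auto simp: chi_chi intro!: sum.cong)
  then show ?thesis by (auto simp: dgeo_def dch ch chi_chi)
qed

lemma geo_Rn: "geo r \<psi> \<phi> P v t \<in> Rn n"
  by (auto simp: Rn_def geo_def n)

lemma geo_sys_shift: "geo_sys r \<phi> UNIV \<gamma> \<gamma>1 \<Longrightarrow> geo_sys r \<phi> UNIV (\<lambda>t. \<gamma> (t - t0)) (\<lambda>t. \<gamma>1 (t - t0))"
  unfolding geo_sys_def
proof (intro ballI allI impI conjI)
  fix t l assume g: "\<forall>t\<in>UNIV. \<forall>l<2 * r + 2. ((\<lambda>s. \<gamma> s l) has_real_derivative \<gamma>1 t l) (at t) \<and>
      ((\<lambda>s. \<gamma>1 s l) has_real_derivative acc r \<phi> (\<gamma> t) (\<gamma>1 t) l) (at t)" and l: "l < 2 * r + 2"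
  show "((\<lambda>s. \<gamma> (s - t0) l) has_real_derivative \<gamma>1 (t - t0) l) (at t)"
    using DERIV_shift[of "\<lambda>s. \<gamma> s l" "\<gamma>1 (t - t0) l" t "- t0"] g[rule_format, of "t - t0" l] l by simp
  show "((\<lambda>s. \<gamma>1 (s - t0) l) has_real_derivative acc r \<phi> (\<gamma> (t - t0)) (\<gamma>1 (t - t0)) l) (at t)"
    using DERIV_shift[of "\<lambda>s. \<gamma>1 s l" "acc r \<phi> (\<gamma> (t - t0)) (\<gamma>1 (t - t0)) l" t "- t0"] g[rule_format, of "t - t0" l] l by simp
qed

lemma geod_complete_gM:
  assumes \<psi>: "\<And>x. (\<psi> has_real_derivative \<psi>1 x) (at x)" and \<psi>1: "continuous_on UNIV \<psi>1"
  shows "geod_complete n (gM r \<psi>)"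
  unfolding geod_complete_def
proof (intro allI impI, elim conjE)
  fix I \<gamma> assume I: "open I" "is_interval I" "I \<noteq> {}" and g: "geodesic n (gM r \<psi>) I \<gamma>"
  from g obtain \<gamma>1 where R: "\<And>t. t \<in> I \<Longrightarrow> \<gamma> t \<in> Rn n" and s: "geo_sys r \<psi>1 I \<gamma> \<gamma>1"
    unfolding geodesic_geo_sys[OF \<psi>] by blast
  obtain t0 where t0: "t0 \<in> I" using I by blast
  \<comment> \<open>The explicit solution with the position and velocity of the given geodesic at
    \<open>t0\<close>, shifted in time because \<open>geo\<close> starts at 0.\<close>
  let ?d = "\<lambda>t. geo r \<psi> \<psi>1 (\<gamma> t0) (\<gamma>1 t0) (t - t0)" and ?d1 = "\<lambda>t. dgeo r \<psi> \<psi>1 (\<gamma> t0) (\<gamma>1 t0) (t - t0)"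
  have sys: "geo_sys r \<psi>1 UNIV ?d ?d1" by (rule geo_sys_shift[OF geo_sys_geo[OF \<psi> \<psi>1]])
  then have sysI: "geo_sys r \<psi>1 I ?d ?d1" by (auto simp: geo_sys_def)
  have "?d t0 l = \<gamma> t0 l" "?d1 t0 l = \<gamma>1 t0 l" for l
    by (simp_all add: geo_0[OF R[OF t0]] dgeo_0[OF R[OF t0]])
  from geo_sys_unique[OF I(1,2) t0 sysI s this] have "?d t l = \<gamma> t l" if "t \<in> I" "l < n" for t l
    using that by blast
  then have "?d t = \<gamma> t" if "t \<in> I" for t
    using that by (intro Rn_eqI[OF geo_Rn R]) auto
  moreover have "geodesic n (gM r \<psi>) UNIV ?d"
    unfolding geodesic_geo_sys[OF \<psi>] using sys geo_Rn by blast
  ultimately show "\<exists>\<delta>. geodesic n (gM r \<psi>) UNIV \<delta> \<and> (\<forall>t\<in>I. \<delta> t = \<gamma> t)" by blast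
qed

lemma exp_map_geo:
  assumes \<psi>: "\<And>x. (\<psi> has_real_derivative \<psi>1 x) (at x)" and \<psi>1: "continuous_on UNIV \<psi>1"
    and P: "P \<in> Rn n"
  shows "exp_map n (gM r \<psi>) P v = geo r \<psi> \<psi>1 P v 1"
  unfolding exp_map_def
proof (rule the_equality)
  let ?d = "geo r \<psi> \<psi>1 P v" and ?d1 = "dgeo r \<psi> \<psi>1 P v"
  note sys = geo_sys_geo[OF \<psi> \<psi>1, of P v]
  have "((\<lambda>s. ?d s k) has_real_derivative v k) (at 0)" if "k < n" for k
  proof -
    have "((\<lambda>s. ?d s k) has_real_derivative ?d1 0 k) (at 0)" using sys that by (simp add: geo_sys_def n)
    then show ?thesis by (simp add: dgeo_0[OF P])
  qed
  moreover have "geodesic n (gM r \<psi>) UNIV ?d"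
    unfolding geodesic_geo_sys[OF \<psi>] using sys geo_Rn by blast
  ultimately show "\<exists>\<gamma>. geodesic n (gM r \<psi>) UNIV \<gamma> \<and> \<gamma> 0 = P \<and>
      (\<forall>k<n. ((\<lambda>s. \<gamma> s k) has_real_derivative v k) (at 0)) \<and> ?d 1 = \<gamma> 1"
    using geo_0[OF P] by blast
next
  let ?d = "geo r \<psi> \<psi>1 P v" and ?d1 = "dgeo r \<psi> \<psi>1 P v"
  fix q assume "\<exists>\<gamma>. geodesic n (gM r \<psi>) UNIV \<gamma> \<and> \<gamma> 0 = P \<and>
      (\<forall>k<n. ((\<lambda>s. \<gamma> s k) has_real_derivative v k) (at 0)) \<and> q = \<gamma> 1"
  then obtain \<gamma> \<gamma>1 where R: "\<And>t. \<gamma> t \<in> Rn n" and s: "geo_sys r \<psi>1 UNIV \<gamma> \<gamma>1" and 0: "\<gamma> 0 = P"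
    and v: "\<And>k. k < n \<Longrightarrow> ((\<lambda>s. \<gamma> s k) has_real_derivative v k) (at 0)" and q: "q = \<gamma> 1"
    unfolding geodesic_geo_sys[OF \<psi>] by blast
  have i1: "\<gamma>1 0 k = ?d1 0 k" if "k < n" for k
    unfolding dgeo_0[OF P] using s v[OF that] that DERIV_unique unfolding geo_sys_def n[symmetric] by blast
  have i0: "\<gamma> 0 k = ?d 0 k" for k by (simp add: geo_0[OF P] 0)
  from geo_sys_unique[OF open_UNIV is_interval_univ UNIV_I[of 0] s geo_sys_geo[OF \<psi> \<psi>1, of P v] i0 i1]
  have "\<gamma> 1 l = ?d 1 l" if "l < n" for l
    using that by blast
  then show "q = ?d 1"
    unfolding q by (rule Rn_eqI[OF R geo_Rn])
qed

section \<open>Smooth dependence on the velocity and inversion of the exponential map\<close>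

lemma chain_cong:
  assumes "\<And>i. i \<le> 2 * r \<Longrightarrow> v i = w i"
  shows "c < 2 * r \<Longrightarrow> chain r \<phi> P v c = chain r \<phi> P w c"
proof (induction c)
  case (Suc c)
  then show ?case using assms chi_less[of "Suc c"] by simp
qed (simp add: assms)

lemma ichain_cong:
  assumes "\<And>i. i \<le> 2 * r \<Longrightarrow> v i = w i"
  shows "c < 2 * r \<Longrightarrow> ichain r \<phi> P v c = ichain r \<phi> P w c"
proof (induction c)
  case (Suc c)
  then show ?case using assms chi_less[of "Suc c"] by simp
qed (simp add: assms)

lemma pot_cong: "(\<And>i. i < 2 * r \<Longrightarrow> p i = q i) \<Longrightarrow> pot r \<psi> p = pot r \<psi> q"
  unfolding pot_def using r0 by (auto intro!: sum.cong arg_cong2[where f = "(+)"])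

lemma geo_cong:
  assumes "\<And>i. i < n \<Longrightarrow> v i = w i" shows "geo r \<psi> \<phi> P v t i = geo r \<psi> \<phi> P w t i"
proof -
  have ch: "chain r \<phi> P v (chi r j) = chain r \<phi> P w (chi r j)" if "j < 2 * r" for j
    by (rule chain_cong) (use assms n chi_less that in auto)
  have "pot r \<psi> (\<lambda>j. chain r \<phi> P v (chi r j) s) = pot r \<psi> (\<lambda>j. chain r \<phi> P w (chi r j) s)" for s
    by (rule pot_cong) (simp add: ch)
  then show ?thesis using assms by (auto simp: geo_def ch)
qed

lemma sm_pot:
  assumes H: "\<forall>j x. (H j has_real_derivative H (Suc j) x) (at x)" and f: "\<And>i. i < 2 * r \<Longrightarrow> f i \<in> sm"
  shows "(\<lambda>p. pot r (H (0 :: nat)) (\<lambda>i. f i p)) \<in> sm"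
proof -
  have "(\<lambda>p. H 0 (f (r - 1) p)) \<in> sm" by (rule sm.comp[OF f H]) (use r0 in simp)
  moreover have "(\<lambda>p. \<Sum>i<r - 1. f i p * f (r + i + 1) p) \<in> sm"
    by (rule sm_sum, rule sm.mult) (auto intro!: f)
  ultimately show ?thesis unfolding pot_def by (rule sm.add[rotated])
qed

text \<open>The time is read from coordinate n, which by \<open>chain_cong\<close> does not
  influence the velocity data of the chain. Integration over time thus becomes integration over a
  coordinate, as the rule \<open>integ\<close> expects.\<close>

lemma chain_sm:
  assumes H: "\<forall>j x. (H j has_real_derivative H (Suc j) x) (at x)"
  shows "c < 2 * r \<Longrightarrow> (\<lambda>p. chain r (H (1 :: nat)) P p c (p n)) \<in> sm"
proof (induction c)
  case 0
  show ?case by (simp, intro sm.add sm.const sm.mult sm.coord)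
next
  case (Suc c)
  let ?f = "\<lambda>p. link r (H 1) c (chain r (H 1) P p c (p n))"
  have f: "?f \<in> sm" using Suc by (intro sm_link[OF H]) auto
  have "?f (p(n := s)) = link r (H 1) c (chain r (H 1) P p c s)" for p s
  proof -
    have "chain r (H 1) P (p(n := s)) c = chain r (H 1) P p c"
      using Suc.prems n by (intro chain_cong) auto
    then show ?thesis by simp
  qed
  with sm_tint_tint[OF f, of n]
  have t: "(\<lambda>p. tint (tint (\<lambda>s. link r (H 1) c (chain r (H 1) P p c s))) (p n)) \<in> sm" by simp
  show ?case unfolding chain.simps power2_eq_square
    by (rule sm_diff[OF sm.add[OF sm.const sm.mult[OF sm.coord sm.coord]] sm.mult[OF sm.mult[OF sm.coord sm.coord] t]])
qed

lemma geo_sm: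
  assumes H: "\<forall>j x. (H j has_real_derivative H (Suc j) x) (at x)"
  shows "(\<lambda>p. geo r (H (0 :: nat)) (H 1) P p (p n) i) \<in> sm"
proof -
  let ?f = "\<lambda>p. pot r (H 0) (\<lambda>j. chain r (H 1) P p (chi r j) (p n)) - pot r (H 0) P"
  have ch: "(\<lambda>p. chain r (H 1) P p (chi r j) (p n)) \<in> sm" if "j < 2 * r" for j
    by (rule chain_sm[OF H chi_less[OF that]])
  have f: "?f \<in> sm" by (intro sm_diff sm.const sm_pot[OF H] ch)
  have "?f (p(n := s)) = pot r (H 0) (\<lambda>j. chain r (H 1) P p (chi r j) s) - pot r (H 0) P" for p s
  proof -
    have "chain r (H 1) P (p(n := s)) (chi r j) = chain r (H 1) P p (chi r j)" if "j < 2 * r" for j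
      using that n by (intro chain_cong chi_less) auto
    then have "pot r (H 0) (\<lambda>j. chain r (H 1) P (p(n := s)) (chi r j) s) = pot r (H 0) (\<lambda>j. chain r (H 1) P p (chi r j) s)"
      by (intro pot_cong) simp
    then show ?thesis by simp
  qed
  with sm.integ[OF f, of n]
  have t: "(\<lambda>p. tint (\<lambda>s. pot r (H 0) (\<lambda>j. chain r (H 1) P p (chi r j) s) - pot r (H 0) P) (p n)) \<in> sm" by simp
  consider "i < 2 * r" | "i = 2 * r" | "i = Suc (2 * r)" | "i > Suc (2 * r)" by linarith
  then show ?thesis
  proof cases
    case 1 then show ?thesis using ch by (simp add: geo_def)
  next
    case 2 then show ?thesis by (simp add: geo_def) (intro sm.add sm.const sm.mult sm.coord)
  next
    case 3
    have "(\<lambda>p. P (Suc (2 * r)) + p n * p (Suc (2 * r))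
       + 2 * p (2 * r) * tint (\<lambda>s. pot r (H 0) (\<lambda>j. chain r (H 1) P p (chi r j) s) - pot r (H 0) P) (p n)) \<in> sm"
      by (rule sm.add[OF sm.add[OF sm.const sm.mult[OF sm.coord sm.coord]] sm.mult[OF sm.mult[OF sm.const sm.coord] t]])
    with 3 show ?thesis by (simp add: geo_def)
  next
    case 4 then show ?thesis by (simp add: geo_def sm.const)
  qed
qed

lemma ichain_sm:
  assumes H: "\<forall>j x. (H j has_real_derivative H (Suc j) x) (at x)"
  shows "c < 2 * r \<Longrightarrow> (\<lambda>p. ichain r (H (1 :: nat)) P p c (p n)) \<in> sm"
    and "c < 2 * r \<Longrightarrow> (\<lambda>p. ivel r (H 1) P p c) \<in> sm"
proof -
  have step: "(\<lambda>p. tint (tint (\<lambda>s. link r (H 1) c (ichain r (H 1) P p c s))) (p n)) \<in> sm"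
      "(\<lambda>p. tint (tint (\<lambda>s. link r (H 1) c (ichain r (H 1) P p c s))) 1) \<in> sm"
    if c: "c < 2 * r" and IH: "(\<lambda>p. ichain r (H 1) P p c (p n)) \<in> sm" for c
  proof -
    let ?f = "\<lambda>p. link r (H 1) c (ichain r (H 1) P p c (p n))"
    have f: "?f \<in> sm" by (intro sm_link[OF H] IH)
    have e: "ichain r (H 1) P (p(n := s)) c = ichain r (H 1) P p c" for p s
      using c n by (intro ichain_cong) auto
    have "?f (p(n := s)) = link r (H 1) c (ichain r (H 1) P p c s)" for p s by (simp add: e)
    with sm_tint_tint[OF f, of n]
    show t: "(\<lambda>p. tint (tint (\<lambda>s. link r (H 1) c (ichain r (H 1) P p c s))) (p n)) \<in> sm" by simp
    \<comment> \<open>The correction by the endpoint is the same double integral at time 1, obtained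
      by freezing the time coordinate.\<close>
    show "(\<lambda>p. tint (tint (\<lambda>s. link r (H 1) c (ichain r (H 1) P p c s))) 1) \<in> sm"
      using sm.freeze[OF t, of n 1] by (simp add: e)
  qed
  have a: "(\<lambda>p. (p (2 * r) - P (2 * r))\<^sup>2) \<in> sm"
    unfolding power2_eq_square by (intro sm.mult sm_diff sm.coord sm.const)
  show *: "c < 2 * r \<Longrightarrow> (\<lambda>p. ichain r (H (1 :: nat)) P p c (p n)) \<in> sm" for c
  proof (induction c)
    case 0
    show ?case by (simp, intro sm.add sm.const sm.mult sm_diff sm.coord)
  next
    case (Suc c)
    then have c: "c < 2 * r" by simp
    note t = step[OF c Suc.IH[OF c]]
    show ?case unfolding ichain.simps
      by (rule sm_diff[OF sm.add[OF sm.const sm.mult[OF sm.coord sm.add[OF sm_diff[OF sm.coord sm.const] sm.mult[OF a t(2)]]]] sm.mult[OF a t(1)]])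
  qed
  assume c: "c < 2 * r"
  show "(\<lambda>p. ivel r (H 1) P p c) \<in> sm"
  proof (cases c)
    case 0
    then show ?thesis by (simp add: ivel_def) (intro sm_diff sm.coord sm.const)
  next
    case (Suc c')
    then have c': "c' < 2 * r" using c by simp
    have "(\<lambda>p. p (chi r (Suc c')) - P (chi r (Suc c'))
      + (p (2 * r) - P (2 * r))\<^sup>2 * tint (tint (\<lambda>s. link r (H 1) c' (ichain r (H 1) P p c' s))) 1) \<in> sm"
      by (rule sm.add[OF sm_diff[OF sm.coord sm.const] sm.mult[OF a step(2)[OF c' *[OF c']]]])
    then show ?thesis using Suc by (simp add: ivel_def)
  qed
qed

lemma ivec_sm:
  assumes H: "\<forall>j x. (H j has_real_derivative H (Suc j) x) (at x)"
  shows "(\<lambda>p. ivec r (H (0 :: nat)) (H 1) P p i) \<in> sm"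
proof -
  let ?f = "\<lambda>p. pot r (H 0) (\<lambda>j. ichain r (H 1) P p (chi r j) (p n)) - pot r (H 0) P"
  have f: "?f \<in> sm" by (intro sm_diff sm.const sm_pot[OF H] ichain_sm[OF H] chi_less)
  have e: "pot r (H 0) (\<lambda>j. ichain r (H 1) P (p(n := s)) (chi r j) t) = pot r (H 0) (\<lambda>j. ichain r (H 1) P p (chi r j) t)" for p s t
  proof -
    have "ichain r (H 1) P (p(n := s)) (chi r j) = ichain r (H 1) P p (chi r j)" if "j < 2 * r" for j
      using that n by (intro ichain_cong chi_less) auto
    then show ?thesis by (intro pot_cong) simp
  qed
  have t: "(\<lambda>p. tint (\<lambda>s. pot r (H 0) (\<lambda>j. ichain r (H 1) P p (chi r j) s) - pot r (H 0) P) 1) \<in> sm"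
    using sm.freeze[OF sm.integ[OF f, of n], of n 1] by (simp add: e)
  consider "i < 2 * r" | "i = 2 * r" | "i = Suc (2 * r)" | "i > Suc (2 * r)" by linarith
  then show ?thesis
  proof cases
    case 1 then show ?thesis using ichain_sm(2)[OF H chi_less[OF 1]] by (simp add: ivec_def)
  next
    case 2 then show ?thesis by (simp add: ivec_def) (intro sm_diff sm.const sm.coord)
  next
    case 3
    have "(\<lambda>p. p (Suc (2 * r)) - P (Suc (2 * r))
       - 2 * (p (2 * r) - P (2 * r)) * tint (\<lambda>s. pot r (H 0) (\<lambda>j. ichain r (H 1) P p (chi r j) s) - pot r (H 0) P) 1) \<in> sm"
      by (rule sm_diff[OF sm_diff[OF sm.coord sm.const] sm.mult[OF sm.mult[OF sm.const sm_diff[OF sm.coord sm.const]] t]])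
    with 3 show ?thesis by (simp add: ivec_def)
  next
    case 4 then show ?thesis by (simp add: ivec_def sm.const)
  qed
qed

text \<open>The velocity \<open>ivel\<close> contains the double integral at time 1 that the
  recursion of \<open>ichain\<close> adds to its linear term, so both recursions become
  identical.\<close>

lemma chain_ivec: "c < 2 * r \<Longrightarrow> chain r \<phi> P (ivec r \<psi> \<phi> P q) c = ichain r \<phi> P q c"
proof (induction c)
  case 0
  show ?case using r0 by (simp add: ivec_def chi_0 ivel_def)
next
  case (Suc c)
  then have "ivec r \<psi> \<phi> P q (chi r (Suc c)) = ivel r \<phi> P q (Suc c)"
    using chi_less[of "Suc c"] chi_chi[of "Suc c"] by (simp add: ivec_def)
  moreover have "ivec r \<psi> \<phi> P q (2 * r) = q (2 * r) - P (2 * r)" by (simp add: ivec_def)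
  ultimately show ?case using Suc by (simp add: ivel_def)
qed

lemma geo_ivec: assumes "q \<in> Rn n" shows "geo r \<psi> \<phi> P (ivec r \<psi> \<phi> P q) 1 = q"
proof (rule Rn_eqI[OF geo_Rn assms])
  fix i assume "i < n"
  have ch: "ichain r \<phi> P q c 1 = q (chi r c)" for c by (cases c) (simp_all add: chi_0)
  have pt: "pot r \<psi> (\<lambda>j. chain r \<phi> P (ivec r \<psi> \<phi> P q) (chi r j) s) = pot r \<psi> (\<lambda>j. ichain r \<phi> P q (chi r j) s)" for s
    by (rule pot_cong) (simp add: chain_ivec chi_less)
  consider "i < 2 * r" | "i = 2 * r" | "i = Suc (2 * r)" using \<open>i < n\<close> n by linarith
  then show "geo r \<psi> \<phi> P (ivec r \<psi> \<phi> P q) 1 i = q i"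
  proof cases
    case 1 then show ?thesis by (simp add: geo_def chain_ivec chi_less ch chi_chi)
  next
    case 2 then show ?thesis by (simp add: geo_def ivec_def)
  next
    case 3 then show ?thesis by (simp add: geo_def pt) (simp add: ivec_def)
  qed
qed

lemma ivec_geo: assumes "v \<in> Rn n" shows "ivec r \<psi> \<phi> P (geo r \<psi> \<phi> P v 1) = v"
proof -
  let ?q = "geo r \<psi> \<phi> P v 1"
  have x: "?q (2 * r) - P (2 * r) = v (2 * r)" by (simp add: geo_def)
  have q: "?q (chi r c) = chain r \<phi> P v c 1" if "c < 2 * r" for c
    using that chi_less[OF that] by (simp add: geo_def chi_chi)
  have ich: "c < 2 * r \<Longrightarrow> ichain r \<phi> P ?q c = chain r \<phi> P v c" for c
  proof (induction c)
    case 0 show ?case using q[of 0] r0 by (simp add: chi_0)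
  next
    case (Suc c)
    then show ?case using q[of "Suc c"] by (simp add: x)
  qed
  have ivl: "ivel r \<phi> P ?q c = v (chi r c)" if "c < 2 * r" for c
  proof (cases c)
    case 0 then show ?thesis using q[of 0] r0 by (simp add: chi_0 ivel_def)
  next
    case (Suc c')
    then show ?thesis using q[of c] that by (simp add: ivel_def x ich)
  qed
  have pt: "pot r \<psi> (\<lambda>j. ichain r \<phi> P ?q (chi r j) s) = pot r \<psi> (\<lambda>j. chain r \<phi> P v (chi r j) s)" for s
    by (rule pot_cong) (simp add: ich chi_less)
  show ?thesis
  proof (rule Rn_eqI[OF _ assms])
    show "ivec r \<psi> \<phi> P ?q \<in> Rn n" by (auto simp: Rn_def ivec_def n)
    fix i assume "i < n"
    then consider "i < 2 * r" | "i = 2 * r" | "i = Suc (2 * r)" using n by linarith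
    then show "ivec r \<psi> \<phi> P ?q i = v i"
    proof cases
      case 1 then show ?thesis by (simp add: ivec_def ivl chi_less chi_chi)
    next
      case 2 then show ?thesis using x by (simp add: ivec_def)
    next
      case 3 then show ?thesis using x by (simp add: ivec_def pt) (simp add: geo_def)
    qed
  qed
qed

lemma exp_diffeo:
  assumes H: "\<forall>j x. (H j has_real_derivative H (Suc j) x) (at x)" and P: "P \<in> Rn n"
  shows "diffeo_betw n (Rn n) (Rn n) (exp_map n (gM r (H (0 :: nat))) P)"
proof -
  have H0: "\<And>x. (H 0 has_real_derivative H 1 x) (at x)" using H by (simp add: One_nat_def)
  have H1: "continuous_on UNIV (H 1)"
    by (rule DERIV_continuous_on[where D = "H (Suc 1)"]) (use H has_field_derivative_at_within in blast)
  have exp: "exp_map n (gM r (H 0)) P = (\<lambda>v. geo r (H 0) (H 1) P v 1)"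
    by (rule ext) (rule exp_map_geo[OF H0 H1 P])
  let ?F = "\<lambda>v. geo r (H 0) (H 1) P v 1" and ?G = "ivec r (H 0) (H 1) P"
  have F: "smooth_map_on n (Rn n) ?F"
  \<comment> \<open>A point of \<open>Rn n\<close> has 0 in the time coordinate n; setting it to 1
    does not change the velocity data, by \<open>geo_cong\<close>.\<close>
  proof (rule smooth_map_on_sm[where f = "\<lambda>i p. geo r (H 0) (H 1) P (p(n := 1)) 1 i"])
    show "(\<lambda>p. geo r (H 0) (H 1) P (p(n := 1)) 1 i) \<in> sm" for i
      using sm.freeze[OF geo_sm[OF H], where m = n and c = 1] by simp
    show "geo r (H 0) (H 1) P p 1 i = geo r (H 0) (H 1) P (p(n := 1)) 1 i" for i p
      by (rule geo_cong) simp
  qed (rule geo_Rn)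
  have G: "smooth_map_on n (Rn n) ?G"
    by (rule smooth_map_on_sm[where f = "\<lambda>i p. ivec r (H 0) (H 1) P p i"])
      (auto simp: ivec_sm[OF H], auto simp: Rn_def ivec_def n)
  have GR: "?G q \<in> Rn n" for q by (auto simp: Rn_def ivec_def n)
  have GF: "?G (?F v) = v" if "v \<in> Rn n" for v by (rule ivec_geo[OF that])
  have FG: "?F (?G q) = q" if "q \<in> Rn n" for q by (rule geo_ivec[OF that])
  have "?F ` Rn n = Rn n" using FG GR geo_Rn by (auto simp: image_iff) metis
  moreover have "?G ` Rn n = Rn n" using GF GR geo_Rn by (auto simp: image_iff) metis
  ultimately show ?thesis unfolding diffeo_betw_def exp using F G GF FG by blast
qed

end

section \<open>The quadratic case: geodesic symmetries\<close>

text \<open>Restricting to one coordinate line gives a function of one real variable with all its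
  derivatives, in the form that \<open>sm.comp\<close> needs in order to substitute another function
  for that variable.\<close>

lemma sm_tower:
  assumes "f \<in> sm"
  obtains K :: "nat \<Rightarrow> real \<Rightarrow> real" where "K 0 = (\<lambda>t. f (p(m := t)))"
    "\<forall>j x. (K j has_real_derivative K (Suc j) x) (at x)"
proof
  let ?K = "\<lambda>j t. iter_pd (replicate j m) f (p(m := t))"
  show "?K 0 = (\<lambda>t. f (p(m := t)))" by simp
  show "\<forall>j x. (?K j has_real_derivative ?K (Suc j) x) (at x)"
  proof (intro allI)
    fix j x
    show "(?K j has_real_derivative ?K (Suc j) x) (at x)"
      using sm_has_pd[OF sm_iter_pd[OF assms, of "replicate j m"], of "p(m := x)" m] by simp
  qed
qed

lemma tint_even: "(\<And>t. h (- t) = h t) \<Longrightarrow> tint h (- t) = - tint h t"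
  and tint_odd: "(\<And>t. h (- t) = - h t) \<Longrightarrow> tint h (- t) = tint h t"
  unfolding tint_def mult_minus_left by simp_all

abbreviation (input) sqr :: "real \<Rightarrow> real" where "sqr \<equiv> \<lambda>t. t ^ 2"
abbreviation (input) dbl :: "real \<Rightarrow> real" where "dbl \<equiv> \<lambda>t. 2 * t"

context coords begin

lemma sum_n: "(\<Sum>i<n. f i) = (\<Sum>i<2 * r. f i) + f (2 * r) + (f (Suc (2 * r)) :: real)"
  by (simp add: n)

lemma bil_gM: "bil n (gM r \<psi> p) a b = (\<Sum>i<n. a i * b (dual r i)) - 2 * pot r \<psi> p * a (2 * r) * b (2 * r)"
proof -
  have "bil n (gM r \<psi> p) a b = (\<Sum>i<n. a i * (b (dual r i) - (if i = 2 * r then 2 * pot r \<psi> p * b (2 * r) else 0)))"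
    unfolding bil_def
  proof (rule sum.cong)
    fix i assume "i \<in> {..<n}"
    then show "a i * (\<Sum>l<n. b l * gM r \<psi> p i l) = a i * (b (dual r i) - (if i = 2 * r then 2 * pot r \<psi> p * b (2 * r) else 0))"
      using sum_gM[of i \<psi> p b] by (simp add: mult.commute)
  qed simp
  also have "\<dots> = (\<Sum>i<n. a i * b (dual r i)) - (\<Sum>i<n. if i = 2 * r then 2 * pot r \<psi> p * a (2 * r) * b (2 * r) else 0)"
    unfolding sum_subtractf[symmetric] by (rule sum.cong) (auto simp: algebra_simps)
  finally show ?thesis by (simp add: sum.delta)
qed

text \<open>Polarisation: for quadratic \<psi> the potential is a quadratic form.\<close>

lemma pot_sqr_diff: "pot r sqr (\<lambda>i. b i - p i) = pot r sqr b + pot r sqr p - (\<Sum>j<n. dpot r dbl b j * p j)"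
  unfolding pot_def sum_dpot
  by (simp add: sum.distrib sum_subtractf algebra_simps power2_eq_square)

text \<open>Euler's identity for a form of degree 2.\<close>

lemma sum_dpot_self: "(\<Sum>j<n. dpot r dbl b j * b j) = 2 * pot r sqr b"
  unfolding pot_def sum_dpot
  by (simp add: sum.distrib power2_eq_square sum_distrib_left mult_ac)

text \<open>In the quadratic case the symmetry at \<open>P\<close> is
  \<open>w \<mapsto> \<beta>(x - x\<^sub>0) - w\<close>, \<open>x \<mapsto> 2x\<^sub>0 - x\<close>, \<open>y \<mapsto> 2y\<^sub>0 - y + \<langle>\<beta>,\<beta>'\<rangle>/2 - \<langle>\<beta>',w\<rangle>\<close>
  where \<open>\<beta>\<close> is the transversal part of the geodesic with \<open>\<beta>(0) = 2w\<^sub>0\<close>, \<open>\<beta>'(0) = 0\<close> and unit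
  velocity in the direction \<open>x\<close>.\<close>

lemma symmetric_space_sqr: "symmetric_space n (gM r sqr)"
  unfolding symmetric_space_def
proof
  fix P assume P: "P \<in> Rn n"
  define V where "V = kd (2 * r)"
  define P2 where "P2 i = 2 * P i" for i
  define B where "B i = chain r dbl P2 V (chi r i)" for i
  define B1 where "B1 i = dchain r dbl P2 V (chi r i)" for i
  \<comment> \<open>The tower of derivatives of the square function.\<close>
  define H where "H j = (if j = 0 then sqr else if j = 1 then dbl else if j = 2 then (\<lambda>t. 2) else (\<lambda>t. 0))" for j :: nat
  have H: "\<forall>j x. (H j has_real_derivative H (Suc j) x) (at x)"
  proof (intro allI)
    fix j :: nat and x
    consider "j = 0" | "j = 1" | "j = 2" | "j > 2" by linarith
    then show "(H j has_real_derivative H (Suc j) x) (at x)"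
      by cases (auto simp: H_def One_nat_def intro!: derivative_eq_intros)
  qed
  have cont: "continuous_on UNIV dbl" by (intro continuous_intros)
  have V: "V (2 * r) = 1" "V (chi r c) = 0" if "c < 2 * r" for c
    using chi_less[OF that] by (auto simp: V_def kd_def)
  have dB: "(B i has_real_derivative B1 i t) (at t)" for i t
    unfolding B_def B1_def by (rule chain_derivs[OF cont])
  have dB1: "(B1 i has_real_derivative - dpot r dbl (\<lambda>j. B j t) (dual r i)) (at t)" if i: "i < 2 * r" for i t
  proof (cases "chi r i")
    case 0
    then have "i = 0" using chi_chi[OF i] chi_0 by simp
    then show ?thesis using chain_derivs(3)[OF cont] by (simp add: B1_def chi_0 dpot_dual_chi(1))
  next
    case (Suc c)
    then have c: "i = chi r (Suc c)" "Suc c < 2 * r" using chi_chi[OF i] chi_less[OF i] by auto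
    then have "dpot r dbl (\<lambda>j. B j t) (dual r i) = link r dbl c (chain r dbl P2 V c t)"
      by (simp add: dpot_dual_chi(2) B_def chi_chi)
    then show ?thesis using chain_derivs(2)[OF cont, of r P2 V c t] Suc V(1)[OF c(2)] by (simp add: B1_def)
  qed
  \<comment> \<open>Zero initial velocity makes \<beta> even: the parity passes along the chain
    since a double integral from 0 of an even function is even.\<close>
  have even: "c < 2 * r \<Longrightarrow> chain r dbl P2 V c (- t) = chain r dbl P2 V c t" for c t
  proof (induction c arbitrary: t)
    case 0
    then show ?case using V(2)[of 0] by (simp add: chi_0)
  next
    case (Suc c)
    have "tint (tint (\<lambda>s. link r dbl c (chain r dbl P2 V c s))) (- t) = tint (tint (\<lambda>s. link r dbl c (chain r dbl P2 V c s))) t"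
      by (intro tint_odd tint_even) (use Suc in simp)
    then show ?case using V(2)[OF Suc.prems] by simp
  qed
  have Bev: "B i (- t) = B i t" if "i < 2 * r" for i t
    unfolding B_def by (rule even[OF chi_less[OF that]])
  have B1odd: "B1 i (- t) = - B1 i t" if "i < 2 * r" for i t
  proof (cases "chi r i")
    case 0
    then show ?thesis using V(2)[of 0] r0 by (simp add: B1_def dchain_def chi_0)
  next
    case (Suc c)
    then have c: "Suc c < 2 * r" using chi_less[OF that] by simp
    have "tint (\<lambda>s. link r dbl c (chain r dbl P2 V c s)) (- t) = - tint (\<lambda>s. link r dbl c (chain r dbl P2 V c s)) t"
      by (intro tint_even) (use even c in simp)
    then show ?thesis using V(2)[OF c] by (simp add: B1_def dchain_def Suc)
  qed
  have B0: "B i 0 = 2 * P i" "B1 i 0 = 0" if "i < 2 * r" for i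
  proof -
    have "chain r dbl P2 V c 0 = P2 (chi r c)" for c by (cases c) (simp_all add: chi_0)
    then show "B i 0 = 2 * P i" using chi_chi[OF that] by (simp add: B_def P2_def)
    show "B1 i 0 = 0" using B1odd[OF that, of 0] by simp
  qed
  \<comment> \<open>With the velocity frozen to \<open>V\<close>, the tower in the time coordinate
    starts with \<open>B i\<close> and \<open>B1 i\<close>; composing with x - x_0 gives members of
    \<open>sm\<close>.\<close>
  have smB: "(\<lambda>p. B i (p (2 * r) - P (2 * r))) \<in> sm" "(\<lambda>p. B1 i (p (2 * r) - P (2 * r))) \<in> sm" if i: "i < 2 * r" for i
  proof -
    have "(\<lambda>p. chain r (H 1) P2 p (chi r i) (p n)) \<in> sm" by (rule chain_sm[OF H chi_less[OF i]])
    from sm_tower[OF this, of V n] obtain K :: "nat \<Rightarrow> real \<Rightarrow> real"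
      where K: "K 0 = (\<lambda>t. chain r (H 1) P2 (V(n := t)) (chi r i) ((V(n := t)) n))"
        "\<forall>j x. (K j has_real_derivative K (Suc j) x) (at x)" by blast
    have K0: "K 0 = B i"
    proof
      fix t
      have "chain r dbl P2 (V(n := t)) (chi r i) = chain r dbl P2 V (chi r i)"
        using n by (intro chain_cong chi_less i) auto
      then show "K 0 t = B i t" by (simp add: K B_def H_def)
    qed
    have K1: "K 1 = B1 i"
    proof
      fix t
      have "(B i has_real_derivative K 1 t) (at t)" using K(2) K0 by (metis One_nat_def)
      then show "K 1 t = B1 i t" using dB DERIV_unique by blast
    qed
    have f: "(\<lambda>p. p (2 * r) - P (2 * r)) \<in> sm" by (intro sm_diff sm.coord sm.const)
    show "(\<lambda>p. B i (p (2 * r) - P (2 * r))) \<in> sm" using sm.comp[OF f K(2), of 0] K0 by simp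
    show "(\<lambda>p. B1 i (p (2 * r) - P (2 * r))) \<in> sm" using sm.comp[OF f K(2), of 1] K1 by simp
  qed
  have dl: "dual r i < 2 * r" if "i < 2 * r" for i using that by (auto simp: dual_def)
  define \<sigma> where "\<sigma> p i = (if i < 2 * r then B i (p (2 * r) - P (2 * r)) - p i
     else if i = 2 * r then 2 * P (2 * r) - p (2 * r)
     else if i = Suc (2 * r) then 2 * P (Suc (2 * r)) - p (Suc (2 * r))
       + (\<Sum>j<2 * r. B j (p (2 * r) - P (2 * r)) * B1 (dual r j) (p (2 * r) - P (2 * r))) / 2
       - (\<Sum>j<2 * r. B1 (dual r j) (p (2 * r) - P (2 * r)) * p j)
     else 0)" for p i
  have \<sigma>R: "\<sigma> p \<in> Rn n" for p by (auto simp: Rn_def \<sigma>_def n)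
  have sm\<sigma>: "(\<lambda>p. \<sigma> p i) \<in> sm" for i
  proof -
    consider "i < 2 * r" | "i = 2 * r" | "i = Suc (2 * r)" | "i > Suc (2 * r)" by linarith
    then show ?thesis
    proof cases
      case 1
      then show ?thesis using sm_diff[OF smB(1)[OF 1] sm.coord] by (simp add: \<sigma>_def)
    next
      case 2
      then show ?thesis using sm_diff[OF sm.const sm.coord] by (simp add: \<sigma>_def)
    next
      case 3
      have s1: "(\<lambda>p. \<Sum>j<2 * r. B j (p (2 * r) - P (2 * r)) * B1 (dual r j) (p (2 * r) - P (2 * r))) \<in> sm"
        by (rule sm_sum) (auto intro!: sm.mult[OF smB(1) smB(2)] dl)
      have s2: "(\<lambda>p. \<Sum>j<2 * r. B1 (dual r j) (p (2 * r) - P (2 * r)) * p j) \<in> sm"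
        by (rule sm_sum) (auto intro!: sm.mult[OF smB(2) sm.coord] dl)
      show ?thesis using 3 sm_diff[OF sm.add[OF sm_diff[OF sm.const sm.coord] sm.mult[OF s1 sm.const]] s2, of "2 * P (Suc (2 * r))" "Suc (2 * r)" "1/2"]
        by (simp add: \<sigma>_def)
    next
      case 4
      then show ?thesis by (simp add: \<sigma>_def sm.const)
    qed
  qed
  have smooth: "smooth_map_on n (Rn n) \<sigma>"
    by (rule smooth_map_on_sm[where f = "\<lambda>i p. \<sigma> p i"]) (auto simp: \<sigma>R sm\<sigma>)
  \<comment> \<open>The symmetry reverses s = x - x_0. Since \<beta> is even and \<beta>' odd, the
    transversal part returns to itself and the multiples of the pairing of \<beta> with \<beta>' in
    the y-component add up to 0.\<close>
  have inv: "\<sigma> (\<sigma> p) = p" if p: "p \<in> Rn n" for p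
  proof (rule Rn_eqI[OF \<sigma>R p])
    fix i assume "i < n"
    define s where "s = p (2 * r) - P (2 * r)"
    have s': "\<sigma> p (2 * r) - P (2 * r) = - s" by (simp add: \<sigma>_def s_def)
    consider "i < 2 * r" | "i = 2 * r" | "i = Suc (2 * r)" using \<open>i < n\<close> n by linarith
    then show "\<sigma> (\<sigma> p) i = p i"
    proof cases
      case 1
      then have "\<sigma> (\<sigma> p) i = B i (\<sigma> p (2 * r) - P (2 * r)) - \<sigma> p i" by (simp add: \<sigma>_def)
      then show ?thesis unfolding s' using 1 Bev by (simp add: \<sigma>_def s_def[symmetric])
    next
      case 2 then show ?thesis by (simp add: \<sigma>_def)
    next
      case 3
      have w: "\<sigma> p j = B j s - p j" if "j < 2 * r" for j using that by (simp add: \<sigma>_def s_def)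
      have "\<sigma> (\<sigma> p) (Suc (2 * r)) = 2 * P (Suc (2 * r)) - \<sigma> p (Suc (2 * r))
       + (\<Sum>j<2 * r. B j (- s) * B1 (dual r j) (- s)) / 2 - (\<Sum>j<2 * r. B1 (dual r j) (- s) * \<sigma> p j)"
        unfolding \<sigma>_def[of "\<sigma> p"] s' by simp
      also have "(\<Sum>j<2 * r. B j (- s) * B1 (dual r j) (- s)) = - (\<Sum>j<2 * r. B j s * B1 (dual r j) s)"
        unfolding sum_negf[symmetric] by (rule sum.cong) (auto simp: Bev B1odd dl)
      also have "(\<Sum>j<2 * r. B1 (dual r j) (- s) * \<sigma> p j) = (\<Sum>j<2 * r. B1 (dual r j) s * p j) - (\<Sum>j<2 * r. B j s * B1 (dual r j) s)"
        unfolding sum_subtractf[symmetric] by (rule sum.cong; simp add: B1odd dl w; simp add: algebra_simps)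
      also have "\<sigma> p (Suc (2 * r)) = 2 * P (Suc (2 * r)) - p (Suc (2 * r))
       + (\<Sum>j<2 * r. B j s * B1 (dual r j) s) / 2 - (\<Sum>j<2 * r. B1 (dual r j) s * p j)"
        by (simp add: \<sigma>_def s_def)
      finally show ?thesis using 3 by simp
    qed
  qed
  have img: "\<sigma> ` Rn n = Rn n"
  proof
    show "\<sigma> ` Rn n \<subseteq> Rn n" using \<sigma>R by auto
    show "Rn n \<subseteq> \<sigma> ` Rn n"
    proof
      fix p assume "p \<in> Rn n"
      then show "p \<in> \<sigma> ` Rn n" using inv[of p] \<sigma>R by (metis imageI)
    qed
  qed
  have diffeo: "diffeo_betw n (Rn n) (Rn n) \<sigma>"
    unfolding diffeo_betw_def using smooth img inv by blast
  \<comment> \<open>The x-derivative of the y-component of the symmetry. The equation \<beta>'' =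
    -grad F(\<beta>) and Euler's identity turn half the pairing of \<beta> with \<beta>'' into
    -F(\<beta>).\<close>
  define Z where "Z p = (let s = p (2 * r) - P (2 * r) in
     (\<Sum>j<2 * r. B1 j s * B1 (dual r j) s) / 2 - pot r sqr (\<lambda>j. B j s) + (\<Sum>j<n. dpot r dbl (\<lambda>j. B j s) j * p j))" for p
  have Jac: "Jac \<sigma> p i a = (if i < 2 * r then kd a (2 * r) * B1 i (p (2 * r) - P (2 * r)) - kd a i
     else if i = 2 * r then - kd a (2 * r)
     else kd a (2 * r) * Z p - kd a (Suc (2 * r)) - (if a < 2 * r then B1 (dual r a) (p (2 * r) - P (2 * r)) else 0))"
    if i: "i < n" for p i a
  proof -
    define s where "s = p (2 * r) - P (2 * r)"
    have ds: "((\<lambda>t. (p(a := t)) (2 * r) - P (2 * r)) has_real_derivative kd a (2 * r)) (at (p a))"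
      using DERIV_diff[OF fun_upd_coord_deriv DERIV_const] by simp
    have cB: "((\<lambda>t. B j ((p(a := t)) (2 * r) - P (2 * r))) has_real_derivative B1 j s * kd a (2 * r)) (at (p a))" for j
      by (rule DERIV_chain2[where f = "B j", OF _ ds]) (simp add: s_def dB)
    have cB1: "((\<lambda>t. B1 j ((p(a := t)) (2 * r) - P (2 * r))) has_real_derivative
        - dpot r dbl (\<lambda>j. B j s) (dual r j) * kd a (2 * r)) (at (p a))" if "j < 2 * r" for j
      by (rule DERIV_chain2[where f = "B1 j", OF _ ds]) (simp add: s_def dB1 that)
    have s0: "(p(a := p a)) (2 * r) - P (2 * r) = s" by (simp add: s_def)
    consider "i < 2 * r" | "i = 2 * r" | "i = Suc (2 * r)" using i n by linarith
    then show ?thesis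
    proof cases
      case 1
      have "((\<lambda>t. \<sigma> (p(a := t)) i) has_real_derivative B1 i s * kd a (2 * r) - kd a i) (at (p a))"
        unfolding \<sigma>_def if_P[OF 1] by (rule DERIV_diff[OF cB fun_upd_coord_deriv])
      then show ?thesis using 1 by (simp add: Jac_def pd_def DERIV_imp_deriv s_def mult.commute)
    next
      case 2
      have "((\<lambda>t. 2 * P (2 * r) - (p(a := t)) (2 * r)) has_real_derivative 0 - kd a (2 * r)) (at (p a))"
        by (rule DERIV_diff[OF DERIV_const fun_upd_coord_deriv])
      then have "((\<lambda>t. \<sigma> (p(a := t)) i) has_real_derivative - kd a (2 * r)) (at (p a))"
        using 2 by (simp add: \<sigma>_def del: fun_upd_apply)
      then show ?thesis using 2 by (simp add: Jac_def pd_def DERIV_imp_deriv)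
    next
      case 3
      define D where "D = dpot r dbl (\<lambda>j. B j s)"
      define S1 where "S1 = (\<Sum>j<2 * r. B1 j s * kd a (2 * r) * B1 (dual r j) s + - D (dual r (dual r j)) * kd a (2 * r) * B j s)"
      define S2 where "S2 = (\<Sum>j<2 * r. - D (dual r (dual r j)) * kd a (2 * r) * p j + kd a j * B1 (dual r j) s)"
      have D1: "((\<lambda>t. \<Sum>j<2 * r. B j ((p(a := t)) (2 * r) - P (2 * r)) * B1 (dual r j) ((p(a := t)) (2 * r) - P (2 * r)))
         has_real_derivative S1) (at (p a))"
        unfolding S1_def
      proof (rule DERIV_sum)
        fix j assume "j \<in> {..<2 * r}"
        then show "((\<lambda>t. B j ((p(a := t)) (2 * r) - P (2 * r)) * B1 (dual r j) ((p(a := t)) (2 * r) - P (2 * r)))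
          has_real_derivative B1 j s * kd a (2 * r) * B1 (dual r j) s + - D (dual r (dual r j)) * kd a (2 * r) * B j s) (at (p a))"
          using DERIV_mult[OF cB[of j] cB1[OF dl, of j]] unfolding s0 D_def by simp
      qed
      have D2: "((\<lambda>t. \<Sum>j<2 * r. B1 (dual r j) ((p(a := t)) (2 * r) - P (2 * r)) * (p(a := t)) j) has_real_derivative S2) (at (p a))"
        unfolding S2_def
      proof (rule DERIV_sum)
        fix j assume "j \<in> {..<2 * r}"
        then show "((\<lambda>t. B1 (dual r j) ((p(a := t)) (2 * r) - P (2 * r)) * (p(a := t)) j)
          has_real_derivative - D (dual r (dual r j)) * kd a (2 * r) * p j + kd a j * B1 (dual r j) s) (at (p a))"
          using DERIV_mult[OF cB1[OF dl, of j] fun_upd_coord_deriv[of p a j "p a"]] unfolding s0 D_def by simp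
      qed
      have "((\<lambda>t. \<sigma> (p(a := t)) i) has_real_derivative 0 - kd a (Suc (2 * r)) + S1 / 2 - S2) (at (p a))"
        using DERIV_diff[OF DERIV_add[OF DERIV_diff[OF DERIV_const fun_upd_coord_deriv] DERIV_cdivide[OF D1]] D2]
        by (simp add: \<sigma>_def 3 del: fun_upd_apply)
      then have J: "Jac \<sigma> p i a = - kd a (Suc (2 * r)) + S1 / 2 - S2" by (simp add: Jac_def pd_def DERIV_imp_deriv)
      have d2: "(\<Sum>j<2 * r. D j * q j) = (\<Sum>j<n. D j * q j)" for q
        by (simp add: sum_n D_def)
      have "S1 = (\<Sum>j<2 * r. kd a (2 * r) * (B1 j s * B1 (dual r j) s) - kd a (2 * r) * (D j * B j s))"
        unfolding S1_def by (rule sum.cong) (auto simp: algebra_simps)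
      also have "\<dots> = kd a (2 * r) * ((\<Sum>j<2 * r. B1 j s * B1 (dual r j) s) - 2 * pot r sqr (\<lambda>j. B j s))"
        unfolding sum_subtractf sum_distrib_left[symmetric] d2 sum_dpot_self[of "\<lambda>j. B j s", folded D_def] by (simp add: algebra_simps)
      finally have S1: "S1 = kd a (2 * r) * ((\<Sum>j<2 * r. B1 j s * B1 (dual r j) s) - 2 * pot r sqr (\<lambda>j. B j s))" .
      have "S2 = (\<Sum>j<2 * r. (if j = a then B1 (dual r a) s else 0) - kd a (2 * r) * (D j * p j))"
        unfolding S2_def by (rule sum.cong) (auto simp: kd_def algebra_simps)
      also have "\<dots> = (if a < 2 * r then B1 (dual r a) s else 0) - kd a (2 * r) * (\<Sum>j<n. D j * p j)"
        unfolding sum_subtractf sum_distrib_left[symmetric] d2 by (simp add: sum.delta)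
      finally have S2: "S2 = (if a < 2 * r then B1 (dual r a) s else 0) - kd a (2 * r) * (\<Sum>j<n. D j * p j)" .
      have Z: "Z p = (\<Sum>j<2 * r. B1 j s * B1 (dual r j) s) / 2 - pot r sqr (\<lambda>j. B j s) + (\<Sum>j<n. D j * p j)"
        by (simp add: Z_def Let_def s_def D_def)
      have "Jac \<sigma> p i a = kd a (2 * r) * Z p - kd a (Suc (2 * r)) - (if a < 2 * r then B1 (dual r a) s else 0)"
        unfolding J S1 S2 Z by (simp add: field_simps)
      then show ?thesis using 3 by (simp add: s_def)
    qed
  qed
  have isom: "(\<Sum>i<n. \<Sum>j<n. Jac \<sigma> p i a * Jac \<sigma> p j b * gM r sqr (\<sigma> p) i j) = gM r sqr p a b"
    if ab: "a < n" "b < n" for p a b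
  proof -
    define s where "s = p (2 * r) - P (2 * r)"
    define Q where "Q = (\<Sum>j<2 * r. B1 j s * B1 (dual r j) s)"
    let ?c = "\<lambda>a i. Jac \<sigma> p i a"
    define u where "u a = (if a < 2 * r then B1 (dual r a) s else 0)" for a
    have cw: "?c a i = kd a (2 * r) * B1 i s - kd a i" if "i < 2 * r" for a i
      using Jac[of i p a] that n by (simp add: s_def)
    have cx: "?c a (2 * r) = - kd a (2 * r)" for a using Jac[of "2 * r" p a] by simp
    have cy: "?c a (Suc (2 * r)) = kd a (2 * r) * Z p - kd a (Suc (2 * r)) - u a" for a
      using Jac[of "Suc (2 * r)" p a] by (simp add: s_def u_def)
    have k1: "(\<Sum>i<2 * r. kd a i * f i) = (if a < 2 * r then f a else 0)" for f :: "nat \<Rightarrow> real" and a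
      by (simp add: kd_def mult_delta_left sum.delta)
    have "(\<Sum>i<2 * r. ?c a i * ?c b (dual r i)) = (\<Sum>i<2 * r. kd a (2 * r) * kd b (2 * r) * (B1 i s * B1 (dual r i) s)
       - kd b (2 * r) * (kd a i * B1 (dual r i) s) - kd a (2 * r) * (kd b (dual r i) * B1 i s) + kd a i * kd b (dual r i))"
      by (rule sum.cong; simp add: cw dl; simp add: algebra_simps)
    also have "\<dots> = kd a (2 * r) * kd b (2 * r) * Q - kd b (2 * r) * u a - kd a (2 * r) * u b
       + (if a < 2 * r then kd b (dual r a) else 0)"
    proof -
      have "(\<Sum>i<2 * r. kd b (dual r i) * B1 i s) = (\<Sum>i<2 * r. kd b i * B1 (dual r i) s)"
        by (rule sum.reindex_bij_witness[of _ "dual r" "dual r"]) (auto intro: dl)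
      then show ?thesis
        by (simp add: sum_subtractf sum.distrib sum_distrib_left[symmetric] k1 u_def Q_def)
    qed
    finally have S: "(\<Sum>i<2 * r. ?c a i * ?c b (dual r i)) = kd a (2 * r) * kd b (2 * r) * Q - kd b (2 * r) * u a - kd a (2 * r) * u b
       + (if a < 2 * r then kd b (dual r a) else 0)" .
    have "pot r sqr (\<sigma> p) = pot r sqr (\<lambda>i. B i s - p i)"
      by (rule pot_cong) (simp add: \<sigma>_def s_def)
    also have "\<dots> = pot r sqr (\<lambda>i. B i s) + pot r sqr p - (\<Sum>j<n. dpot r dbl (\<lambda>i. B i s) j * p j)"
      by (rule pot_sqr_diff)
    \<comment> \<open>This is the comparison of the coefficients of dx^2 before and after the map,
      which polarisation of F settles.\<close>
    finally have pot: "Q - 2 * Z p - 2 * pot r sqr (\<sigma> p) = - 2 * pot r sqr p"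
      by (simp add: Z_def Let_def s_def[symmetric] Q_def)
    have "(\<Sum>i<n. \<Sum>j<n. Jac \<sigma> p i a * Jac \<sigma> p j b * gM r sqr (\<sigma> p) i j) = bil n (gM r sqr (\<sigma> p)) (?c a) (?c b)"
      by (simp add: bil_expand)
    also have "\<dots> = (\<Sum>i<2 * r. ?c a i * ?c b (dual r i)) + ?c a (2 * r) * ?c b (Suc (2 * r)) + ?c a (Suc (2 * r)) * ?c b (2 * r)
       - 2 * pot r sqr (\<sigma> p) * ?c a (2 * r) * ?c b (2 * r)"
      unfolding bil_gM sum_n by simp
    also have "\<dots> = (if a < 2 * r then kd b (dual r a) else 0) + kd a (2 * r) * kd b (Suc (2 * r)) + kd a (Suc (2 * r)) * kd b (2 * r)
       + kd a (2 * r) * kd b (2 * r) * (Q - 2 * Z p - 2 * pot r sqr (\<sigma> p))"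
      unfolding S cx cy by (simp add: algebra_simps)
    also have "\<dots> = gM r sqr p a b"
    proof -
      have "(if a < 2 * r then kd b (dual r a) else 0) + kd a (2 * r) * kd b (Suc (2 * r)) + kd a (Suc (2 * r)) * kd b (2 * r) = g_flat r a b"
        using ab n by (auto simp: g_flat_dual kd_def dual_def)
      then show ?thesis unfolding pot gM_pot by (simp add: kd_def)
    qed
    finally show ?thesis .
  qed
  have fixP: "\<sigma> P = P"
  proof (rule Rn_eqI[OF \<sigma>R P])
    fix i assume "i < n"
    then consider "i < 2 * r" | "i = 2 * r" | "i = Suc (2 * r)" using n by linarith
    then show "\<sigma> P i = P i" by cases (auto simp: \<sigma>_def B0 dl)
  qed
  \<comment> \<open>At \<open>P\<close> one has \<beta> = 2w_0 and \<beta>' = 0, so Z = -4 F(P) + 4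
    F(P).\<close>
  have Z0: "Z P = 0"
  proof -
    have p: "pot r sqr (\<lambda>j. B j 0) = 4 * pot r sqr P"
    proof -
      have "pot r sqr (\<lambda>j. B j 0) = pot r sqr (\<lambda>j. 2 * P j)" by (rule pot_cong) (simp add: B0)
      then show ?thesis by (simp add: pot_def sum_distrib_left power2_eq_square mult_ac)
    qed
    have "dpot r dbl (\<lambda>j. B j 0) j = 2 * dpot r dbl P j" for j
      using r0 by (auto simp: dpot_def B0)
    then have "(\<Sum>j<n. dpot r dbl (\<lambda>j. B j 0) j * P j) = 2 * (\<Sum>j<n. dpot r dbl P j * P j)"
      by (simp add: sum_distrib_left mult.assoc)
    moreover have "(\<Sum>j<2 * r. B1 j 0 * B1 (dual r j) 0) = 0" by (simp add: B0)
    ultimately show ?thesis by (simp add: Z_def Let_def p sum_dpot_self)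
  qed
  have "Jac \<sigma> P i j = - kd i j" if "i < n" "j < n" for i j
    using Jac[OF that(1), of P j] that n Z0 by (auto simp: B0 dl kd_def split: if_splits)
  then show "\<exists>\<sigma>. isometry_betw n (gM r sqr) (gM r sqr) (Rn n) (Rn n) \<sigma> \<and> \<sigma> P = P \<and> (\<forall>i<n. \<forall>j<n. Jac \<sigma> P i j = - kd i j)"
    unfolding isometry_betw_def using diffeo isom fixP by blast
qed

end

section \<open>Partial derivatives on open sets\<close>

text \<open>In the product topology only finitely many coordinates matter, and on
  \<open>Rn n\<close> those from n on are constantly 0. Otherwise points outside \<open>U\<close> in
  shrinking boxes would converge coordinatewise to \<open>p\<close>.\<close>

lemma Rn_box:
  assumes "openin (top_of_set (Rn n)) U" "p \<in> U"
  obtains e where "e > 0" "\<And>q. q \<in> Rn n \<Longrightarrow> (\<And>i. i < n \<Longrightarrow> \<bar>q i - p i\<bar> < e) \<Longrightarrow> q \<in> U"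
proof -
  obtain W where W: "open W" "U = Rn n \<inter> W" using assms(1) by (auto simp: openin_open)
  have "\<exists>e>0. \<forall>q\<in>Rn n. (\<forall>i<n. \<bar>q i - p i\<bar> < e) \<longrightarrow> q \<in> U"
  proof (rule ccontr)
    assume neg: "\<not> ?thesis"
    have "\<exists>q\<in>Rn n. (\<forall>i<n. \<bar>q i - p i\<bar> < inverse (real (Suc m))) \<and> q \<notin> U" for m
      using neg by (metis inverse_positive_iff_positive of_nat_0_less_iff zero_less_Suc)
    then obtain Q where Q: "\<And>m. Q m \<in> Rn n" "\<And>m i. i < n \<Longrightarrow> \<bar>Q m i - p i\<bar> < inverse (real (Suc m))" "\<And>m. Q m \<notin> U"
      by metis
    have "(\<lambda>m. Q m i) \<longlonglongrightarrow> p i" for i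
    proof (cases "i < n")
      case True
      show ?thesis
        by (rule Lim_transform_bound[OF _ LIMSEQ_inverse_real_of_nat, THEN Lim_null[THEN iffD2]])
          (use Q(2)[OF True] in \<open>auto intro!: eventuallyI simp: less_imp_le\<close>)
    next
      case False
      then have "Q m i = 0" "p i = 0" for m using Q(1)[of m] assms(2) W by (auto simp: Rn_def)
      then show ?thesis by simp
    qed
    then have "limitin (product_topology (\<lambda>i. euclidean) UNIV) Q p sequentially"
      by (simp add: limitin_componentwise)
    then have "Q \<longlonglongrightarrow> p" by (simp only: euclidean_product_topology limitin_canonical_iff)
    then have "eventually (\<lambda>m. Q m \<in> W) sequentially"
      using topological_tendstoD[of Q p sequentially W] W assms(2) by auto
    then obtain m where "Q m \<in> W" by (auto simp: eventually_sequentially)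
    then show False using Q(1,3)[of m] W by auto
  qed
  then show ?thesis using that by blast
qed

lemma eventually_upd_in:
  assumes "openin (top_of_set (Rn n)) U" "p \<in> U" "k < n"
  shows "eventually (\<lambda>t. p(k := t) \<in> U) (nhds (p k))"
proof -
  obtain e where e: "e > 0" "\<And>q. q \<in> Rn n \<Longrightarrow> (\<And>i. i < n \<Longrightarrow> \<bar>q i - p i\<bar> < e) \<Longrightarrow> q \<in> U"
    using Rn_box[OF assms(1,2)] by metis
  have p: "p \<in> Rn n" using assms openin_subset by fastforce
  have "p(k := t) \<in> U" if "dist t (p k) < e" for t
    using that e(1) by (intro e(2) Rn_upd p assms) (auto simp: dist_real_def)
  then show ?thesis unfolding eventually_nhds_metric using e(1) by blast
qed

section \<open>Calculus of smooth functions on relatively open sets\<close>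

lemma iter_pd_append: "iter_pd (ks @ ls) f = iter_pd ks (iter_pd ls f)"
  by (induction ks) auto

lemma smooth_on_pd: "smooth_on n U f \<Longrightarrow> k < n \<Longrightarrow> smooth_on n U (pd k f)"
  unfolding smooth_on_def
proof (intro allI impI)
  fix ks :: "nat list"
  assume a: "\<forall>ks. set ks \<subseteq> {..<n} \<longrightarrow> continuous_on U (iter_pd ks f) \<and>
        (\<forall>k<n. \<forall>p\<in>U. (\<lambda>t. iter_pd ks f (p(k := t))) differentiable at (p k))"
    and "k < n" "set ks \<subseteq> {..<n}"
  then show "continuous_on U (iter_pd ks (pd k f)) \<and>
        (\<forall>ka<n. \<forall>p\<in>U. (\<lambda>t. iter_pd ks (pd k f) (p(ka := t))) differentiable at (p ka))"
    using a[rule_format, of "ks @ [k]"] by (simp add: iter_pd_append)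
qed

lemma smooth_on_has_pd:
  assumes "smooth_on n U f" "p \<in> U" "k < n"
  shows "((\<lambda>t. f (p(k := t))) has_real_derivative pd k f p) (at (p k))"
proof -
  have "(\<lambda>t. iter_pd [] f (p(k := t))) differentiable at (p k)"
    using assms unfolding smooth_on_def by (metis empty_set empty_subsetI)
  then show ?thesis by (simp add: pd_def DERIV_deriv_iff_real_differentiable)
qed

lemma smooth_on_continuous: "smooth_on n U f \<Longrightarrow> continuous_on U f"
  unfolding smooth_on_def using iter_pd.simps(1) by (metis empty_set empty_subsetI)

lemma continuous_on_box:
  assumes U: "openin (top_of_set (Rn n)) U" "p \<in> U" and f: "continuous_on U f" and e: "(e :: real) > 0"
  obtains d where "d > 0" "\<And>q. q \<in> Rn n \<Longrightarrow> (\<And>i. i < n \<Longrightarrow> \<bar>q i - p i\<bar> < d) \<Longrightarrow> q \<in> U \<and> \<bar>f q - f p\<bar> < e"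
proof -
  have "openin (top_of_set U) (U \<inter> f -` ball (f p) e)"
    using f by (intro continuous_openin_preimage_gen) auto
  then have "openin (top_of_set (Rn n)) (U \<inter> f -` ball (f p) e)"
    using U(1) openin_trans by blast
  moreover have "p \<in> U \<inter> f -` ball (f p) e" using U e by auto
  ultimately obtain d where "d > 0" "\<And>q. q \<in> Rn n \<Longrightarrow> (\<And>i. i < n \<Longrightarrow> \<bar>q i - p i\<bar> < d) \<Longrightarrow> q \<in> U \<inter> f -` ball (f p) e"
    using Rn_box by metis
  then show ?thesis using that[of d] by (auto simp: dist_real_def abs_minus_commute)
qed

lemma MVT_real:
  fixes g g' :: "real \<Rightarrow> real"
  assumes "a \<noteq> b" "\<And>t. min a b \<le> t \<Longrightarrow> t \<le> max a b \<Longrightarrow> (g has_real_derivative g' t) (at t)"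
  obtains \<xi> where "min a b \<le> \<xi>" "\<xi> \<le> max a b" "g b - g a = (b - a) * g' \<xi>"
proof (cases "a < b")
  case True
  then obtain z where "a < z" "z < b" "g b - g a = (b - a) * g' z" using MVT2[of a b g g'] assms by auto
  then show ?thesis using that[of z] True by auto
next
  case False
  then have "b < a" using assms by simp
  then obtain z where "b < z" "z < a" "g a - g b = (a - b) * g' z" using MVT2[of b a g g'] assms by auto
  then show ?thesis using that[of z] \<open>b < a\<close> by (auto simp: algebra_simps)
qed

text \<open>Caratheodory's form of differentiability: along the polygonal path from \<open>p\<close> to \<open>q\<close> one coordinate
  changes at a time, so \<open>f q - f p = (\<Sum>m<n. A m q * (q m - p m))\<close> with difference quotients
  \<open>A m q\<close> that tend to the partial derivatives at \<open>p\<close>.\<close>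

lemma pd_chain_rule:
  assumes U: "openin (top_of_set (Rn n)) U" and f: "smooth_on n U f" and p: "c t0 \<in> U"
    and R: "eventually (\<lambda>t. c t \<in> Rn n) (nhds t0)"
    and c: "\<And>i. i < n \<Longrightarrow> ((\<lambda>t. c t i) has_real_derivative c' i) (at t0)"
  shows "((\<lambda>t. f (c t)) has_real_derivative (\<Sum>i<n. pd i f (c t0) * c' i)) (at t0)"
proof -
  define p where "p = c t0"
  have pU: "p \<in> U" and pR: "p \<in> Rn n" using p U openin_subset by (fastforce simp: p_def)+
  define hyb where "hyb m q i = (if i < m then q i else p i)" for m :: nat and q :: "nat \<Rightarrow> real" and i
  \<comment> \<open>Where the coordinate does not change, the quotient is given its limit as value;
    the telescoping identity is unaffected because the factor q m - p m is 0.\<close>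
  define A where "A m q = (if q m = p m then pd m f p else (f (hyb (Suc m) q) - f (hyb m q)) / (q m - p m))" for m q
  have hyb_Suc: "hyb (Suc m) q = (hyb m q)(m := q m)" for m q by (auto simp: hyb_def)
  have hyb_id: "hyb m q = (hyb m q)(m := p m)" for m q by (auto simp: hyb_def)
  have hybR: "hyb m q \<in> Rn n" if "q \<in> Rn n" for m q using that pR by (auto simp: Rn_def hyb_def)
  have tele: "f q - f p = (\<Sum>m<n. A m q * (q m - p m))" if q: "q \<in> Rn n" for q
  proof -
    have "f (hyb (Suc m) q) - f (hyb m q) = A m q * (q m - p m)" for m
    proof (cases "q m = p m")
      case True
      then have "hyb (Suc m) q = hyb m q" using hyb_Suc hyb_id by metis
      then show ?thesis using True by simp
    qed (simp add: A_def)
    then have "(\<Sum>m<n. A m q * (q m - p m)) = f (hyb n q) - f (hyb 0 q)"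
      using sum_lessThan_telescope[of "\<lambda>m. f (hyb m q)" n] by simp
    moreover have "hyb n q = q" by (rule Rn_eqI[OF hybR[OF q] q]) (simp add: hyb_def)
    moreover have "hyb 0 q = p" by (auto simp: hyb_def)
    ultimately show ?thesis by simp
  qed
  have lim: "((\<lambda>t. A m (c t)) \<longlongrightarrow> pd m f p) (at t0)" if m: "m < n" for m
  proof (rule tendstoI)
    fix e :: real assume e: "e > 0"
    obtain d where d: "d > 0" "\<And>q. q \<in> Rn n \<Longrightarrow> (\<And>i. i < n \<Longrightarrow> \<bar>q i - p i\<bar> < d) \<Longrightarrow> q \<in> U \<and> \<bar>pd m f q - pd m f p\<bar> < e"
      using continuous_on_box[OF U pU smooth_on_continuous[OF smooth_on_pd[OF f m]] e] by metis
    have A: "\<bar>A m q - pd m f p\<bar> < e" if q: "q \<in> Rn n" and qd: "\<And>i. i < n \<Longrightarrow> \<bar>q i - p i\<bar> < d" for q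
    proof (cases "q m = p m")
      case False
      let ?z = "\<lambda>t. (hyb m q)(m := t)"
      have z: "?z t \<in> U \<and> \<bar>pd m f (?z t) - pd m f p\<bar> < e" if "min (p m) (q m) \<le> t" "t \<le> max (p m) (q m)" for t
      proof (rule d(2))
        show "?z t \<in> Rn n" by (rule Rn_upd[OF hybR[OF q] m])
        fix i assume "i < n"
        show "\<bar>?z t i - p i\<bar> < d"
          using qd[OF \<open>i < n\<close>] qd[OF m] that d(1) by (auto simp: hyb_def)
      qed
      have "((\<lambda>t. f (?z t)) has_real_derivative pd m f (?z t)) (at t)" if "min (p m) (q m) \<le> t" "t \<le> max (p m) (q m)" for t
        using smooth_on_has_pd[OF f, of "?z t" m] z[OF that] m by simp
      from MVT_real[OF False[symmetric] this] obtain \<xi> where \<xi>: "min (p m) (q m) \<le> \<xi>" "\<xi> \<le> max (p m) (q m)"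
        "f (?z (q m)) - f (?z (p m)) = (q m - p m) * pd m f (?z \<xi>)" by metis
      have "A m q = pd m f (?z \<xi>)"
        using \<xi>(3) False hyb_Suc[of m q] hyb_id[of m q] by (simp add: A_def)
      then show ?thesis using z[OF \<xi>(1,2)] by simp
    qed (simp add: A_def e)
    have "eventually (\<lambda>t. \<bar>c t i - p i\<bar> < d) (at t0)" if "i < n" for i
    proof -
      have "((\<lambda>t. c t i) \<longlongrightarrow> p i) (at t0)"
        using DERIV_isCont[OF c[OF that]] by (simp add: isCont_def p_def)
      from tendstoD[OF this d(1)] show ?thesis by (simp add: dist_real_def)
    qed
    then have "eventually (\<lambda>t. \<forall>i\<in>{..<n}. \<bar>c t i - p i\<bar> < d) (at t0)"
      by (intro eventually_ball_finite) auto
    moreover have "eventually (\<lambda>t. c t \<in> Rn n) (at t0)" using R by (simp add: eventually_at_filter eventually_mono)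
    ultimately show "eventually (\<lambda>t. dist (A m (c t)) (pd m f p) < e) (at t0)"
      by eventually_elim (use A in \<open>auto simp: dist_real_def\<close>)
  qed
  have "((\<lambda>t. \<Sum>m<n. A m (c t) * ((c t m - c t0 m) / (t - t0))) \<longlongrightarrow> (\<Sum>m<n. pd m f p * c' m)) (at t0)"
    by (intro tendsto_sum tendsto_mult lim) (use c in \<open>auto simp: has_field_derivative_iff\<close>)
  moreover have "eventually (\<lambda>t. (\<Sum>m<n. A m (c t) * ((c t m - c t0 m) / (t - t0))) = (f (c t) - f (c t0)) / (t - t0)) (at t0)"
  proof -
    have "eventually (\<lambda>t. c t \<in> Rn n) (at t0)" using R by (simp add: eventually_at_filter eventually_mono)
    then show ?thesis
    proof eventually_elim
      case (elim t)
      then show ?case using tele[OF elim] by (simp add: p_def sum_divide_distrib)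
    qed
  qed
  ultimately show ?thesis
    unfolding has_field_derivative_iff p_def by (rule Lim_transform_eventually)
qed

text \<open>Schwarz's theorem. The second difference \<open>\<Delta>\<close> is symmetric in i and
  j, and two applications of the mean value theorem show that \<open>\<Delta> / h\<^sup>2\<close>
  tends to the mixed derivative in either order.\<close>

lemma pd_commute:
  assumes U: "openin (top_of_set (Rn n)) U" and f: "smooth_on n U f" and p: "p \<in> U" and ij: "i < n" "j < n"
  shows "pd i (pd j f) p = pd j (pd i f) p"
proof (cases "i = j")
  case False
  have pR: "p \<in> Rn n" using p U openin_subset by fastforce
  define \<Delta> where "\<Delta> i j h = f (p(i := p i + h, j := p j + h)) - f (p(i := p i + h)) - f (p(j := p j + h)) + f p" for i j h
  have half: "\<exists>d>0. \<forall>h. 0 < h \<and> h < d \<longrightarrow> \<bar>\<Delta> i j h / h\<^sup>2 - pd j (pd i f) p\<bar> < e"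
    if e: "e > 0" and ij: "i < n" "j < n" "i \<noteq> j" for e i j
  proof -
    obtain d where d: "d > 0" "\<And>q. q \<in> Rn n \<Longrightarrow> (\<And>i. i < n \<Longrightarrow> \<bar>q i - p i\<bar> < d) \<Longrightarrow>
        q \<in> U \<and> \<bar>pd j (pd i f) q - pd j (pd i f) p\<bar> < e"
      using continuous_on_box[OF U p smooth_on_continuous[OF smooth_on_pd[OF smooth_on_pd[OF f ij(1)] ij(2)]] e] by metis
    have "\<bar>\<Delta> i j h / h\<^sup>2 - pd j (pd i f) p\<bar> < e" if h: "0 < h" "h < d" for h
    proof -
      let ?z = "\<lambda>s t. p(i := s, j := t)"
      have z: "?z s t \<in> U \<and> \<bar>pd j (pd i f) (?z s t) - pd j (pd i f) p\<bar> < e"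
        if "p i \<le> s" "s \<le> p i + h" "p j \<le> t" "t \<le> p j + h" for s t
        using that h d(1) by (intro d(2) Rn_upd pR ij) auto
      have zj: "?z s (p j) = p(i := s)" for s using ij(3) by auto
      have tw: "?z s t = p(j := t, i := s)" for s t using ij(3) by (rule fun_upd_twist)
      have "((\<lambda>s. f (?z s (p j + h)) - f (?z s (p j))) has_real_derivative
          pd i f (?z s (p j + h)) - pd i f (?z s (p j))) (at s)" if "p i \<le> s" "s \<le> p i + h" for s
      proof (rule DERIV_diff)
        show "((\<lambda>s. f (?z s (p j + h))) has_real_derivative pd i f (?z s (p j + h))) (at s)"
          using smooth_on_has_pd[OF f, of "?z s (p j + h)" i] z[of s "p j + h"] that h ij unfolding tw by simp
        show "((\<lambda>s. f (?z s (p j))) has_real_derivative pd i f (?z s (p j))) (at s)"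
          using smooth_on_has_pd[OF f, of "?z s (p j)" i] z[of s "p j"] that h ij unfolding tw by simp
      qed
      from MVT2[OF _ this, of "p i" "p i + h"] obtain s where s: "p i < s" "s < p i + h"
        "f (?z (p i + h) (p j + h)) - f (?z (p i + h) (p j)) - (f (?z (p i) (p j + h)) - f (?z (p i) (p j)))
          = h * (pd i f (?z s (p j + h)) - pd i f (?z s (p j)))"
        using h by auto
      have "((\<lambda>t. pd i f (?z s t)) has_real_derivative pd j (pd i f) (?z s t)) (at t)" if "p j \<le> t" "t \<le> p j + h" for t
        using smooth_on_has_pd[OF smooth_on_pd[OF f ij(1)], of "?z s t" j] z[of s t] that s ij by simp
      from MVT2[OF _ this, of "p j" "p j + h"] obtain t where t: "p j < t" "t < p j + h"
        "pd i f (?z s (p j + h)) - pd i f (?z s (p j)) = h * pd j (pd i f) (?z s t)"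
        using h by auto
      have "\<Delta> i j h = h * (h * pd j (pd i f) (?z s t))"
        using s(3) t(3) ij(3) by (simp add: \<Delta>_def zj)
      then have "\<Delta> i j h / h\<^sup>2 = pd j (pd i f) (?z s t)" using h by (simp add: power2_eq_square)
      then show ?thesis using z[of s t] s t by simp
    qed
    then show ?thesis using d(1) by blast
  qed
  have sym: "\<Delta> j i h = \<Delta> i j h" for h
    using fun_upd_twist[OF False, of p "p i + h" "p j + h"] by (simp add: \<Delta>_def)
  show ?thesis
  proof (rule ccontr)
    assume neq: "\<not> ?thesis"
    define e where "e = \<bar>pd i (pd j f) p - pd j (pd i f) p\<bar> / 2"
    have e: "e > 0" using neq by (simp add: e_def)
    obtain d1 where d1: "d1 > 0" "\<And>h. 0 < h \<Longrightarrow> h < d1 \<Longrightarrow> \<bar>\<Delta> i j h / h\<^sup>2 - pd j (pd i f) p\<bar> < e"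
      using half[OF e ij False] by blast
    obtain d2 where d2: "d2 > 0" "\<And>h. 0 < h \<Longrightarrow> h < d2 \<Longrightarrow> \<bar>\<Delta> j i h / h\<^sup>2 - pd i (pd j f) p\<bar> < e"
      using half[OF e ij(2,1) False[symmetric]] by blast
    define h where "h = min d1 d2 / 2"
    have "0 < h" "h < d1" "h < d2" using d1 d2 by (auto simp: h_def)
    then have "\<bar>\<Delta> i j h / h\<^sup>2 - pd j (pd i f) p\<bar> < e" "\<bar>\<Delta> i j h / h\<^sup>2 - pd i (pd j f) p\<bar> < e"
      using d1(2) d2(2) sym by auto
    moreover have "\<bar>pd i (pd j f) p - pd j (pd i f) p\<bar> \<le> \<bar>\<Delta> i j h / h\<^sup>2 - pd j (pd i f) p\<bar> + \<bar>\<Delta> i j h / h\<^sup>2 - pd i (pd j f) p\<bar>"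
      using abs_triangle_ineq4[of "\<Delta> i j h / h\<^sup>2 - pd j (pd i f) p" "\<Delta> i j h / h\<^sup>2 - pd i (pd j f) p"] by simp
    moreover have "\<bar>pd i (pd j f) p - pd j (pd i f) p\<bar> = e + e" by (simp add: e_def)
    ultimately show False by linarith
  qed
qed simp

lemma bil_has_derivative:
  assumes "\<And>c. c < n \<Longrightarrow> ((\<lambda>t. a t c) has_real_derivative a' c) (at t0)"
    "\<And>c. c < n \<Longrightarrow> ((\<lambda>t. b t c) has_real_derivative b' c) (at t0)"
  shows "((\<lambda>t. bil n Q (a t) (b t)) has_real_derivative bil n Q a' (b t0) + bil n Q (a t0) b') (at t0)"
proof -
  have "((\<lambda>t. bil n Q (a t) (b t)) has_real_derivative
      (\<Sum>i<n. \<Sum>j<n. (a' i * b t0 j + b' j * a t0 i) * Q i j)) (at t0)"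
    unfolding bil_expand using assms by (intro DERIV_sum DERIV_cmult_right DERIV_mult) auto
  moreover have "(\<Sum>i<n. \<Sum>j<n. (a' i * b t0 j + b' j * a t0 i) * Q i j) = bil n Q a' (b t0) + bil n Q (a t0) b'"
    unfolding bil_expand sum.distrib[symmetric] by (intro sum.cong refl) (simp add: algebra_simps)
  ultimately show ?thesis by simp
qed

lemma bil_lin_left: "bil n Q (\<lambda>c. a c + s * b c) d = bil n Q a d + s * bil n Q b d"
  unfolding bil_expand sum_distrib_left sum.distrib[symmetric] by (intro sum.cong refl) (simp add: algebra_simps)

lemma bil_lin_right: "bil n Q d (\<lambda>c. a c + s * b c) = bil n Q d a + s * bil n Q d b"
  unfolding bil_expand sum_distrib_left sum.distrib[symmetric] by (intro sum.cong refl) (simp add: algebra_simps)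

section \<open>The connection of the quadratic metric as a bilinear map\<close>

context coords begin

text \<open>The gradient of F with respect to the flat metric, which is also the covariant
  derivative of the x-field along itself. For quadratic F it is linear in \<open>p\<close>.\<close>

definition Nv :: "(nat \<Rightarrow> real) \<Rightarrow> nat \<Rightarrow> real" where
  "Nv p c = dpot r dbl p (dual r c)"

definition Hf :: "(nat \<Rightarrow> real) \<Rightarrow> (nat \<Rightarrow> real) \<Rightarrow> real" where
  "Hf = bil n (hess r 2)"

definition Bf :: "(nat \<Rightarrow> real) \<Rightarrow> (nat \<Rightarrow> real) \<Rightarrow> real" where
  "Bf = bil n (g_flat r)"

text \<open>The metric at \<open>p\<close> on vectors: \<open>Hf p p\<close> is 2 F(p) by Euler's
  identity.\<close>

definition gf :: "(nat \<Rightarrow> real) \<Rightarrow> (nat \<Rightarrow> real) \<Rightarrow> (nat \<Rightarrow> real) \<Rightarrow> real" where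
  "gf p a b = Bf a b - Hf p p * (a (2 * r) * b (2 * r))"

text \<open>The Christoffel symbols as a bilinear map on vectors; \<open>Hf p b\<close> is the
  differential of F at \<open>p\<close> applied to \<open>b\<close>.\<close>

definition Gam :: "(nat \<Rightarrow> real) \<Rightarrow> (nat \<Rightarrow> real) \<Rightarrow> (nat \<Rightarrow> real) \<Rightarrow> nat \<Rightarrow> real" where
  "Gam p a b c = a (2 * r) * b (2 * r) * Nv p c - (a (2 * r) * Hf p b + b (2 * r) * Hf p a) * kd (Suc (2 * r)) c"

lemma Hf_sym: "Hf a b = Hf b a"
  unfolding Hf_def bil_expand by (subst sum.swap) (simp add: hess_sym[of r 2] mult_ac)

lemma Hf_dpot: "Hf a b = (\<Sum>i<n. a i * dpot r dbl b i)"
  by (simp add: Hf_def bil_hess)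

lemma Bf_dual: "Bf a b = (\<Sum>i<n. a i * b (dual r i))"
  by (simp add: Bf_def bil_g_flat)

lemma Bf_sym: "Bf a b = Bf b a"
  unfolding Bf_dual by (rule sum.reindex_bij_witness[of _ "dual r" "dual r"]) auto

lemma Bf_lin: "Bf (\<lambda>c. a c + s * b c) d = Bf a d + s * Bf b d"
  unfolding Bf_def by (rule bil_lin_left)

lemma Hf_lin: "Hf d (\<lambda>c. a c + s * b c) = Hf d a + s * Hf d b"
  unfolding Hf_def by (rule bil_lin_right)

lemma Bf_Nv: "Bf (Nv p) b = Hf p b"
proof -
  have "Bf (Nv p) b = (\<Sum>i<n. b i * dpot r dbl p i)"
    unfolding Bf_dual Nv_def by (rule sum.reindex_bij_witness[of _ "dual r" "dual r"]) auto
  then show ?thesis by (simp add: Hf_dpot[symmetric] Hf_sym)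
qed

lemma Bf_y: "Bf (kd (Suc (2 * r))) b = b (2 * r)"
  by (simp add: Bf_dual kd_sum)

lemma Hf_y: "Hf p (kd (Suc (2 * r))) = 0"
  unfolding Hf_sym[of p] by (simp add: Hf_dpot kd_sum)

lemma Nv_x: "Nv p (2 * r) = 0" by (simp add: Nv_def)

lemma Gam_x: "Gam p a b (2 * r) = 0" by (simp add: Gam_def Nv_x kd_def)

lemma Gam_sym: "Gam p a b = Gam p b a" by (rule ext) (simp add: Gam_def)

lemma gf_sym: "gf p a b = gf p b a" by (simp add: gf_def Bf_sym)

lemma gf_gM: "bil n (gM r sqr p) a b = gf p a b"
proof -
  have "2 * pot r sqr p = Hf p p" by (simp add: sum_dpot_self[symmetric] Hf_dpot mult.commute)
  then show ?thesis by (simp add: bil_gM gf_def Bf_dual mult.assoc)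
qed

lemma Bf_Gam: "Bf (\<lambda>c. a' c + Gam p u a c) b = Bf a' b + u (2 * r) * a (2 * r) * Hf p b
    - (u (2 * r) * Hf p a + a (2 * r) * Hf p u) * b (2 * r)"
proof -
  have *: "(\<lambda>c. a' c + Gam p u a c) = (\<lambda>c. (a' c + (u (2 * r) * a (2 * r)) * Nv p c) + (- (u (2 * r) * Hf p a + a (2 * r) * Hf p u)) * kd (Suc (2 * r)) c)"
    by (rule ext) (simp add: Gam_def algebra_simps)
  show ?thesis unfolding * Bf_lin Bf_Nv Bf_y by (simp add: algebra_simps)
qed

lemma Hf_Gam: "Hf p (\<lambda>c. a' c + Gam q u a c) = Hf p a' + u (2 * r) * a (2 * r) * Hf p (Nv q)"
proof -
  have "(\<lambda>c. a' c + Gam q u a c) = (\<lambda>c. (a' c + (u (2 * r) * a (2 * r)) * Nv q c) + (- (u (2 * r) * Hf q a + a (2 * r) * Hf q u)) * kd (Suc (2 * r)) c)"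
    by (rule ext) (simp add: Gam_def algebra_simps)
  then show ?thesis by (simp add: Hf_lin Hf_y)
qed

text \<open>Compatibility of metric and connection along a curve \<open>X\<close>: the derivatives
  of \<open>a\<close> and \<open>b\<close>, corrected by \<open>Gam\<close>, are their covariant
  derivatives along it.\<close>

lemma gf_metric:
  assumes X: "\<And>c. c < n \<Longrightarrow> ((\<lambda>t. X t c) has_real_derivative X' c) (at t0)"
    and a: "\<And>c. c < n \<Longrightarrow> ((\<lambda>t. a t c) has_real_derivative a' c) (at t0)"
    and b: "\<And>c. c < n \<Longrightarrow> ((\<lambda>t. b t c) has_real_derivative b' c) (at t0)"
  shows "((\<lambda>t. gf (X t) (a t) (b t)) has_real_derivative
     gf (X t0) (\<lambda>c. a' c + Gam (X t0) X' (a t0) c) (b t0) + gf (X t0) (a t0) (\<lambda>c. b' c + Gam (X t0) X' (b t0) c)) (at t0)"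
proof -
  let ?x = "2 * r"
  have d: "((\<lambda>t. gf (X t) (a t) (b t)) has_real_derivative (Bf a' (b t0) + Bf (a t0) b')
      - ((Hf X' (X t0) + Hf (X t0) X') * (a t0 ?x * b t0 ?x) + (a' ?x * b t0 ?x + b' ?x * a t0 ?x) * Hf (X t0) (X t0))) (at t0)"
    unfolding gf_def Bf_def Hf_def
    by (intro DERIV_diff DERIV_mult bil_has_derivative X a b xn)
  have e1: "gf (X t0) (\<lambda>c. a' c + Gam (X t0) X' (a t0) c) (b t0) = Bf a' (b t0) + X' ?x * a t0 ?x * Hf (X t0) (b t0)
     - (X' ?x * Hf (X t0) (a t0) + a t0 ?x * Hf (X t0) X') * b t0 ?x - Hf (X t0) (X t0) * (a' ?x * b t0 ?x)"
    unfolding gf_def Bf_Gam by (simp add: Gam_x)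
  have e2: "gf (X t0) (a t0) (\<lambda>c. b' c + Gam (X t0) X' (b t0) c) = Bf b' (a t0) + X' ?x * b t0 ?x * Hf (X t0) (a t0)
     - (X' ?x * Hf (X t0) (b t0) + b t0 ?x * Hf (X t0) X') * a t0 ?x - Hf (X t0) (X t0) * (b' ?x * a t0 ?x)"
    unfolding gf_sym[of _ "a t0"] unfolding gf_def Bf_Gam by (simp add: Gam_x)
  have "gf (X t0) (\<lambda>c. a' c + Gam (X t0) X' (a t0) c) (b t0) + gf (X t0) (a t0) (\<lambda>c. b' c + Gam (X t0) X' (b t0) c)
    = (Bf a' (b t0) + Bf (a t0) b')
      - ((Hf X' (X t0) + Hf (X t0) X') * (a t0 ?x * b t0 ?x) + (a' ?x * b t0 ?x + b' ?x * a t0 ?x) * Hf (X t0) (X t0))"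
    unfolding e1 e2 Hf_sym[of X' "X t0"] Bf_sym[of b' "a t0"] by (simp add: algebra_simps)
  then show ?thesis using d by simp
qed

lemma Gam_has_derivative:
  assumes X: "\<And>c. c < n \<Longrightarrow> ((\<lambda>t. X t c) has_real_derivative X' c) (at t0)"
    and a: "\<And>c. c < n \<Longrightarrow> ((\<lambda>t. a t c) has_real_derivative a' c) (at t0)"
    and b: "\<And>c. c < n \<Longrightarrow> ((\<lambda>t. b t c) has_real_derivative b' c) (at t0)"
  shows "((\<lambda>t. Gam (X t) (a t) (b t) c) has_real_derivative
     ((a' (2 * r) * b t0 (2 * r) + b' (2 * r) * a t0 (2 * r)) * Nv (X t0) c + Nv X' c * (a t0 (2 * r) * b t0 (2 * r)))
     - ((a' (2 * r) * Hf (X t0) (b t0) + (Hf X' (b t0) + Hf (X t0) b') * a t0 (2 * r))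
       + (b' (2 * r) * Hf (X t0) (a t0) + (Hf X' (a t0) + Hf (X t0) a') * b t0 (2 * r))) * kd (Suc (2 * r)) c) (at t0)"
proof -
  have N: "((\<lambda>t. Nv (X t) c) has_real_derivative Nv X' c) (at t0)"
    unfolding Nv_def using n by (intro dpot_has_derivative X) (auto intro!: derivative_eq_intros)
  show ?thesis unfolding Gam_def Hf_def
    by (intro DERIV_diff DERIV_mult DERIV_add DERIV_cmult_right bil_has_derivative N X a b xn)
qed

end

section \<open>Irreducibility in the quadratic case\<close>

lemma product_metric_cong:
  assumes prod: "product_metric n k h T" and k: "k < n"
    and h: "\<And>q a b. q \<in> T \<Longrightarrow> a < n \<Longrightarrow> b < n \<Longrightarrow> h q a b = h' q a b"
  shows "product_metric n k h' T"
  unfolding product_metric_def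
proof (intro conjI ballI allI impI)
  fix q a b assume "q \<in> T" "a < k" "k \<le> b \<and> b < n"
  then show "h' q a b = 0" "h' q b a = 0"
    using prod k h[of q a b] h[of q b a] unfolding product_metric_def by auto
next
  fix q q' a b assume "q \<in> T" "q' \<in> T" "\<forall>i<k. q i = q' i" "a < k" "b < k"
  moreover from this have "h q a b = h q' a b" using prod unfolding product_metric_def by blast
  ultimately show "h' q a b = h' q' a b" using k h[of q a b] h[of q' a b] by simp
next
  fix q q' a b assume "q \<in> T" "q' \<in> T" "\<forall>i. k \<le> i \<and> i < n \<longrightarrow> q i = q' i" "k \<le> a \<and> a < n \<and> k \<le> b \<and> b < n"
  moreover from this have "h q a b = h q' a b" using prod unfolding product_metric_def by blast
  ultimately show "h' q a b = h' q' a b" using h[of q a b] h[of q' a b] by simp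
qed

text \<open>A chart \<open>G\<close> with domain \<open>T\<close> in which the metric \<open>gM r sqr\<close> is a product of its first \<open>k\<close> and its
  remaining coordinates; \<open>JF\<close> is the inverse of the Jacobian of \<open>G\<close>.\<close>

locale product_chart = coords +
  fixes T :: "(nat \<Rightarrow> real) set" and G :: "(nat \<Rightarrow> real) \<Rightarrow> nat \<Rightarrow> real"
    and JF :: "(nat \<Rightarrow> real) \<Rightarrow> nat \<Rightarrow> nat \<Rightarrow> real" and k :: nat
  assumes T: "openin (top_of_set (Rn n)) T"
    and smooth: "\<And>c. c < n \<Longrightarrow> smooth_on n T (\<lambda>q. G q c)"
    and inv1: "\<And>q c d. q \<in> T \<Longrightarrow> c < n \<Longrightarrow> d < n \<Longrightarrow> (\<Sum>s<n. pd s (\<lambda>q. G q c) q * JF q s d) = kd c d"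
    and inv2: "\<And>q s t. q \<in> T \<Longrightarrow> s < n \<Longrightarrow> t < n \<Longrightarrow> (\<Sum>c<n. JF q s c * pd t (\<lambda>q. G q c) q) = kd s t"
    and k: "0 < k" "k < n"
    and prod: "product_metric n k (\<lambda>q a b. gf (G q) (\<lambda>c. pd a (\<lambda>q. G q c) q) (\<lambda>c. pd b (\<lambda>q. G q c) q)) T"
begin

text \<open>The coordinate fields of the chart as vector fields along \<open>G\<close>, written in
  the original coordinates. \<open>W i l\<close> below is the covariant derivative of field l in
  direction i, \<open>hh\<close> the metric in the chart, and \<open>TT\<close> its Christoffel
  symbols of the first kind.\<close>

definition G1 :: "nat \<Rightarrow> (nat \<Rightarrow> real) \<Rightarrow> nat \<Rightarrow> real" where
  "G1 i q c = pd i (\<lambda>q. G q c) q"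

definition G2 :: "nat \<Rightarrow> nat \<Rightarrow> (nat \<Rightarrow> real) \<Rightarrow> nat \<Rightarrow> real" where
  "G2 i j q c = pd i (\<lambda>q. G1 j q c) q"

definition W :: "nat \<Rightarrow> nat \<Rightarrow> (nat \<Rightarrow> real) \<Rightarrow> nat \<Rightarrow> real" where
  "W i l q c = G2 i l q c + Gam (G q) (G1 i q) (G1 l q) c"

definition hh :: "nat \<Rightarrow> nat \<Rightarrow> (nat \<Rightarrow> real) \<Rightarrow> real" where
  "hh l m q = gf (G q) (G1 l q) (G1 m q)"

definition TT :: "nat \<Rightarrow> nat \<Rightarrow> nat \<Rightarrow> (nat \<Rightarrow> real) \<Rightarrow> real" where
  "TT i l m q = gf (G q) (W i l q) (G1 m q)"

abbreviation "cls i \<equiv> i < k"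

section \<open>Koszul's formula in a product chart\<close>

lemma smooth1: "j < n \<Longrightarrow> c < n \<Longrightarrow> smooth_on n T (\<lambda>q. G1 j q c)"
  using smooth_on_pd[OF smooth] by (simp add: G1_def)

lemma smooth2: "i < n \<Longrightarrow> j < n \<Longrightarrow> c < n \<Longrightarrow> smooth_on n T (\<lambda>q. G2 i j q c)"
  using smooth_on_pd[OF smooth1] by (simp add: G2_def)

lemma dG: "q \<in> T \<Longrightarrow> i < n \<Longrightarrow> c < n \<Longrightarrow> ((\<lambda>t. G (q(i := t)) c) has_real_derivative G1 i q c) (at (q i))"
  using smooth_on_has_pd[OF smooth] by (simp add: G1_def)

lemma dG1: "q \<in> T \<Longrightarrow> i < n \<Longrightarrow> j < n \<Longrightarrow> c < n \<Longrightarrow> ((\<lambda>t. G1 j (q(i := t)) c) has_real_derivative G2 i j q c) (at (q i))"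
  using smooth_on_has_pd[OF smooth1] by (simp add: G2_def)

lemma dG2: "q \<in> T \<Longrightarrow> i < n \<Longrightarrow> j < n \<Longrightarrow> l < n \<Longrightarrow> c < n \<Longrightarrow>
    ((\<lambda>t. G2 j l (q(i := t)) c) has_real_derivative pd i (\<lambda>q. G2 j l q c) q) (at (q i))"
  using smooth_on_has_pd[OF smooth2] by simp

lemma G2_sym: "q \<in> T \<Longrightarrow> i < n \<Longrightarrow> j < n \<Longrightarrow> c < n \<Longrightarrow> G2 i j q c = G2 j i q c"
  using pd_commute[OF T smooth, of c q i j] by (simp add: G2_def G1_def)

lemma G3_sym: "q \<in> T \<Longrightarrow> i < n \<Longrightarrow> j < n \<Longrightarrow> l < n \<Longrightarrow> c < n \<Longrightarrow>
    pd i (\<lambda>q. G2 j l q c) q = pd j (\<lambda>q. G2 i l q c) q"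
  using pd_commute[OF T smooth1, of l c q i j] by (simp add: G2_def)

lemma gf_cong:
  assumes "\<And>c. c < n \<Longrightarrow> a c = a' c" "\<And>c. c < n \<Longrightarrow> b c = b' c"
  shows "gf p a b = gf p a' b'"
  unfolding gf_gM[symmetric] by (rule bil_cong) (use assms in auto)

lemma W_sym: "q \<in> T \<Longrightarrow> i < n \<Longrightarrow> l < n \<Longrightarrow> c < n \<Longrightarrow> W i l q c = W l i q c"
  unfolding W_def by (simp add: G2_sym[of q i l] Gam_sym[of _ "G1 i q"])

lemma TT_sym: "q \<in> T \<Longrightarrow> i < n \<Longrightarrow> l < n \<Longrightarrow> TT i l m q = TT l i m q"
  unfolding TT_def by (rule gf_cong) (auto simp: W_sym)

lemma dhh:
  assumes "q \<in> T" "i < n" "l < n" "m < n"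
  shows "((\<lambda>t. hh l m (q(i := t))) has_real_derivative TT i l m q + TT i m l q) (at (q i))"
proof -
  have "((\<lambda>t. gf (G (q(i := t))) (G1 l (q(i := t))) (G1 m (q(i := t)))) has_real_derivative
      gf (G (q(i := q i))) (\<lambda>c. G2 i l q c + Gam (G (q(i := q i))) (G1 i q) (G1 l (q(i := q i))) c) (G1 m (q(i := q i)))
    + gf (G (q(i := q i))) (G1 l (q(i := q i))) (\<lambda>c. G2 i m q c + Gam (G (q(i := q i))) (G1 i q) (G1 m (q(i := q i))) c)) (at (q i))"
    by (rule gf_metric) (use assms dG dG1 in auto)
  then show ?thesis
    unfolding hh_def fun_upd_triv W_def[abs_def, symmetric] TT_def by (simp add: gf_sym[of _ "G1 l q"] W_def[abs_def])
qed

lemma pd_hh: "q \<in> T \<Longrightarrow> i < n \<Longrightarrow> l < n \<Longrightarrow> m < n \<Longrightarrow> pd i (hh l m) q = TT i l m q + TT i m l q"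
  by (rule pd_eqI) (rule dhh)

lemma koszul:
  assumes "q \<in> T" "i < n" "l < n" "m < n"
  shows "2 * TT i l m q = pd i (hh l m) q + pd l (hh i m) q - pd m (hh i l) q"
  using assms TT_sym[of q i l m] TT_sym[of q i m l] TT_sym[of q l m i] by (simp add: pd_hh)

lemma hh_mixed: "q \<in> T \<Longrightarrow> l < n \<Longrightarrow> m < n \<Longrightarrow> cls l \<noteq> cls m \<Longrightarrow> hh l m q = 0"
  using prod unfolding product_metric_def hh_def G1_def by (cases "cls l") (auto simp: not_less)

lemma hh_const:
  assumes "q \<in> T" "q' \<in> T" "l < n" "m < n" "cls l = cls m" "\<And>i. i < n \<Longrightarrow> cls i = cls l \<Longrightarrow> q i = q' i"
  shows "hh l m q = hh l m q'"
proof (cases "cls l")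
  case True
  then have "\<forall>i<k. q i = q' i" using assms(6) k by auto
  then show ?thesis using prod assms True unfolding product_metric_def hh_def G1_def by blast
next
  case False
  then have "\<forall>i. k \<le> i \<and> i < n \<longrightarrow> q i = q' i" using assms(6) by auto
  then show ?thesis using prod assms False unfolding product_metric_def hh_def G1_def by (metis not_less)
qed

lemma line_in: "q \<in> T \<Longrightarrow> i < n \<Longrightarrow> eventually (\<lambda>t. q(i := t) \<in> T) (nhds (q i))"
  by (rule eventually_upd_in[OF T])

lemma deriv_ev_const:
  assumes "eventually (\<lambda>t. f t = c) (nhds x)"
  shows "(f has_real_derivative 0) (at x)"
proof -
  have "((\<lambda>t. c) has_real_derivative 0) (at x)" by simp
  then show ?thesis using DERIV_cong_ev[OF refl assms refl] by simp
qed

text \<open>If l and m belong to different factors the coefficient is 0 throughout; if they share a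
  factor and i does not, the coefficient does not depend on coordinate i.\<close>

lemma pd_hh_0:
  assumes "q \<in> T" "i < n" "l < n" "m < n" "\<not> (cls i = cls l \<and> cls l = cls m)"
  shows "pd i (hh l m) q = 0"
proof -
  have "eventually (\<lambda>t. hh l m (q(i := t)) = hh l m q) (nhds (q i))"
    using line_in[OF assms(1,2)]
  proof eventually_elim
    case (elim t)
    show ?case
    proof (cases "cls l = cls m")
      case True
      then show ?thesis using assms elim by (intro hh_const) auto
    qed (use assms elim hh_mixed in simp)
  qed
  then show ?thesis by (intro pd_eqI deriv_ev_const)
qed

lemma TT_0:
  assumes "q \<in> T" "i < n" "l < n" "m < n" "\<not> (cls i = cls l \<and> cls l = cls m)"
  shows "TT i l m q = 0"
  using koszul[OF assms(1-4)] pd_hh_0[of q i l m] pd_hh_0[of q l i m] pd_hh_0[of q m i l] assms by auto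

text \<open>The inverse Jacobian expresses every basis vector by the frame, and the metric is
  nondegenerate. The term in F affects only the pairing with the x-direction, so the y-component is
  read off last.\<close>

lemma nondegenerate:
  assumes q: "q \<in> T" and w: "\<And>m. m < n \<Longrightarrow> gf (G q) w (G1 m q) = 0" and c: "c < n"
  shows "w c = 0"
proof -
  have b: "gf (G q) w (kd b) = 0" if "b < n" for b
  proof -
    have "gf (G q) w (kd b) = gf (G q) w (\<lambda>c. \<Sum>m<n. JF q m b * G1 m q c)"
      using inv1[OF q _ that] by (intro gf_cong) (auto simp: G1_def mult.commute kd_def)
    also have "\<dots> = (\<Sum>m<n. JF q m b * gf (G q) w (G1 m q))"
      unfolding gf_gM[symmetric] by (rule bil_sum_right)
    finally show ?thesis using w by simp
  qed
  have g: "gf (G q) w (kd b) = w (dual r b) - Hf (G q) (G q) * (w (2 * r) * kd b (2 * r))" if "b < n" for b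
  proof -
    have "Bf w (kd b) = w (dual r b)" unfolding Bf_sym[of w] by (simp add: Bf_dual kd_sum that)
    then show ?thesis by (simp add: gf_def)
  qed
  have 1: "w c = 0" if "c < n" "c \<noteq> Suc (2 * r)" for c
    using b[of "dual r c"] g[of "dual r c"] that dual_eq_iff[of r c "2 * r"] by (simp add: kd_def)
  then show ?thesis using b[of "2 * r"] g[of "2 * r"] 1[of "2 * r"] c by (cases "c = Suc (2 * r)") auto
qed

lemma W_0: "q \<in> T \<Longrightarrow> i < n \<Longrightarrow> l < n \<Longrightarrow> cls i \<noteq> cls l \<Longrightarrow> c < n \<Longrightarrow> W i l q c = 0"
  by (rule nondegenerate[of q]) (auto simp: TT_0 TT_def[symmetric])

lemma dW:
  assumes "q \<in> T" "i < n" "j < n" "l < n" "c < n"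
  shows "((\<lambda>t. W i l (q(j := t)) c) has_real_derivative pd j (\<lambda>q. W i l q c) q) (at (q j))" (is ?th1)
    and "pd j (\<lambda>q. W i l q c) q = pd j (\<lambda>q. G2 i l q c) q +
     (((G2 j i q (2 * r) * G1 l q (2 * r) + G2 j l q (2 * r) * G1 i q (2 * r)) * Nv (G q) c
       + Nv (G1 j q) c * (G1 i q (2 * r) * G1 l q (2 * r)))
     - ((G2 j i q (2 * r) * Hf (G q) (G1 l q) + (Hf (G1 j q) (G1 l q) + Hf (G q) (G2 j l q)) * G1 i q (2 * r))
       + (G2 j l q (2 * r) * Hf (G q) (G1 i q) + (Hf (G1 j q) (G1 i q) + Hf (G q) (G2 j i q)) * G1 l q (2 * r))) * kd (Suc (2 * r)) c)"
    (is "_ = ?v")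
proof -
  have "((\<lambda>t. W i l (q(j := t)) c) has_real_derivative ?v) (at (q j))"
    unfolding W_def
    using DERIV_add[OF dG2[OF assms(1,3,2,4,5)] Gam_has_derivative[of "\<lambda>t. G (q(j := t))" "G1 j q" "q j"
       "\<lambda>t. G1 i (q(j := t))" "G2 j i q" "\<lambda>t. G1 l (q(j := t))" "G2 j l q" c]] assms dG dG1
    unfolding fun_upd_triv by auto
  then show "pd j (\<lambda>q. W i l q c) q = ?v" ?th1
    using pd_eqI[of "\<lambda>q. W i l q c" q j ?v] by simp_all
qed

text \<open>The commutator of covariant derivatives along \<open>G\<close>: symmetry of third
  derivatives removes every term that is not tensorial, and the right-hand side is the curvature
  operator of the original metric.\<close>

lemma ricci:
  assumes q: "q \<in> T" and lt: "i < n" "j < n" "l < n" "c < n"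
  defines "a \<equiv> G1 j q" and "b \<equiv> G1 i q" and "w \<equiv> G1 l q"
  shows "pd j (\<lambda>q. W i l q c) q + Gam (G q) a (W i l q) c
     - (pd i (\<lambda>q. W j l q c) q + Gam (G q) b (W j l q) c)
    = (a (2 * r) * Hf b w - b (2 * r) * Hf a w) * kd (Suc (2 * r)) c
      + w (2 * r) * (b (2 * r) * Nv a c - a (2 * r) * Nv b c)"
proof -
  let ?x = "2 * r"
  have Gx: "G2 j i q ?x = G2 i j q ?x" by (rule G2_sym) (use q lt in auto)
  have GH: "Hf (G q) (G2 j i q) = Hf (G q) (G2 i j q)"
    unfolding Hf_def by (rule bil_cong) (use G2_sym q lt in auto)
  have Wx: "W i l q ?x = G2 i l q ?x" for i l by (simp add: W_def Gam_x)
  have WH: "Hf (G q) (W i l q) = Hf (G q) (G2 i l q) + G1 i q ?x * G1 l q ?x * Hf (G q) (Nv (G q))" for i l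
    unfolding W_def by (rule Hf_Gam)
  show ?thesis
    unfolding dW(2)[OF q lt(1,2,3,4)] dW(2)[OF q lt(2,1,3,4)] Gam_def Wx WH
      G3_sym[OF q lt(2,1,3,4)] Gx GH a_def b_def w_def Hf_sym[of "G1 j q" "G1 i q"]
    by (simp add: algebra_simps)
qed

text \<open>Lowering the index of the curvature operator in \<open>ricci\<close>.\<close>

lemma gf_curvF:
  "gf p (\<lambda>c. (a (2 * r) * Hf b w - b (2 * r) * Hf a w) * kd (Suc (2 * r)) c
      + w (2 * r) * (b (2 * r) * Nv a c - a (2 * r) * Nv b c)) z = curvF n (2 * r) (hess r 2) a b w z"
proof -
  let ?x = "2 * r" and ?y = "Suc (2 * r)"
  have "(\<lambda>c. (a ?x * Hf b w - b ?x * Hf a w) * kd ?y c + w ?x * (b ?x * Nv a c - a ?x * Nv b c))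
     = (\<lambda>c. ((0 + (a ?x * Hf b w - b ?x * Hf a w) * kd ?y c) + (w ?x * b ?x) * Nv a c) + (- (w ?x * a ?x)) * Nv b c)"
    by (rule ext) (simp add: algebra_simps)
  moreover have "Bf (\<lambda>c. 0) z = 0" by (simp add: Bf_dual)
  ultimately have "gf p (\<lambda>c. (a ?x * Hf b w - b ?x * Hf a w) * kd ?y c + w ?x * (b ?x * Nv a c - a ?x * Nv b c)) z
    = (a ?x * Hf b w - b ?x * Hf a w) * z ?x + (w ?x * b ?x) * Hf a z - (w ?x * a ?x) * Hf b z"
    unfolding gf_def by (simp only: Bf_lin Bf_y Bf_Nv Nv_x) (simp add: kd_def)
  then show ?thesis by (simp add: curvF_def Hf_def algebra_simps)
qed

lemma pd_hh_const:
  assumes "q \<in> T" "q(j := t) \<in> T" "i < n" "j < n" "l < n" "m < n" "cls i = cls l" "cls l = cls m" "cls j \<noteq> cls i"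
  shows "pd i (hh l m) (q(j := t)) = pd i (hh l m) q"
proof -
  have ij: "i \<noteq> j" using assms by auto
  have "eventually (\<lambda>s. (q(j := t))(i := s) \<in> T) (nhds (q i))" using line_in[OF assms(2,3)] ij by simp
  moreover have "eventually (\<lambda>s. q(i := s) \<in> T) (nhds (q i))" by (rule line_in) (use assms in auto)
  ultimately have "eventually (\<lambda>s. hh l m (q(j := t, i := s)) = hh l m (q(i := s))) (nhds (q i))"
    by eventually_elim (use assms in \<open>auto intro!: hh_const\<close>)
  then show ?thesis using ij unfolding pd_def by (simp add: deriv_cong_ev)
qed

text \<open>For m in the factor of i, Koszul's formula involves only the metric of that factor,
  which ignores coordinate j; for m in the other factor the symbol is 0 along the whole
  line.\<close>

lemma TT_line_const:
  assumes q: "q \<in> T" and lt: "i < n" "j < n" "l < n" "m < n" and cl: "cls i \<noteq> cls j" "cls l = cls i"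
  shows "((\<lambda>t. TT i l m (q(j := t))) has_real_derivative 0) (at (q j))"
proof (rule deriv_ev_const[where c = "TT i l m q"])
  show "eventually (\<lambda>t. TT i l m (q(j := t)) = TT i l m q) (nhds (q j))"
    using line_in[OF q lt(2)]
  proof eventually_elim
    case (elim t)
    show ?case
    proof (cases "cls m = cls i")
      case True
      have "pd i (hh l m) (q(j := t)) = pd i (hh l m) q"
        by (rule pd_hh_const[OF q elim]) (use lt cl True in auto)
      moreover have "pd l (hh i m) (q(j := t)) = pd l (hh i m) q"
        by (rule pd_hh_const[OF q elim]) (use lt cl True in auto)
      moreover have "pd m (hh i l) (q(j := t)) = pd m (hh i l) q"
        by (rule pd_hh_const[OF q elim]) (use lt cl True in auto)
      ultimately have "2 * TT i l m (q(j := t)) = 2 * TT i l m q"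
        unfolding koszul[OF elim lt(1,3,4)] koszul[OF q lt(1,3,4)] by (simp only:)
      then show ?thesis by simp
    next
      case False
      then show ?thesis using TT_0[OF elim lt(1,3,4)] TT_0[OF q lt(1,3,4)] cl by auto
    qed
  qed
qed

text \<open>The field \<open>W i l\<close> is tangent to the factor of i: its component
  \<open>v'\<close> along the other factor is orthogonal to the whole frame, hence 0. The field
  \<open>W j m\<close> either vanishes or is orthogonal to the factor of i.\<close>

lemma W_orthogonal:
  assumes q: "q \<in> T" and lt: "i < n" "j < n" "l < n" "m < n" and cl: "cls i \<noteq> cls j" "cls l = cls i"
  shows "gf (G q) (W i l q) (W j m q) = 0"
proof (cases "cls m = cls j")
  case False
  then have "gf (G q) (W i l q) (W j m q) = gf (G q) (W i l q) (\<lambda>c. 0)"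
    using W_0[OF q lt(2,4)] by (intro gf_cong) auto
  then show ?thesis by (simp add: gf_def Bf_dual)
next
  case True
  define u where "u s = (\<Sum>d<n. JF q s d * W i l q d)" for s
  define v where "v s = (if cls s = cls i then u s else 0)" for s
  define v' where "v' s = (if cls s = cls i then 0 else u s)" for s
  have Wu: "W i l q c = (\<Sum>s<n. u s * G1 s q c)" if "c < n" for c
  proof -
    have "(\<Sum>s<n. u s * G1 s q c) = (\<Sum>s<n. G1 s q c * (\<Sum>d<n. W i l q d * JF q s d))"
      by (simp add: u_def mult.commute)
    also have "\<dots> = (\<Sum>d<n. W i l q d * (\<Sum>s<n. G1 s q c * JF q s d))" by (rule sum_swap_mult)
    also have "\<dots> = W i l q c" using inv1[OF q that] kd_sum(2)[OF that] by (simp add: G1_def)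
    finally show ?thesis by simp
  qed
  have lin: "gf (G q) (\<lambda>c. \<Sum>s<n. z s * G1 s q c) b = (\<Sum>s<n. z s * gf (G q) (G1 s q) b)" for z b
    unfolding gf_gM[symmetric] by (rule bil_sum_left)
  have "gf (G q) (\<lambda>c. \<Sum>s<n. v' s * G1 s q c) (G1 m' q) = 0" if m': "m' < n" for m'
  proof (cases "cls m' = cls i")
    case True
    then show ?thesis unfolding lin v'_def using hh_mixed[OF q _ m'] by (auto simp: hh_def intro!: sum.neutral)
  next
    case False
    have "gf (G q) (W i l q) (G1 m' q) = gf (G q) (\<lambda>c. \<Sum>s<n. u s * G1 s q c) (G1 m' q)"
      by (rule gf_cong) (use Wu in auto)
    also have "\<dots> = gf (G q) (\<lambda>c. \<Sum>s<n. v' s * G1 s q c) (G1 m' q)"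
      unfolding lin by (rule sum.cong) (use False hh_mixed[OF q _ m'] in \<open>auto simp: v'_def hh_def\<close>)
    finally show ?thesis using TT_0[OF q lt(1,3) m'] False cl by (auto simp: TT_def)
  qed
  then have v'0: "(\<Sum>s<n. v' s * G1 s q c) = 0" if "c < n" for c
    using nondegenerate[OF q _ that, of "\<lambda>c. \<Sum>s<n. v' s * G1 s q c"] by blast
  have "W i l q c = (\<Sum>s<n. v s * G1 s q c)" if "c < n" for c
  proof -
    have "W i l q c = (\<Sum>s<n. v s * G1 s q c) + (\<Sum>s<n. v' s * G1 s q c)"
      unfolding Wu[OF that] sum.distrib[symmetric] by (rule sum.cong) (auto simp: v_def v'_def)
    then show ?thesis using v'0[OF that] by simp
  qed
  then have "gf (G q) (W i l q) (W j m q) = gf (G q) (\<lambda>c. \<Sum>s<n. v s * G1 s q c) (W j m q)"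
    by (intro gf_cong) auto
  also have "\<dots> = (\<Sum>s<n. v s * TT j m s q)"
    unfolding lin TT_def by (simp add: gf_sym[of _ "G1 _ q"])
  also have "\<dots> = 0"
    by (rule sum.neutral) (use TT_0[OF q lt(2,4)] cl True in \<open>auto simp: v_def\<close>)
  finally show ?thesis .
qed

text \<open>Since \<open>W j l\<close> vanishes identically, the curvature operator on field l is
  the j-derivative of \<open>W i l\<close>. Its pairing with field m is the j-derivative of
  \<open>TT i l m\<close>, which is 0, minus the pairing of \<open>W i l\<close> with
  \<open>W j m\<close>, also 0.\<close>

lemma curvature_mixed_aux:
  assumes q: "q \<in> T" and lt: "i < n" "j < n" "l < n" "m < n" and cl: "cls i \<noteq> cls j" "cls l = cls i"
  shows "curvF n (2 * r) (hess r 2) (G1 j q) (G1 i q) (G1 l q) (G1 m q) = 0"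
proof -
  let ?v = "\<lambda>c. pd j (\<lambda>q. W i l q c) q + Gam (G q) (G1 j q) (W i l q) c"
  have W0: "W j l q' c = 0" if "q' \<in> T" "c < n" for q' c
    using W_0[OF that(1) lt(2,3)] cl that by auto
  have pd0: "pd i (\<lambda>q. W j l q c) q = 0" if "c < n" for c
  proof (intro pd_eqI deriv_ev_const)
    show "eventually (\<lambda>t. W j l (q(i := t)) c = 0) (nhds (q i))"
      using line_in[OF q lt(1)] by eventually_elim (use W0 that in auto)
  qed
  have Gam0: "Gam (G q) (G1 i q) (W j l q) c = 0" for c
  proof -
    have "Hf (G q) (W j l q) = Hf (G q) (\<lambda>c. 0)"
      unfolding Hf_def by (rule bil_cong) (use W0 q in auto)
    then have "Hf (G q) (W j l q) = 0" by (simp add: Hf_def bil_def)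
    then show ?thesis using W0[OF q xn] by (simp add: Gam_def)
  qed
  have v: "gf (G q) ?v (G1 m q) = curvF n (2 * r) (hess r 2) (G1 j q) (G1 i q) (G1 l q) (G1 m q)"
    unfolding gf_curvF[where p = "G q", symmetric]
    using ricci[OF q lt(1-3)] pd0 Gam0 by (intro gf_cong) auto
  have "((\<lambda>t. gf (G (q(j := t))) (W i l (q(j := t))) (G1 m (q(j := t)))) has_real_derivative
     gf (G (q(j := q j))) (\<lambda>c. pd j (\<lambda>q. W i l q c) q + Gam (G (q(j := q j))) (G1 j q) (W i l (q(j := q j))) c) (G1 m (q(j := q j)))
     + gf (G (q(j := q j))) (W i l (q(j := q j))) (\<lambda>c. G2 j m q c + Gam (G (q(j := q j))) (G1 j q) (G1 m (q(j := q j))) c)) (at (q j))"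
    by (rule gf_metric) (use q lt dG dG1 dW(1) in auto)
  then have "((\<lambda>t. TT i l m (q(j := t))) has_real_derivative gf (G q) ?v (G1 m q) + gf (G q) (W i l q) (W j m q)) (at (q j))"
    unfolding fun_upd_triv TT_def W_def[of j m, symmetric] .
  from DERIV_unique[OF this TT_line_const[OF q lt cl]] show ?thesis
    using W_orthogonal[OF q lt cl] v by simp
qed

lemma curvature_mixed:
  assumes q: "q \<in> T" and lt: "i < n" "j < n" "l < n" "m < n" and cl: "cls i \<noteq> cls j"
  shows "curvF n (2 * r) (hess r 2) (G1 j q) (G1 i q) (G1 l q) (G1 m q) = 0"
proof (cases "cls l = cls i")
  case True
  then show ?thesis by (rule curvature_mixed_aux[OF q lt cl])
next
  case False
  have "curvF n (2 * r) (hess r 2) (G1 i q) (G1 j q) (G1 l q) (G1 m q) = 0"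
    by (rule curvature_mixed_aux[OF q lt(2,1,3,4)]) (use cl False in auto)
  then show ?thesis by (subst curvF_skew) simp
qed

text \<open>The spans of the two parts of the frame at one point satisfy the hypotheses of
  \<open>curvature_irreducible\<close>, yet both are nonzero because 0 < k < n.\<close>

lemma contradiction: assumes q: "q \<in> T" shows False
proof -
  define E where "E b c s = (if cls s = b then G1 s q c else 0)" for b c s
  define V where "V b = range (\<lambda>u c. \<Sum>s<n. u s * E b c s)" for b
  have frame: "w c = (\<Sum>s<n. (\<Sum>d<n. JF q s d * w d) * G1 s q c)" if "c < n" for w c
  proof -
    have "(\<Sum>s<n. (\<Sum>d<n. JF q s d * w d) * G1 s q c) = (\<Sum>s<n. G1 s q c * (\<Sum>d<n. w d * JF q s d))"
      by (simp add: mult.commute)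
    also have "\<dots> = (\<Sum>d<n. w d * (\<Sum>s<n. G1 s q c * JF q s d))" by (rule sum_swap_mult)
    also have "\<dots> = w c" using inv1[OF q that] kd_sum(2)[OF that] by (simp add: G1_def)
    finally show ?thesis by simp
  qed
  have "(\<forall>a\<in>V True. \<forall>i<n. a i = 0) \<or> (\<forall>b\<in>V False. \<forall>i<n. b i = 0)"
  proof (rule curvature_irreducible[where c = 2 and \<kappa> = "- Hf (G q) (G q)"])
    show "\<exists>a\<in>V True. \<exists>b\<in>V False. \<forall>i<n. w i = a i + b i" for w
    proof -
      define u where "u s = (\<Sum>d<n. JF q s d * w d)" for s
      have "w c = (\<Sum>s<n. u s * E True c s) + (\<Sum>s<n. u s * E False c s)" if "c < n" for c
        unfolding frame[OF that, of w] sum.distrib[symmetric] u_def by (rule sum.cong) (auto simp: E_def)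
      moreover have "(\<lambda>c. \<Sum>s<n. u s * E b c s) \<in> V b" for b by (auto simp: V_def)
      ultimately show ?thesis
        by (intro bexI[of _ "\<lambda>c. \<Sum>s<n. u s * E True c s"] bexI[of _ "\<lambda>c. \<Sum>s<n. u s * E False c s"]) auto
    qed
    show "(\<Sum>i<n. a i * b (dual r i)) + - Hf (G q) (G q) * a (2 * r) * b (2 * r) = 0" if "a \<in> V True" "b \<in> V False" for a b
    proof -
      from that obtain u v where ab: "a = (\<lambda>c. \<Sum>s<n. u s * E True c s)" "b = (\<lambda>c. \<Sum>s<n. v s * E False c s)"
        unfolding V_def by blast
      have "gf (G q) (\<lambda>c. E True c s) (\<lambda>c. E False c t) = 0" if "s < n" "t < n" for s t
      proof (cases "cls s \<and> \<not> cls t")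
        case True
        then show ?thesis using hh_mixed[OF q that] by (simp add: E_def hh_def)
      next
        case False
        then show ?thesis by (auto simp: E_def gf_def Bf_dual)
      qed
      then have "gf (G q) a b = 0"
        unfolding ab gf_gM[symmetric] bil_sum_left bil_sum_right by simp
      then show ?thesis by (simp add: gf_def Bf_dual mult.assoc)
    qed
    show "curvF n (2 * r) (hess r 2) a b w w' = 0" if "a \<in> V True" "b \<in> V False" for a b w w'
    proof -
      from that obtain u v where ab: "a = (\<lambda>c. \<Sum>s<n. u s * E True c s)" "b = (\<lambda>c. \<Sum>s<n. v s * E False c s)"
        unfolding V_def by blast
      have z: "curvF n (2 * r) (hess r 2) (\<lambda>c. E True c s) (\<lambda>c. E False c t) (G1 l q) (G1 m q) = 0"
        if "s < n" "t < n" "l < n" "m < n" for s t l m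
      proof (cases "cls s \<and> \<not> cls t")
        case True
        then show ?thesis using curvature_mixed[OF q that(2,1,3,4)] by (simp add: E_def)
      next
        case False
        then have "(\<lambda>c. E True c s) = (\<lambda>c. 0) \<or> (\<lambda>c. E False c t) = (\<lambda>c. 0)" by (auto simp: E_def)
        then show ?thesis using curvF_zero[OF xn, of "\<lambda>c. 0"] by auto
      qed
      have "curvF n (2 * r) (hess r 2) a b w w' = curvF n (2 * r) (hess r 2) a b
         (\<lambda>c. \<Sum>s<n. (\<Sum>d<n. JF q s d * w d) * G1 s q c) (\<lambda>c. \<Sum>s<n. (\<Sum>d<n. JF q s d * w' d) * G1 s q c)"
        by (rule curvF_cong) (use frame in auto)
      also have "\<dots> = 0" unfolding ab curvF_sum using z by simp
      finally show ?thesis .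
    qed
  qed simp
  \<comment> \<open>Index 0 lies in the first factor and index k in the second, so whichever span
    vanishes contains a frame field; that field would be 0 against the invertibility of the
    Jacobian.\<close>
  then obtain s where s: "s < n" and V0: "\<And>a c. a \<in> V (cls s) \<Longrightarrow> c < n \<Longrightarrow> a c = 0"
  proof
    assume "\<forall>a\<in>V True. \<forall>i<n. a i = 0"
    then show ?thesis using that[of 0] k by auto
  next
    assume "\<forall>a\<in>V False. \<forall>i<n. a i = 0"
    then show ?thesis using that[of k] k by auto
  qed
  have "G1 s q = (\<lambda>c. \<Sum>t<n. kd s t * E (cls s) c t)" by (simp add: kd_sum s E_def)
  then have "G1 s q \<in> V (cls s)" unfolding V_def by (intro image_eqI[where x = "kd s"]) simp_all
  from V0[OF this] have "(\<Sum>c<n. JF q s c * G1 s q c) = 0" by simp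
  then show False using inv2[OF q s s] by (simp add: G1_def kd_def)
qed

end

section \<open>From a local product decomposition to a product chart\<close>

context coords begin

lemma irreducible_mfd_sqr: "irreducible_mfd n (gM r sqr)"
  unfolding irreducible_mfd_def locally_reducible_def
proof
  assume "\<exists>P\<in>Rn n. \<exists>U T F h k. 0 < k \<and> k < n \<and> P \<in> U \<and>
      openin (top_of_set (Rn n)) U \<and> openin (top_of_set (Rn n)) T \<and>
      isometry_betw n (gM r sqr) h U T F \<and> product_metric n k h T"
  then obtain P U T F h k where k: "0 < k" "k < n" and P: "P \<in> U"
    and U: "openin (top_of_set (Rn n)) U" and T: "openin (top_of_set (Rn n)) T"
    and iso: "isometry_betw n (gM r sqr) h U T F" and prod: "product_metric n k h T" by blast
  from iso have diffeo: "diffeo_betw n U T F"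
    and g: "\<And>p a b. p \<in> U \<Longrightarrow> a < n \<Longrightarrow> b < n \<Longrightarrow> (\<Sum>i<n. \<Sum>j<n. Jac F p i a * Jac F p j b * h (F p) i j) = gM r sqr p a b"
    unfolding isometry_betw_def by auto
  have F: "smooth_map_on n U F" "F ` U = T" using diffeo by (simp_all add: diffeo_betw_def)
  obtain G where "smooth_map_on n T G \<and> G ` T = U \<and> (\<forall>p\<in>U. G (F p) = p) \<and> (\<forall>q\<in>T. F (G q) = q)"
    using diffeo unfolding diffeo_betw_def by (elim conjE exE) (rule that, simp)
  then have G: "smooth_map_on n T G" "G ` T = U"
    and GF: "\<And>p. p \<in> U \<Longrightarrow> G (F p) = p" and FG: "\<And>q. q \<in> T \<Longrightarrow> F (G q) = q"
    by simp_all
  have GU: "G q \<in> U" if "q \<in> T" for q using G(2) that by auto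
  have FT: "F p \<in> T" if "p \<in> U" for p using F(2) that by auto
  \<comment> \<open>The chain rule for a composition that is the identity, stated for general maps
    because it is needed for both orders of \<open>F\<close> and \<open>G\<close>.\<close>
  have comp: "(\<Sum>d<n. pd d (\<lambda>p. f p i) (g q) * pd j (\<lambda>q. g q d) q) = kd i j"
    if U: "openin (top_of_set (Rn n)) U" and T: "openin (top_of_set (Rn n)) T"
      and f: "smooth_map_on n U f" and g: "smooth_map_on n T g"
      and gU: "\<And>q. q \<in> T \<Longrightarrow> g q \<in> U" and fg: "\<And>q. q \<in> T \<Longrightarrow> f (g q) = q" and q: "q \<in> T" and ij: "i < n" "j < n"
    for U T :: "(nat \<Rightarrow> real) set" and f g q i j
  proof -
    have ev: "eventually (\<lambda>t. q(j := t) \<in> T) (nhds (q j))" by (rule eventually_upd_in[OF T q ij(2)])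
    have "((\<lambda>t. f (g (q(j := t))) i) has_real_derivative (\<Sum>d<n. pd d (\<lambda>p. f p i) (g (q(j := q j))) * pd j (\<lambda>q. g q d) q)) (at (q j))"
    proof (rule pd_chain_rule[OF U, of "\<lambda>p. f p i" "\<lambda>t. g (q(j := t))" "q j"])
      show "smooth_on n U (\<lambda>p. f p i)" using f ij by (auto simp: smooth_map_on_def)
      show "g (q(j := q j)) \<in> U" using gU q by simp
      show "eventually (\<lambda>t. g (q(j := t)) \<in> Rn n) (nhds (q j))"
        using ev by eventually_elim (use g in \<open>auto simp: smooth_map_on_def\<close>)
      show "((\<lambda>t. g (q(j := t)) d) has_real_derivative pd j (\<lambda>q. g q d) q) (at (q j))" if "d < n" for d
        by (rule smooth_on_has_pd[of n T "\<lambda>q. g q d"]) (use g that q ij in \<open>auto simp: smooth_map_on_def\<close>)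
    qed
    moreover have "((\<lambda>t. f (g (q(j := t))) i) has_real_derivative kd j i) (at (q j))"
    proof -
      have "eventually (\<lambda>t. f (g (q(j := t))) i = (q(j := t)) i) (nhds (q j))"
        using ev by eventually_elim (use fg in simp)
      from DERIV_cong_ev[OF refl this refl, THEN iffD2, OF fun_upd_coord_deriv] show ?thesis .
    qed
    ultimately have "(\<Sum>d<n. pd d (\<lambda>p. f p i) (g (q(j := q j))) * pd j (\<lambda>q. g q d) q) = kd j i"
      by (rule DERIV_unique)
    then show ?thesis by (simp add: kd_def)
  qed
  define JF where "JF q s d = Jac F (G q) s d" for q s d
  let ?G1 = "\<lambda>i q c. pd i (\<lambda>q. G q c) q"
  have inv1: "(\<Sum>s<n. ?G1 s q c * JF q s d) = kd c d" if "q \<in> T" "c < n" "d < n" for q c d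
    using comp[OF T U G(1) F(1) FT GF GU[OF that(1)] that(2,3)] FG[OF that(1)] by (simp add: JF_def Jac_def)
  have inv2: "(\<Sum>c<n. JF q s c * ?G1 t q c) = kd s t" if "q \<in> T" "s < n" "t < n" for q s t
    using comp[OF U T F(1) G(1) GU FG that] by (simp add: JF_def Jac_def)
  \<comment> \<open>Expresses the product metric as the pullback of the original one under
    \<open>G\<close>, so its differentiability comes from that of \<open>G\<close>.\<close>
  have h: "h q a b = gf (G q) (?G1 a q) (?G1 b q)" if q: "q \<in> T" and ab: "a < n" "b < n" for q a b
  proof -
    have gM: "gM r sqr (G q) c d = bil n (h q) (\<lambda>i. JF q i c) (\<lambda>i. JF q i d)" if "c < n" "d < n" for c d
      using g[OF GU[OF q] that] FG[OF q] by (simp add: bil_expand JF_def)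
    have "gf (G q) (?G1 a q) (?G1 b q) = (\<Sum>c<n. ?G1 a q c * (\<Sum>d<n. ?G1 b q d * bil n (h q) (\<lambda>i. JF q i c) (\<lambda>i. JF q i d)))"
      unfolding gf_gM[symmetric] bil_def[of n "gM r sqr (G q)"] by (intro sum.cong refl arg_cong2[where f = "(*)"]) (auto simp: gM)
    also have "\<dots> = bil n (h q) (\<lambda>i. \<Sum>c<n. ?G1 a q c * JF q i c) (\<lambda>i. \<Sum>d<n. ?G1 b q d * JF q i d)"
      unfolding bil_sum_left bil_sum_right ..
    also have "\<dots> = bil n (h q) (\<lambda>i. kd i a) (\<lambda>i. kd i b)"
      by (rule bil_cong) (use inv2[OF q _ ab(1)] inv2[OF q _ ab(2)] in \<open>auto simp: mult.commute\<close>)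
    also have "\<dots> = h q a b" by (simp add: bil_def kd_sum ab)
    finally show ?thesis by simp
  qed
  have "product_chart r n T G JF k"
  proof (unfold_locales)
    show "smooth_on n T (\<lambda>q. G q c)" if "c < n" for c using G(1) that by (auto simp: smooth_map_on_def)
    show "product_metric n k (\<lambda>q a b. gf (G q) (?G1 a q) (?G1 b q)) T"
      by (rule product_metric_cong[OF prod k(2) h])
  qed (use T inv1 inv2 k in auto)
  then show False using product_chart.contradiction FT[OF P] by blast
qed

end

theorem theorem1p5:
  fixes r :: nat and \<psi> :: "real \<Rightarrow> real"
  assumes r2: "r \<ge> 2"
    and smooth: "\<forall>k x. ((deriv ^^ k) \<psi>) differentiable (at x)"
    and pos2: "\<forall>x. (deriv ^^ 2) \<psi> x > 0"
  shows
    "(geod_complete (2 * r + 2) (gM r \<psi>))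
   \<and> (\<forall>P\<in>Rn (2 * r + 2).
       diffeo_betw (2 * r + 2) (Rn (2 * r + 2)) (Rn (2 * r + 2)) (exp_map (2 * r + 2) (gM r \<psi>) P))
   \<and> (\<forall>p\<in>Rn (2 * r + 2). \<forall>a<2 * r + 2. \<forall>b<2 * r + 2. \<forall>c<2 * r + 2. \<forall>d<2 * r + 2.
       Rt (2 * r + 2) (gM r \<psi>) p [a, b, c, d]
         = curvQ (xI r) (\<lambda>a b. Qur r ((deriv ^^ 2) \<psi> (p (uI r r))) a b + Qchain r a b) a b c d)
   \<and> (\<forall>p\<in>Rn (2 * r + 2). \<forall>a<2 * r + 2. \<forall>b<2 * r + 2. \<forall>c<2 * r + 2. \<forall>d<2 * r + 2. \<forall>e<2 * r + 2.
       nablaR (2 * r + 2) (gM r \<psi>) 1 p [a, b, c, d, e]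
         = (if e = uI r r then curvQ (xI r) (Qur r ((deriv ^^ 3) \<psi> (p (uI r r)))) a b c d else 0))
   \<and> (is_model (2 * r + 2) (g_flat r) [AU r] (gM r \<psi>) \<and> irreducible_model (2 * r + 2) (g_flat r) (AU r))
   \<and> (\<psi> = (\<lambda>t. t ^ 2) \<longrightarrow>
       symmetric_space (2 * r + 2) (gM r \<psi>) \<and> irreducible_mfd (2 * r + 2) (gM r \<psi>))
   \<and> ((\<forall>x. (deriv ^^ 3) \<psi> x > 0) \<longrightarrow>
       is_model (2 * r + 2) (g_flat r) [AU r, AU1 r] (gM r \<psi>) \<and> \<not> curv_hom (2 * r + 2) (gM r \<psi>) 2)"
proof -
  interpret coords r "2 * r + 2" by unfold_locales (use r2 in auto)
  \<comment> \<open>The tower of derivatives of \<open>\<psi>\<close>, in the form required by the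
    class \<open>sm\<close>.\<close>
  define H where "H k = (deriv ^^ k) \<psi>" for k
  have H: "\<forall>j x. (H j has_real_derivative H (Suc j) x) (at x)"
    using smooth by (simp add: H_def DERIV_deriv_iff_real_differentiable)
  have H0: "H 0 = \<psi>" by (simp add: H_def)
  have Suc: "Suc 0 = 1" "Suc 1 = 2" "Suc 2 = 3" "Suc 3 = 4" by simp_all
  have D: "(\<psi> has_real_derivative H 1 x) (at x)" "(H 1 has_real_derivative H 2 x) (at x)"
    "(H 2 has_real_derivative H 3 x) (at x)" "(H 3 has_real_derivative H 4 x) (at x)" for x
    using H[rule_format, of 0 x] H[rule_format, of 1 x] H[rule_format, of 2 x] H[rule_format, of 3 x]
    by (simp_all only: H0 Suc)
  have cont: "continuous_on UNIV (H 1)"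
    by (rule DERIV_continuous_on[where D = "H 2"]) (use D(2) has_field_derivative_at_within in blast)
  have pos: "H 2 x > 0" for x using pos2 by (simp add: H_def)
  have Q: "hess r c = (\<lambda>a b. Qur r c a b + Qchain r a b)" for c by (simp add: fun_eq_iff hess_def)
  have p1: "geod_complete (2 * r + 2) (gM r \<psi>)" by (rule geod_complete_gM[OF D(1) cont])
  have p2: "diffeo_betw (2 * r + 2) (Rn (2 * r + 2)) (Rn (2 * r + 2)) (exp_map (2 * r + 2) (gM r \<psi>) P)"
    if "P \<in> Rn (2 * r + 2)" for P
    using exp_diffeo[OF H that] by (simp add: H0)
  have p3: "Rt (2 * r + 2) (gM r \<psi>) p [a, b, c, d]
      = curvQ (xI r) (\<lambda>a b. Qur r ((deriv ^^ 2) \<psi> (p (uI r r))) a b + Qchain r a b) a b c d"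
    if "a < 2 * r + 2" "b < 2 * r + 2" "c < 2 * r + 2" "d < 2 * r + 2" for p a b c d
    using Rt_gM[OF D(1,2) that, of p] unfolding Q xI_def uI_def H_def .
  have p4: "nablaR (2 * r + 2) (gM r \<psi>) 1 p [a, b, c, d, e]
      = (if e = uI r r then curvQ (xI r) (Qur r ((deriv ^^ 3) \<psi> (p (uI r r)))) a b c d else 0)"
    if "a < 2 * r + 2" "b < 2 * r + 2" "c < 2 * r + 2" "d < 2 * r + 2" "e < 2 * r + 2" for p a b c d e
    using nablaR1_gM[OF D(1-3) that, of p] unfolding xI_def uI_def H_def .
  have p5: "is_model (2 * r + 2) (g_flat r) [AU r] (gM r \<psi>)" by (rule is_model_0[OF D(1,2) pos])
  have p6: "\<psi> = sqr \<Longrightarrow> symmetric_space (2 * r + 2) (gM r \<psi>)" "\<psi> = sqr \<Longrightarrow> irreducible_mfd (2 * r + 2) (gM r \<psi>)"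
    by (simp_all only: symmetric_space_sqr irreducible_mfd_sqr)
  have p7: "is_model (2 * r + 2) (g_flat r) [AU r, AU1 r] (gM r \<psi>)" "\<not> curv_hom (2 * r + 2) (gM r \<psi>) 2"
    if "\<forall>x. (deriv ^^ 3) \<psi> x > 0"
  proof -
    have pos3: "H 3 x > 0" for x using that by (simp add: H_def)
    show "is_model (2 * r + 2) (g_flat r) [AU r, AU1 r] (gM r \<psi>)" by (rule is_model_1[OF D(1-3) pos pos3])
    show "\<not> curv_hom (2 * r + 2) (gM r \<psi>) 2" by (rule not_curv_hom_2[OF D pos3])
  qed
  show ?thesis
    by (intro conjI ballI allI impI) (assumption | rule p1 p2 p3 p4 p5 p6 p7 irreducible_model_AU)+
qed

end
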